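(* Let $X_j=\sum_{k=0}^\infty a_k\zeta_{j-k}$, $j\in\mathbb{Z}$, be a linear process with real coefficients satisfying $\sum_{k=0}^\infty a_k^2<\infty$ and i.i.d. real random variables $\zeta_j$, $j\in\mathbb{Z}$, with $E\zeta_0=0$, $E\zeta_0^2=1$ and $E\zeta_0^4<\infty$. Let $b_{n,j}$ be a triangular array of real weights such that, as $n\to\infty$, $$\frac{\max_{j=1,\ldots,\nu}|b_{n,j}|}{\left(\sum_{j=1}^{\nu}b_{n,j}^2\right)^{1/2}}\to0 .$$ Suppose in addition that the spectral density satisfies $0<C_1\le f_X(u)\le C_2<\infty$, $u\in\Pi=[-\pi,\pi]$, for some constants $C_1,C_2$, and that the transfer function $A_X$ is continuous on $\Pi$. Then, as $n\to\infty$, $$\operatorname{Var}(Q_{n,X})=v_n^2+o(v_n^2),\qquad v_n^{-1}(Q_{n,X}-EQ_{n,X})\to_D\mathcal{N}(0,1).$$ If, in addition, $f_X\in\Lambda_\beta(\Pi)$ with $\beta>1/2$, then $$EQ_{n,X}=\sum_{j=1}^{\nu}b_{n,j}f_{X,j}+o(v_n),\qquad v_n^{-1}\Bigl(Q_{n,X}-\sum_{j=1}^{\nu}b_{n,j}f_{X,j}\Bigr)\to_D\mathcal{N}(0,1).$$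
   Context: $[\cdot]$ denotes integer part, $\nu=[n/2]-1$, and $u_j=2\pi j/n$. The transfer function is $A_X(u)=\sum_{k=0}^\infty e^{-\mathrm{i}ku}a_k$, $u\in\Pi$ (an $L^2(\Pi)$ series; pointwise conditions refer to a fixed version), and $f_X(u)=|A_X(u)|^2/(2\pi)$, $f_{X,j}=f_X(u_j)$. The periodogram is $I_X(u_j)=(2\pi n)^{-1}\bigl|\sum_{t=1}^n e^{\mathrm{i}tu_j}X_t\bigr|^2$. Define $$Q_{n,X}=\sum_{j=1}^{\nu}b_{n,j}I_X(u_j),\qquad v_n^2=\sum_{j=1}^{\nu}(b_{n,j}f_{X,j})^2+\operatorname{Cum}_4(\zeta_0)\frac1n\Bigl(\sum_{j=1}^{\nu}b_{n,j}f_{X,j}\Bigr)^2,$$ with $v_n\ge0$ and $\operatorname{Cum}_4(\zeta_0)$ the fourth cumulant of $\zeta_0$ (here $E\zeta_0^4-3$). For $\beta\in(0,1]$, $\Lambda_\beta(\Pi)$ is the class of (complex valued) Lipschitz functions on $\Pi$ with parameter $\beta$, i.e. $|h(u)-h(v)|\le C|u-v|^\beta$ for all $u,v\in\Pi$ and some $C<\infty$. $\to_D$ denotes convergence in distribution.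
   Formalization: Added: if E ζ_0^4 = 1 (ζ_0 = ±1 a.s.), then v_n^2 ≥ c Σ b_{n,j}^2 for some c > 0 and all large n; without it X_j = ζ_j with b_{n,j} = 1 has a non-normal limit along even n. Also Σ b_{n,j}^2 ≠ 0 for large n, so that the ratio is defined. *)

theory Defs
  imports "HOL-Probability.Probability" "HOL-Library.Landau_Symbols"
begin

abbreviation Pi_int :: "real set" where
  "Pi_int \<equiv> {-pi..pi}"

text \<open>Number of Fourier frequencies used, \<open>[n/2] - 1\<close>.  For \<open>n < 2\<close> truncated subtraction
  gives \<open>0\<close> instead of \<open>-1\<close>; the index range \<open>{1..nu n}\<close> is empty in both cases.\<close>

definition nu :: "nat \<Rightarrow> nat" where
  "nu n = n div 2 - 1"

definition freq :: "nat \<Rightarrow> nat \<Rightarrow> real" where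
  "freq n j = 2 * pi * real j / real n"

text \<open>The series defining the linear process converges in \<open>L\<^sup>2(M)\<close>.  Stating this with
  nonnegative integrals makes square integrability of the limit part of the convergence.\<close>

definition linear_process ::
  "'w measure \<Rightarrow> (nat \<Rightarrow> real) \<Rightarrow> (int \<Rightarrow> 'w \<Rightarrow> real) \<Rightarrow> (int \<Rightarrow> 'w \<Rightarrow> real) \<Rightarrow> bool" where
  "linear_process M a \<zeta> X \<longleftrightarrow>
     (\<forall>j. X j \<in> borel_measurable M \<and>
        (\<lambda>N. \<integral>\<^sup>+\<omega>. ennreal ((X j \<omega> - (\<Sum>k<N. a k * \<zeta> (j - int k) \<omega>))\<^sup>2) \<partial>M)
          \<longlonglongrightarrow> 0)"

text \<open>\<open>A\<close> is a version of the \<open>L\<^sup>2([-\<pi>, \<pi>])\<close> sum of \<open>e\<^sup>-\<^sup>i\<^sup>k\<^sup>u a\<^sub>k\<close>; only its values on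
  \<open>[-\<pi>, \<pi>]\<close> matter.\<close>

definition transfer_function :: "(nat \<Rightarrow> real) \<Rightarrow> (real \<Rightarrow> complex) \<Rightarrow> bool" where
  "transfer_function a A \<longleftrightarrow>
     set_borel_measurable lborel Pi_int A \<and>
     (\<lambda>N. \<integral>\<^sup>+u\<in>Pi_int. ennreal ((cmod (A u -
            (\<Sum>k<N. exp (- \<i> * of_nat k * complex_of_real u) * complex_of_real (a k))))\<^sup>2) \<partial>lborel)
       \<longlonglongrightarrow> 0"

definition spec_dens :: "(real \<Rightarrow> complex) \<Rightarrow> real \<Rightarrow> real" where
  "spec_dens A u = (cmod (A u))\<^sup>2 / (2 * pi)"

definition periodogram :: "(int \<Rightarrow> 'w \<Rightarrow> real) \<Rightarrow> nat \<Rightarrow> real \<Rightarrow> 'w \<Rightarrow> real" where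
  "periodogram X n u \<omega> =
     (cmod (\<Sum>t=1..n. exp (\<i> * of_nat t * complex_of_real u) * complex_of_real (X (int t) \<omega>)))\<^sup>2
       / (2 * pi * real n)"

definition Q_stat :: "(nat \<Rightarrow> nat \<Rightarrow> real) \<Rightarrow> (int \<Rightarrow> 'w \<Rightarrow> real) \<Rightarrow> nat \<Rightarrow> 'w \<Rightarrow> real" where
  "Q_stat b X n \<omega> = (\<Sum>j=1..nu n. b n j * periodogram X n (freq n j) \<omega>)"

definition bf_sum :: "(nat \<Rightarrow> nat \<Rightarrow> real) \<Rightarrow> (real \<Rightarrow> complex) \<Rightarrow> nat \<Rightarrow> real" where
  "bf_sum b A n = (\<Sum>j=1..nu n. b n j * spec_dens A (freq n j))"

text \<open>Fourth cumulant; for \<open>Y\<close> with mean \<open>0\<close> and variance \<open>1\<close> it is \<open>E Y\<^sup>4 - 3\<close>.\<close>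

definition cum4 :: "'w measure \<Rightarrow> ('w \<Rightarrow> real) \<Rightarrow> real" where
  "cum4 M Y = prob_space.expectation M (\<lambda>\<omega>. (Y \<omega> - prob_space.expectation M Y) ^ 4)
     - 3 * (prob_space.variance M Y)\<^sup>2"

text \<open>The radicand is nonnegative when \<open>Z\<close> is standardized, since then \<open>cum4 M Z \<ge> -2\<close>,
  \<open>2 * nu n \<le> n\<close> and Cauchy-Schwarz applies.  If \<open>cum4 M Z > -2\<close>, i.e. \<open>E Z\<^sup>4 > 1\<close>, it is at least a
  fixed positive multiple of the first sum.  If \<open>E Z\<^sup>4 = 1\<close>, i.e. \<open>Z\<^sup>2 = 1\<close> almost surely, the two
  terms can cancel to leading order (take \<open>b n j * spec_dens A (freq n j)\<close> constant).\<close>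

definition v_norm ::
  "'w measure \<Rightarrow> ('w \<Rightarrow> real) \<Rightarrow> (nat \<Rightarrow> nat \<Rightarrow> real) \<Rightarrow> (real \<Rightarrow> complex) \<Rightarrow> nat \<Rightarrow> real" where
  "v_norm M Z b A n =
     sqrt ((\<Sum>j=1..nu n. (b n j * spec_dens A (freq n j))\<^sup>2)
           + cum4 M Z * (1 / real n) * (bf_sum b A n)\<^sup>2)"

definition Lipschitz_class :: "real \<Rightarrow> (real \<Rightarrow> complex) set" where
  "Lipschitz_class \<beta> =
     {h. \<exists>C. \<forall>u\<in>Pi_int. \<forall>v\<in>Pi_int. cmod (h u - h v) \<le> C * \<bar>u - v\<bar> powr \<beta>}"

definition tends_to_std_normal :: "'w measure \<Rightarrow> (nat \<Rightarrow> 'w \<Rightarrow> real) \<Rightarrow> bool" where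
  "tends_to_std_normal M Y \<longleftrightarrow>
     weak_conv_m (\<lambda>n. distr M borel (Y n)) std_normal_distribution"

end

theory Submission
  imports Defs
begin

text \<open>Let \<open>u\<^sub>j\<close> be the Fourier frequencies, \<open>c\<^sub>j = b\<^sub>j f(u\<^sub>j)\<close>, and let \<open>S\<close> be the sum of the periodogram
  ordinates of the innovations, normalized to mean one, with weights \<open>c\<^sub>j\<close>.  By discrete
  orthogonality, \<open>S\<close> is a quadratic form in i.i.d. variables whose matrix \<open>C\<close> is circulant, with
  \<open>Var S = v\<^sub>n\<^sup>2\<close> exactly, with all rows of the same norm, and with \<open>\<parallel>C\<^sup>2\<parallel>\<close> small against \<open>\<parallel>C\<parallel>\<^sup>2\<close>
  (Frobenius norms) by the condition on the maximal weight.

  Normality of \<open>F = (S - E S) / v\<^sub>n\<close>: let \<open>h\<^sub>t\<close> be the part of \<open>F\<close> that involves \<open>\<zeta>\<^sub>t\<close>.  Expanding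
  \<open>exp(i\<xi>F)\<close> in \<open>h\<^sub>t\<close> inside \<open>E F exp(i\<xi>F)\<close> shows that the characteristic function satisfies
  \<open>\<phi>' = -\<xi> \<phi> + o(1)\<close>.  The remainders are small because every single innovation has influence
  \<open>O(n powr -1/2)\<close>, and the quadratic form with matrix \<open>C\<^sup>2\<close> that replaces the variance concentrates.

  Reduction of \<open>Q\<close> to \<open>S\<close>: the matrix of \<open>Q - S\<close> is a sum of products of a factor whose operator
  norm is bounded by \<open>sup |A|\<close> (Parseval) and a factor whose Frobenius norm is the Fejer mean of
  \<open>|A(u) - A(u\<^sub>j)|\<^sup>2\<close>, weighted by \<open>b\<^sub>j\<^sup>2\<close>.  As \<open>A\<close> is continuous, these means are negligible except at
  boundedly many frequencies next to \<open>\<pi>\<close>, whose total weight is negligible.  The means of \<open>Q\<close> are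
  Fejer means of \<open>f\<close>, which gives the last part.\<close>

subsection \<open>Quadratic forms in the innovations\<close>

text \<open>Only four moments are available, so \<open>(z t)\<^sup>2 - 1\<close> need not have a
  third absolute moment and a cubic remainder bound is out of reach for the diagonal. The Taylor
  remainder is therefore capped by \<open>min (x\<^sup>2 / 2) (2 * |x|)\<close>, and its diagonal
  part vanishes by dominated convergence, without a rate.

  The process is only an L2 limit, so \<open>Q - S\<close> involves infinitely many innovations.
  Matrix estimates are made for the filter cut at \<open>N\<close>, but in terms of \<open>A\<close>
  itself, because partial sums of the Fourier series of a continuous function need not be bounded
  uniformly in \<open>N\<close>. The price is a term \<open>n * transfer_err\<close>, which vanishes
  as \<open>N\<close> grows with \<open>n\<close> fixed; Fatou's lemma then carries the bound to the
  full filter.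

  Every error is measured against the sum of the squared weights, so \<open>v_norm\<close> squared
  must dominate a multiple of that sum. If the fourth moment exceeds 1, this is Cauchy-Schwarz with
  \<open>2 * nu n \<le> n\<close>; if it equals 1, the two terms of the variance may cancel, and the
  hypothesis \<open>nondegenerate\<close> supplies the bound.\<close>

locale iid_innovations = prob_space M for M :: "'w measure" +
  fixes z :: "int \<Rightarrow> 'w \<Rightarrow> real"
  assumes indep_z: "indep_vars (\<lambda>_. borel) z UNIV"
    and ident_z: "\<And>j. distr M borel (z j) = distr M borel (z 0)"
    and fourth_z: "integrable M (\<lambda>\<omega>. z 0 \<omega> ^ 4)"
    and mean_z: "expectation (z 0) = 0"
    and second_z: "expectation (\<lambda>\<omega>. (z 0 \<omega>)\<^sup>2) = 1"
begin

definition mu3 :: real where "mu3 = expectation (\<lambda>\<omega>. z 0 \<omega> ^ 3)"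
definition mu4 :: real where "mu4 = expectation (\<lambda>\<omega>. z 0 \<omega> ^ 4)"

lemma z_measurable [measurable]: "z t \<in> borel_measurable M"
  using indep_z unfolding indep_vars_def2 by simp

lemma expectation_ident:
  fixes f :: "real \<Rightarrow> 'b::{banach, second_countable_topology}"
  assumes [measurable]: "f \<in> borel_measurable borel"
  shows "expectation (\<lambda>\<omega>. f (z t \<omega>)) = expectation (\<lambda>\<omega>. f (z 0 \<omega>))"
  using integral_distr[of "z t" M borel f] integral_distr[of "z 0" M borel f] ident_z[of t]
  by simp

lemma integrable_ident:
  fixes f :: "real \<Rightarrow> 'b::{banach, second_countable_topology}"
  assumes [measurable]: "f \<in> borel_measurable borel"
  shows "integrable M (\<lambda>\<omega>. f (z t \<omega>)) \<longleftrightarrow> integrable M (\<lambda>\<omega>. f (z 0 \<omega>))"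
  using integrable_distr_eq[of "z t" M borel f] integrable_distr_eq[of "z 0" M borel f] ident_z[of t]
  by simp

lemma power_le_one_plus_fourth:
  fixes x :: real assumes "k \<le> 4" shows "\<bar>x\<bar> ^ k \<le> 1 + x ^ 4"
proof (cases "\<bar>x\<bar> \<le> 1")
  case True
  then have "\<bar>x\<bar> ^ k \<le> 1" by (simp add: power_le_one)
  then show ?thesis by (smt (verit) zero_le_even_power even_numeral)
next
  case False
  then have "\<bar>x\<bar> ^ k \<le> \<bar>x\<bar> ^ 4" using assms by (intro power_increasing) auto
  then show ?thesis by (simp add: power_even_abs)
qed

lemma integrable_abs_power_z: "k \<le> 4 \<Longrightarrow> integrable M (\<lambda>\<omega>. \<bar>z t \<omega>\<bar> ^ k)"
proof -
  assume k: "k \<le> 4"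
  have "integrable M (\<lambda>\<omega>. \<bar>z 0 \<omega>\<bar> ^ k)"
    by (rule Bochner_Integration.integrable_bound[where f="\<lambda>\<omega>. 1 + z 0 \<omega> ^ 4"])
       (use fourth_z power_le_one_plus_fourth[OF k] in \<open>auto intro!: AE_I2 simp: power_abs\<close>)
  then show ?thesis using integrable_ident[of "\<lambda>x. \<bar>x\<bar> ^ k" t] by simp
qed

lemma integrable_power_z: "k \<le> 4 \<Longrightarrow> integrable M (\<lambda>\<omega>. z t \<omega> ^ k)"
  by (rule Bochner_Integration.integrable_bound[OF integrable_abs_power_z]) (auto simp: power_abs)

lemma integrable_z: "integrable M (z t)"
  using integrable_power_z[of 1 t] by simp

lemma expectation_z: "expectation (z t) = 0"
  using expectation_ident[of "\<lambda>x. x" t] mean_z by simp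

lemma expectation_z2: "expectation (\<lambda>\<omega>. (z t \<omega>)\<^sup>2) = 1"
  using expectation_ident[of "\<lambda>x. x\<^sup>2" t] second_z by simp

lemma expectation_z3: "expectation (\<lambda>\<omega>. (z t \<omega>) ^ 3) = mu3"
  using expectation_ident[of "\<lambda>x. x ^ 3" t] by (simp add: mu3_def)

lemma expectation_z4: "expectation (\<lambda>\<omega>. (z t \<omega>) ^ 4) = mu4"
  using expectation_ident[of "\<lambda>x. x ^ 4" t] by (simp add: mu4_def)

text \<open>Centred square, the contribution of a diagonal entry to a centred quadratic form. Four
  moments of the innovations give \<open>eta (z t)\<close> two moments and in general no
  more.\<close>

definition eta :: "real \<Rightarrow> real" where "eta x = x\<^sup>2 - 1"

lemma eta_measurable [measurable]: "eta \<in> borel_measurable borel"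
  unfolding eta_def by measurable

lemma eta_moments:
  shows "integrable M (\<lambda>\<omega>. eta (z t \<omega>))"
    and "expectation (\<lambda>\<omega>. eta (z t \<omega>)) = 0"
    and "integrable M (\<lambda>\<omega>. (eta (z t \<omega>))\<^sup>2)"
    and "expectation (\<lambda>\<omega>. (eta (z t \<omega>))\<^sup>2) = mu4 - 1"
    and "integrable M (\<lambda>\<omega>. eta (z t \<omega>) * z t \<omega>)"
    and "expectation (\<lambda>\<omega>. eta (z t \<omega>) * z t \<omega>) = mu3"
proof -
  note i = integrable_power_z[of 2 t] integrable_power_z[of 3 t] integrable_power_z[of 4 t] integrable_z[of t]
  note e = expectation_z[of t] expectation_z2[of t] expectation_z3[of t] expectation_z4[of t]
  have sq: "(eta x)\<^sup>2 = x ^ 4 - 2 * x\<^sup>2 + 1" and ez: "eta x * x = x ^ 3 - x" for x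
    by (simp_all add: eta_def power2_eq_square power4_eq_xxxx power3_eq_cube algebra_simps)
  show "integrable M (\<lambda>\<omega>. eta (z t \<omega>))" "expectation (\<lambda>\<omega>. eta (z t \<omega>)) = 0"
    using i e by (simp_all add: eta_def prob_space)
  show "integrable M (\<lambda>\<omega>. (eta (z t \<omega>))\<^sup>2)" "expectation (\<lambda>\<omega>. (eta (z t \<omega>))\<^sup>2) = mu4 - 1"
    unfolding sq using i e by (simp_all add: prob_space)
  show "integrable M (\<lambda>\<omega>. eta (z t \<omega>) * z t \<omega>)" "expectation (\<lambda>\<omega>. eta (z t \<omega>) * z t \<omega>) = mu3"
    unfolding ez using i e by simp_all
qed

lemma mu4_ge_1: "1 \<le> mu4"
proof -
  have "0 \<le> expectation (\<lambda>\<omega>. (eta (z 0 \<omega>))\<^sup>2)" by simp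
  then show ?thesis unfolding eta_moments(4) by simp
qed

text \<open>Measurability with respect to the innovations indexed by \<open>T\<close>, encoded as a
  factorization through the restricted family. In this form closure under sums, products and Borel
  maps is composition of functions, and independence from a coordinate outside \<open>T\<close>
  comes from disjoint index blocks. The value type is general because real forms and complex
  exponentials both occur.\<close>

definition dep :: "int set \<Rightarrow> ('w \<Rightarrow> 'b::topological_space) \<Rightarrow> bool" where
  "dep T h \<longleftrightarrow> (\<exists>g \<in> borel_measurable (Pi\<^sub>M T (\<lambda>_. borel)). h = (\<lambda>\<omega>. g (restrict (\<lambda>s. z s \<omega>) T)))"

lemma dep_z: "s \<in> T \<Longrightarrow> dep T (z s)"
  unfolding dep_def by (intro bexI[where x="\<lambda>x. x s"]) auto

lemma dep_const: "dep T (\<lambda>_. c)"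
  unfolding dep_def by (intro bexI[where x="\<lambda>_. c"]) auto

lemma dep_compose: "dep T h \<Longrightarrow> \<phi> \<in> borel_measurable borel \<Longrightarrow> dep T (\<lambda>\<omega>. \<phi> (h \<omega>))"
  unfolding dep_def
  by (elim bexE, rule_tac x="\<lambda>x. \<phi> (g x)" in bexI) auto

lemma dep_add:
  fixes h1 h2 :: "'w \<Rightarrow> 'b::{second_countable_topology, real_normed_algebra}"
  shows "dep T h1 \<Longrightarrow> dep T h2 \<Longrightarrow> dep T (\<lambda>\<omega>. h1 \<omega> + h2 \<omega>)"
  unfolding dep_def
  by (elim bexE, rule_tac x="\<lambda>x. g x + ga x" in bexI) auto

lemma dep_mult:
  fixes h1 h2 :: "'w \<Rightarrow> 'b::{second_countable_topology, real_normed_algebra}"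
  shows "dep T h1 \<Longrightarrow> dep T h2 \<Longrightarrow> dep T (\<lambda>\<omega>. h1 \<omega> * h2 \<omega>)"
  unfolding dep_def
  by (elim bexE, rule_tac x="\<lambda>x. g x * ga x" in bexI) auto

lemma dep_diff:
  fixes h1 h2 :: "'w \<Rightarrow> 'b::{second_countable_topology, real_normed_algebra}"
  shows "dep T h1 \<Longrightarrow> dep T h2 \<Longrightarrow> dep T (\<lambda>\<omega>. h1 \<omega> - h2 \<omega>)"
  unfolding dep_def
  by (elim bexE, rule_tac x="\<lambda>x. g x - ga x" in bexI) auto

lemma dep_sum:
  fixes h :: "'c \<Rightarrow> 'w \<Rightarrow> 'b::{second_countable_topology, real_normed_algebra}"
  shows "(\<And>i. i \<in> I \<Longrightarrow> dep T (h i)) \<Longrightarrow> dep T (\<lambda>\<omega>. \<Sum>i\<in>I. h i \<omega>)"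
proof (induction I rule: infinite_finite_induct)
  case (insert x F) then show ?case by (simp add: dep_add)
qed (simp_all add: dep_const)

lemma dep_measurable:
  fixes h :: "'w \<Rightarrow> 'b::topological_space"
  assumes "dep T h" shows "h \<in> borel_measurable M"
proof -
  obtain g where g[measurable]: "g \<in> borel_measurable (Pi\<^sub>M T (\<lambda>_. borel))"
    and h: "h = (\<lambda>\<omega>. g (restrict (\<lambda>s. z s \<omega>) T))"
    using assms unfolding dep_def by auto
  show ?thesis unfolding h by measurable
qed

lemma dep_indep:
  fixes h :: "'w \<Rightarrow> 'b::topological_space"
  assumes "t \<notin> T" "dep T h" "f \<in> borel_measurable borel"
  shows "indep_var borel (\<lambda>\<omega>. f (z t \<omega>)) borel h"
proof -
  obtain g where g: "g \<in> borel_measurable (Pi\<^sub>M T (\<lambda>_. borel))"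
    and h: "h = (\<lambda>\<omega>. g (restrict (\<lambda>s. z s \<omega>) T))"
    using assms unfolding dep_def by auto
  have "indep_var borel ((\<lambda>x. f (x t)) \<circ> (\<lambda>\<omega>. restrict (\<lambda>s. z s \<omega>) {t})) borel (g \<circ> (\<lambda>\<omega>. restrict (\<lambda>s. z s \<omega>) T))"
    by (rule indep_var_compose[OF indep_var_restrict[OF indep_z]]) (use assms g in auto)
  then show ?thesis unfolding h o_def by simp
qed

text \<open>Stands in for conditioning on all coordinates except \<open>t\<close>: the factor in
  \<open>z t\<close> is integrated out against a coefficient that does not see it.\<close>

lemma indep_factor:
  fixes f :: "real \<Rightarrow> 'b::{real_normed_field, banach, second_countable_topology}"
  assumes "t \<notin> T" "dep T h" "f \<in> borel_measurable borel"
    and "integrable M (\<lambda>\<omega>. f (z t \<omega>))" "integrable M h"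
  shows "integrable M (\<lambda>\<omega>. f (z t \<omega>) * h \<omega>)"
    and "expectation (\<lambda>\<omega>. f (z t \<omega>) * h \<omega>) = expectation (\<lambda>\<omega>. f (z t \<omega>)) * expectation h"
  using indep_var_integrable[OF dep_indep[OF assms(1-3)] assms(4,5)]
    indep_var_lebesgue_integral[OF dep_indep[OF assms(1-3)] assms(4,5)] by auto

definition lin :: "(int \<Rightarrow> real) \<Rightarrow> int set \<Rightarrow> 'w \<Rightarrow> real" where
  "lin d T \<omega> = (\<Sum>s\<in>T. d s * z s \<omega>)"

text \<open>The trace is the mean of the uncentred form, because the innovations are uncorrelated
  with unit variance.\<close>

definition qf :: "(int \<Rightarrow> int \<Rightarrow> real) \<Rightarrow> int set \<Rightarrow> 'w \<Rightarrow> real" where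
  "qf B T \<omega> = (\<Sum>s\<in>T. \<Sum>t\<in>T. B s t * z s \<omega> * z t \<omega>) - (\<Sum>t\<in>T. B t t)"

lemma dep_lin: "dep T (lin d T)"
  unfolding lin_def by (intro dep_sum dep_mult dep_const dep_z)

lemma dep_qf: "dep T (qf B T)"
  unfolding qf_def by (intro dep_diff dep_sum dep_mult dep_const dep_z)

lemma lin_measurable [measurable]: "lin d T \<in> borel_measurable M"
  by (rule dep_measurable[OF dep_lin])

lemma qf_measurable [measurable]: "qf B T \<in> borel_measurable M"
  by (rule dep_measurable[OF dep_qf])

lemma lin_insert: "finite T \<Longrightarrow> t \<notin> T \<Longrightarrow> lin d (insert t T) \<omega> = d t * z t \<omega> + lin d T \<omega>"
  by (simp add: lin_def)

text \<open>Isolates the influence of one coordinate; the factor 2 collects the row and the column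
  of \<open>t\<close>. It serves both the induction for the moments and the leave-one-out expansion
  of the characteristic function.\<close>

lemma qf_insert:
  assumes "finite T" "t \<notin> T" and sym: "\<And>s. s \<in> T \<Longrightarrow> B s t = B t s"
  shows "qf B (insert t T) \<omega> = qf B T \<omega> + (B t t * eta (z t \<omega>) + 2 * z t \<omega> * lin (B t) T \<omega>)"
proof -
  have "(\<Sum>s\<in>T. B s t * z s \<omega> * z t \<omega>) = z t \<omega> * lin (B t) T \<omega>"
    unfolding lin_def sum_distrib_left by (intro sum.cong) (auto simp: sym)
  moreover have "(\<Sum>s\<in>T. B t s * z t \<omega> * z s \<omega>) = z t \<omega> * lin (B t) T \<omega>"
    unfolding lin_def sum_distrib_left by (intro sum.cong) auto
  ultimately show ?thesis using assms(1,2)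
    by (simp add: qf_def sum.distrib eta_def power2_eq_square algebra_simps)
qed

lemma integrable_mult_of_squares:
  fixes f g :: "'w \<Rightarrow> real"
  assumes [measurable]: "f \<in> borel_measurable M" "g \<in> borel_measurable M"
    and "integrable M (\<lambda>\<omega>. (f \<omega>)\<^sup>2)" "integrable M (\<lambda>\<omega>. (g \<omega>)\<^sup>2)"
  shows "integrable M (\<lambda>\<omega>. f \<omega> * g \<omega>)"
proof (rule Bochner_Integration.integrable_bound)
  show "integrable M (\<lambda>\<omega>. (f \<omega>)\<^sup>2 + (g \<omega>)\<^sup>2)" using assms by simp
  have "\<bar>x * y\<bar> \<le> x\<^sup>2 + y\<^sup>2" for x y :: real
  proof -
    have "2 * \<bar>x\<bar> * \<bar>y\<bar> \<le> \<bar>x\<bar>\<^sup>2 + \<bar>y\<bar>\<^sup>2" by (rule sum_squares_bound)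
    moreover have "0 \<le> \<bar>x\<bar> * \<bar>y\<bar>" by simp
    ultimately show ?thesis unfolding abs_mult power2_abs by linarith
  qed
  then show "AE \<omega> in M. norm (f \<omega> * g \<omega>) \<le> norm ((f \<omega>)\<^sup>2 + (g \<omega>)\<^sup>2)"
    by (intro AE_I2) simp
qed auto

lemma integrable_of_square:
  fixes f :: "'w \<Rightarrow> real"
  assumes [measurable]: "f \<in> borel_measurable M" and "integrable M (\<lambda>\<omega>. (f \<omega>)\<^sup>2)"
  shows "integrable M f"
  using integrable_mult_of_squares[of f "\<lambda>_. 1"] assms by simp

lemma lin_moments:
  assumes "finite T"
  shows "integrable M (\<lambda>\<omega>. (lin d T \<omega>)\<^sup>2) \<and> expectation (lin d T) = 0
    \<and> expectation (\<lambda>\<omega>. (lin d T \<omega>)\<^sup>2) = (\<Sum>s\<in>T. (d s)\<^sup>2)"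
  using assms
proof (induction T)
  case empty then show ?case by (simp add: lin_def)
next
  case (insert t T)
  then have i2: "integrable M (\<lambda>\<omega>. (lin d T \<omega>)\<^sup>2)" and e1: "expectation (lin d T) = 0"
    and e2: "expectation (\<lambda>\<omega>. (lin d T \<omega>)\<^sup>2) = (\<Sum>s\<in>T. (d s)\<^sup>2)" by auto
  have i1: "integrable M (lin d T)" using i2 by (rule integrable_of_square[rotated]) simp
  have c: "integrable M (\<lambda>\<omega>. z t \<omega> * lin d T \<omega>)" "expectation (\<lambda>\<omega>. z t \<omega> * lin d T \<omega>) = 0"
    using indep_factor[of t T "lin d T" "\<lambda>x. x", OF insert(2) dep_lin _ integrable_z i1]
    by (auto simp: expectation_z)
  have sq: "(lin d (insert t T) \<omega>)\<^sup>2 = (d t)\<^sup>2 * (z t \<omega>)\<^sup>2 + 2 * d t * (z t \<omega> * lin d T \<omega>) + (lin d T \<omega>)\<^sup>2" for \<omega>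
    unfolding lin_insert[OF insert(1,2)] by (simp add: power2_eq_square algebra_simps)
  have li: "lin d (insert t T) = (\<lambda>\<omega>. d t * z t \<omega> + lin d T \<omega>)"
    unfolding lin_insert[OF insert(1,2), abs_def] by simp
  have "integrable M (\<lambda>\<omega>. (lin d (insert t T) \<omega>)\<^sup>2)"
    "expectation (\<lambda>\<omega>. (lin d (insert t T) \<omega>)\<^sup>2) = (d t)\<^sup>2 + (\<Sum>s\<in>T. (d s)\<^sup>2)"
    unfolding sq using c i2 integrable_power_z[of 2 t] by (simp_all add: e2 expectation_z2)
  moreover have "expectation (lin d (insert t T)) = 0"
    unfolding li using i1 integrable_z[of t] by (simp add: e1 expectation_z)
  ultimately show ?case using insert(1,2) by simp
qed

lemma integrable_lin: "finite T \<Longrightarrow> integrable M (lin d T)"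
  using lin_moments[of T d] integrable_of_square[of "lin d T"] by simp

text \<open>Induction over the coordinates. Of the six terms in the square of the enlarged form,
  only the old square, the one with \<open>eta\<^sup>2\<close> and the one with
  \<open>z\<^sup>2 * lin\<^sup>2\<close> have nonzero mean; with
  \<open>mu4 - 1 = (mu4 - 3) + 2\<close> they add the new diagonal entry and twice the new row and
  column.\<close>

lemma qf_moments:
  assumes "finite T" and "\<And>s t. s \<in> T \<Longrightarrow> t \<in> T \<Longrightarrow> B s t = B t s"
  shows "integrable M (\<lambda>\<omega>. (qf B T \<omega>)\<^sup>2) \<and> expectation (qf B T) = 0
    \<and> expectation (\<lambda>\<omega>. (qf B T \<omega>)\<^sup>2) = (mu4 - 3) * (\<Sum>t\<in>T. (B t t)\<^sup>2) + 2 * (\<Sum>s\<in>T. \<Sum>t\<in>T. (B s t)\<^sup>2)"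
  using assms
proof (induction T)
  case empty then show ?case by (simp add: qf_def)
next
  case (insert t T)
  let ?L = "lin (B t) T" and ?q = "qf B T"
  have i2: "integrable M (\<lambda>\<omega>. (?q \<omega>)\<^sup>2)" and e1: "expectation ?q = 0"
    and e2: "expectation (\<lambda>\<omega>. (?q \<omega>)\<^sup>2) = (mu4 - 3) * (\<Sum>t\<in>T. (B t t)\<^sup>2) + 2 * (\<Sum>s\<in>T. \<Sum>t\<in>T. (B s t)\<^sup>2)"
    using insert by auto
  have sym: "s \<in> T \<Longrightarrow> B s t = B t s" for s using insert by auto
  note L = lin_moments[OF insert(1), of "B t"]
  have qi0: "qf B (insert t T) \<omega> = ?q \<omega> + (B t t * eta (z t \<omega>) + 2 * z t \<omega> * ?L \<omega>)" for \<omega>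
    by (rule qf_insert[OF insert(1,2)]) (rule sym)
  have i1: "integrable M ?q" using i2 by (rule integrable_of_square[rotated]) simp
  have iL: "integrable M ?L" using integrable_lin[OF insert(1)] .
  have iqL: "integrable M (\<lambda>\<omega>. ?q \<omega> * ?L \<omega>)"
    using L i2 by (intro integrable_mult_of_squares) auto
  note F = indep_factor[OF insert(2)]
  have c1: "integrable M (\<lambda>\<omega>. eta (z t \<omega>) * ?q \<omega>)" "expectation (\<lambda>\<omega>. eta (z t \<omega>) * ?q \<omega>) = 0"
    using F[OF dep_qf _ eta_moments(1) i1] by (auto simp: eta_moments)
  have c2: "integrable M (\<lambda>\<omega>. z t \<omega> * ?L \<omega>)" "expectation (\<lambda>\<omega>. z t \<omega> * ?L \<omega>) = 0"
    using F[OF dep_lin, of "\<lambda>x. x", OF _ integrable_z iL] by (auto simp: expectation_z)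
  have c3: "integrable M (\<lambda>\<omega>. z t \<omega> * (?q \<omega> * ?L \<omega>))" "expectation (\<lambda>\<omega>. z t \<omega> * (?q \<omega> * ?L \<omega>)) = 0"
    using F[OF dep_mult[OF dep_qf dep_lin], of "\<lambda>x. x", OF _ integrable_z iqL] by (auto simp: expectation_z)
  \<comment> \<open>The first factor has mean \<open>mu3\<close>, which need not vanish; the term
    dies because the linear form is centred.\<close>
  have c4: "integrable M (\<lambda>\<omega>. (eta (z t \<omega>) * z t \<omega>) * ?L \<omega>)" "expectation (\<lambda>\<omega>. (eta (z t \<omega>) * z t \<omega>) * ?L \<omega>) = 0"
    using F[OF dep_lin, of "\<lambda>x. eta x * x", OF _ eta_moments(5) iL] L by auto
  have c5: "integrable M (\<lambda>\<omega>. (z t \<omega>)\<^sup>2 * (?L \<omega>)\<^sup>2)" 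
     "expectation (\<lambda>\<omega>. (z t \<omega>)\<^sup>2 * (?L \<omega>)\<^sup>2) = (\<Sum>s\<in>T. (B t s)\<^sup>2)"
    using F[OF dep_compose[OF dep_lin, of "\<lambda>x. x\<^sup>2"], of "\<lambda>x. x\<^sup>2"] integrable_power_z[of 2 t] L
    by (auto simp: expectation_z2)
  have sq: "(qf B (insert t T) \<omega>)\<^sup>2 = (?q \<omega>)\<^sup>2 + (B t t)\<^sup>2 * (eta (z t \<omega>))\<^sup>2 + 4 * ((z t \<omega>)\<^sup>2 * (?L \<omega>)\<^sup>2)
     + 2 * B t t * (eta (z t \<omega>) * ?q \<omega>) + 4 * (z t \<omega> * (?q \<omega> * ?L \<omega>)) + 4 * B t t * ((eta (z t \<omega>) * z t \<omega>) * ?L \<omega>)" for \<omega>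
    unfolding qi0 by (simp add: power2_eq_square algebra_simps)
  have qi: "qf B (insert t T) = (\<lambda>\<omega>. ?q \<omega> + B t t * eta (z t \<omega>) + 2 * (z t \<omega> * ?L \<omega>))"
    unfolding fun_eq_iff qi0 by (auto simp: algebra_simps)
  have I: "integrable M (\<lambda>\<omega>. (qf B (insert t T) \<omega>)\<^sup>2)"
    unfolding sq using i2 c1 c2 c3 c4 c5 eta_moments(3)[of t] by simp
  have E1: "expectation (qf B (insert t T)) = 0"
    unfolding qi using i1 c2 eta_moments(1,2)[of t] e1 by simp
  have "expectation (\<lambda>\<omega>. (qf B (insert t T) \<omega>)\<^sup>2) = expectation (\<lambda>\<omega>. (?q \<omega>)\<^sup>2) + (B t t)\<^sup>2 * (mu4 - 1) + 4 * (\<Sum>s\<in>T. (B t s)\<^sup>2)"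
    unfolding sq using i2 c1 c2 c3 c4 c5 eta_moments(3,4)[of t] by simp
  moreover have "(\<Sum>s\<in>T. (B s t)\<^sup>2) = (\<Sum>s\<in>T. (B t s)\<^sup>2)" by (simp add: sym)
  ultimately have "expectation (\<lambda>\<omega>. (qf B (insert t T) \<omega>)\<^sup>2) = 
    (mu4 - 3) * (\<Sum>t\<in>insert t T. (B t t)\<^sup>2) + 2 * (\<Sum>s\<in>insert t T. \<Sum>t\<in>insert t T. (B s t)\<^sup>2)"
    using insert(1,2) by (simp add: e2 sum.distrib algebra_simps)
  then show ?case using I E1 by simp
qed

lemma integrable_qf:
  assumes "finite T" "\<And>s t. s \<in> T \<Longrightarrow> t \<in> T \<Longrightarrow> B s t = B t s"
  shows "integrable M (qf B T)"
  using qf_moments[of T B, OF assms] integrable_of_square[of "qf B T"] by simp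

text \<open>Bounding \<open>mu4 - 3\<close> by \<open>mu4\<close> on the diagonal avoids
  distinguishing the sign of the fourth cumulant.\<close>

lemma qf_second_moment_le:
  assumes "finite T" "\<And>s t. s \<in> T \<Longrightarrow> t \<in> T \<Longrightarrow> B s t = B t s"
  shows "expectation (\<lambda>\<omega>. (qf B T \<omega>)\<^sup>2) \<le> (mu4 + 2) * (\<Sum>s\<in>T. \<Sum>t\<in>T. (B s t)\<^sup>2)"
proof -
  have d: "(\<Sum>t\<in>T. (B t t)\<^sup>2) \<le> (\<Sum>s\<in>T. \<Sum>t\<in>T. (B s t)\<^sup>2)"
    using assms(1) by (intro sum_mono member_le_sum) auto
  have "(mu4 - 3) * (\<Sum>t\<in>T. (B t t)\<^sup>2) \<le> mu4 * (\<Sum>t\<in>T. (B t t)\<^sup>2)"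
    by (intro mult_right_mono) (auto intro: sum_nonneg)
  also have "\<dots> \<le> mu4 * (\<Sum>s\<in>T. \<Sum>t\<in>T. (B s t)\<^sup>2)"
    using d mu4_ge_1 by (intro mult_left_mono) auto
  finally show ?thesis using qf_moments[of T B, OF assms] by (simp add: algebra_simps)
qed

text \<open>The square of a linear form is, up to its mean, the quadratic form of a rank-one matrix
  whose Frobenius norm is the squared length of \<open>d\<close>. The fourth moment is thus a second
  moment of \<open>qf\<close>, and the mean adds 1 to the constant.\<close>

lemma lin_fourth_moment:
  assumes "finite T"
  shows "integrable M (\<lambda>\<omega>. (lin d T \<omega>) ^ 4)"
    and "expectation (\<lambda>\<omega>. (lin d T \<omega>) ^ 4) \<le> (mu4 + 3) * (\<Sum>s\<in>T. (d s)\<^sup>2)\<^sup>2"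
proof -
  let ?B = "\<lambda>s t. d s * d t" and ?D = "\<Sum>s\<in>T. (d s)\<^sup>2"
  have sym: "?B s t = ?B t s" for s t by simp
  have l: "(lin d T \<omega>)\<^sup>2 = qf ?B T \<omega> + ?D" for \<omega>
    unfolding qf_def lin_def power2_eq_square sum_product by (simp add: algebra_simps)
  have "(lin d T \<omega>) ^ 4 = ((lin d T \<omega>)\<^sup>2)\<^sup>2" for \<omega> by simp
  then have l4: "(lin d T \<omega>) ^ 4 = (qf ?B T \<omega>)\<^sup>2 + 2 * ?D * qf ?B T \<omega> + ?D\<^sup>2" for \<omega>
    unfolding l by (simp add: power2_eq_square algebra_simps)
  note q = qf_moments[of T ?B, OF assms sym] integrable_qf[of T ?B, OF assms sym]
  show "integrable M (\<lambda>\<omega>. (lin d T \<omega>) ^ 4)" unfolding l4 using q by simp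
  have "(\<Sum>s\<in>T. \<Sum>t\<in>T. (?B s t)\<^sup>2) = ?D\<^sup>2"
    unfolding power2_eq_square[of ?D] sum_product by (simp add: power_mult_distrib)
  then have "expectation (\<lambda>\<omega>. (qf ?B T \<omega>)\<^sup>2) \<le> (mu4 + 2) * ?D\<^sup>2"
    using qf_second_moment_le[of T ?B, OF assms sym] by simp
  then show "expectation (\<lambda>\<omega>. (lin d T \<omega>) ^ 4) \<le> (mu4 + 3) * ?D\<^sup>2"
    unfolding l4 using q by (simp add: prob_space algebra_simps)
qed

end

subsection \<open>Characteristic functions close to the Gaussian one\<close>

lemma norm_iexp_minus_1_le: "norm (iexp x - 1) \<le> \<bar>x\<bar>"
  using iexp_approx1[of x 0] by simp

lemma norm_iexp_minus_linear_le:
  "norm (iexp x - (1 + \<i> * x)) \<le> min (x\<^sup>2 / 2) (2 * \<bar>x\<bar>)"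
  using iexp_approx1[of x 1] iexp_approx2[of x 1] by (simp add: power2_eq_square)

text \<open>Majorant of \<open>|k| * |exp(i \<xi> h) - 1 - i \<xi> h|\<close> when
  \<open>|k|\<close> and \<open>|h|\<close> are at most \<open>x\<close> and
  \<open>|\<xi>| \<le> R\<close>. It is of third order for small \<open>x\<close> but grows only
  quadratically, so that two moments suffice for integrability.\<close>

definition cubic_cap :: "real \<Rightarrow> real \<Rightarrow> real" where
  "cubic_cap R x = x * min (R\<^sup>2 * x\<^sup>2 / 2) (2 * R * x)"

lemma cubic_cap_mono: "0 \<le> x \<Longrightarrow> x \<le> y \<Longrightarrow> 0 \<le> R \<Longrightarrow> cubic_cap R x \<le> cubic_cap R y"
  unfolding cubic_cap_def
  by (intro mult_mono min.mono divide_right_mono mult_left_mono power_mono) auto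

lemma cubic_cap_nonneg: "0 \<le> x \<Longrightarrow> 0 \<le> R \<Longrightarrow> 0 \<le> cubic_cap R x"
  unfolding cubic_cap_def by simp

text \<open>A sum is at most twice its larger term. The split is needed because the two parts of the
  influence of a coordinate, one in \<open>eta\<close> and one a product of independent factors,
  have different moments.\<close>

lemma cubic_cap_add:
  assumes "0 \<le> p" "0 \<le> q" "0 \<le> R"
  shows "cubic_cap R (p + q) \<le> cubic_cap R (2 * p) + cubic_cap R (2 * q)"
proof (cases "p \<le> q")
  case True
  then have "cubic_cap R (p + q) \<le> cubic_cap R (2 * q)" using assms by (intro cubic_cap_mono) auto
  then show ?thesis using cubic_cap_nonneg[of "2 * p" R] assms by simp
next
  case False
  then have "cubic_cap R (p + q) \<le> cubic_cap R (2 * p)" using assms by (intro cubic_cap_mono) auto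
  then show ?thesis using cubic_cap_nonneg[of "2 * q" R] assms by simp
qed

lemma cubic_cap_le_cube: "0 \<le> x \<Longrightarrow> cubic_cap R x \<le> R\<^sup>2 * x ^ 3 / 2"
proof -
  assume x: "0 \<le> x"
  have "cubic_cap R x \<le> x * (R\<^sup>2 * x\<^sup>2 / 2)"
    unfolding cubic_cap_def using x by (intro mult_left_mono) auto
  then show ?thesis by (simp add: power2_eq_square power3_eq_cube mult_ac)
qed

lemma sq_sum_times_sum_le:
  fixes a b :: real assumes "0 \<le> a" "0 \<le> b"
  shows "(a\<^sup>2 + b\<^sup>2) * (a + b) \<le> 2 * (a ^ 3 + b ^ 3)"
proof -
  have "0 \<le> (a + b) * (a - b)\<^sup>2" using assms by simp
  then show ?thesis by (simp add: power2_eq_square power3_eq_cube algebra_simps)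
qed

text \<open>The integrating factor \<open>exp (x\<^sup>2 / 2)\<close> turns
  \<open>D x + x * \<phi> x\<close> into a derivative, and the mean value inequality on
  \<open>{-R..R}\<close> does the rest.\<close>

lemma norm_close_to_gaussian_char:
  fixes \<phi> D :: "real \<Rightarrow> complex"
  assumes deriv: "\<And>\<xi>. (\<phi> has_vector_derivative D \<xi>) (at \<xi>)" and zero: "\<phi> 0 = 1"
    and bound: "\<And>\<xi>. \<bar>\<xi>\<bar> \<le> R \<Longrightarrow> norm (D \<xi> + \<xi> * \<phi> \<xi>) \<le> \<epsilon>"
    and \<xi>: "\<bar>\<xi>\<bar> \<le> R"
  shows "norm (\<phi> \<xi> - complex_of_real (exp (- (\<xi>\<^sup>2) / 2))) \<le> \<epsilon> * exp (R\<^sup>2 / 2) * R"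
proof -
  define \<psi> where "\<psi> x = exp (x\<^sup>2 / 2) *\<^sub>R \<phi> x" for x
  have d: "(\<psi> has_vector_derivative exp (x\<^sup>2 / 2) *\<^sub>R (D x + x * \<phi> x)) (at x within {-R..R})" for x
    unfolding \<psi>_def
    by (rule has_vector_derivative_at_within)
      (rule derivative_eq_intros deriv | simp add: scaleR_conv_of_real algebra_simps)+
  have e0: "0 \<le> \<epsilon>" using bound[OF \<xi>] norm_ge_zero order_trans by blast
  have "norm (\<psi> \<xi> - \<psi> 0) \<le> (\<epsilon> * exp (R\<^sup>2 / 2)) * norm (\<xi> - 0)"
  proof (rule differentiable_bound[where S="{-R..R}" and f'="\<lambda>x h. h *\<^sub>R (exp (x\<^sup>2 / 2) *\<^sub>R (D x + x * \<phi> x))"])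
    show "(\<psi> has_derivative (\<lambda>h. h *\<^sub>R (exp (x\<^sup>2 / 2) *\<^sub>R (D x + x * \<phi> x)))) (at x within {-R..R})" for x
      using d[of x] unfolding has_vector_derivative_def .
    fix x assume x: "x \<in> {-R..R}"
    then have "x\<^sup>2 \<le> R\<^sup>2" by (intro abs_le_square_iff[THEN iffD1]) auto
    moreover have "norm (D x + x * \<phi> x) \<le> \<epsilon>" using x by (intro bound) auto
    ultimately have "norm (exp (x\<^sup>2 / 2) *\<^sub>R (D x + x * \<phi> x)) \<le> \<epsilon> * exp (R\<^sup>2 / 2)"
      using e0 by (simp add: mult.commute[of \<epsilon>] del: of_real_add) (intro mult_mono, auto)
    then show "onorm (\<lambda>h. h *\<^sub>R (exp (x\<^sup>2 / 2) *\<^sub>R (D x + x * \<phi> x))) \<le> \<epsilon> * exp (R\<^sup>2 / 2)"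
    proof (intro onorm_bound)
      fix h :: real
      assume v: "norm (exp (x\<^sup>2 / 2) *\<^sub>R (D x + x * \<phi> x)) \<le> \<epsilon> * exp (R\<^sup>2 / 2)"
      show "norm (h *\<^sub>R (exp (x\<^sup>2 / 2) *\<^sub>R (D x + x * \<phi> x))) \<le> \<epsilon> * exp (R\<^sup>2 / 2) * norm h"
        using mult_right_mono[OF v abs_ge_zero[of h]] by (simp only: norm_scaleR real_norm_def mult.commute)
    qed (use e0 in auto)
  qed (use \<xi> in auto)
  moreover have "\<dots> \<le> (\<epsilon> * exp (R\<^sup>2 / 2)) * R"
    using \<xi> e0 by (intro mult_left_mono) auto
  ultimately have *: "norm (\<psi> \<xi> - 1) \<le> \<epsilon> * exp (R\<^sup>2 / 2) * R" by (simp add: \<psi>_def zero)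
  \<comment> \<open>Undoing the integrating factor costs nothing, as the Gaussian factor is at most
    one.\<close>
  have "\<phi> \<xi> - complex_of_real (exp (- (\<xi>\<^sup>2) / 2)) = exp (- (\<xi>\<^sup>2) / 2) *\<^sub>R (\<psi> \<xi> - 1)"
    by (simp add: \<psi>_def scaleR_diff_right exp_minus scaleR_conv_of_real right_diff_distrib mult.assoc[symmetric] flip: of_real_inverse of_real_mult)
  then have "norm (\<phi> \<xi> - complex_of_real (exp (- (\<xi>\<^sup>2) / 2))) = exp (- (\<xi>\<^sup>2) / 2) * norm (\<psi> \<xi> - 1)" by simp
  also have "\<dots> \<le> 1 * norm (\<psi> \<xi> - 1)" by (intro mult_right_mono) auto
  finally show ?thesis using * by simp
qed

lemma norm_integral_le:
  fixes f :: "'a \<Rightarrow> 'b::{banach, second_countable_topology}"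
  assumes "f \<in> borel_measurable M" "integrable M g" "\<And>\<omega>. norm (f \<omega>) \<le> g \<omega>"
  shows "norm (integral\<^sup>L M f) \<le> integral\<^sup>L M g"
proof -
  have "integrable M f"
    by (rule Bochner_Integration.integrable_bound[OF assms(2,1)]) (use assms(3) in \<open>auto intro!: AE_I2 order_trans[OF _ abs_ge_self]\<close>)
  then have "norm (integral\<^sup>L M f) \<le> (\<integral>\<omega>. norm (f \<omega>) \<partial>M)" "(\<integral>\<omega>. norm (f \<omega>) \<partial>M) \<le> integral\<^sup>L M g"
    using assms by (auto intro!: integral_mono)
  then show ?thesis by (rule order_trans)
qed

context prob_space
begin

lemma expectation_abs_le_sqrt:
  fixes f :: "'a \<Rightarrow> real"
  assumes [measurable]: "f \<in> borel_measurable M" and i: "integrable M (\<lambda>\<omega>. (f \<omega>)\<^sup>2)"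
  shows "integrable M f" "expectation (\<lambda>\<omega>. \<bar>f \<omega>\<bar>) \<le> sqrt (expectation (\<lambda>\<omega>. (f \<omega>)\<^sup>2))"
proof -
  show f: "integrable M f" using square_integrable_imp_integrable[OF _ i] by simp
  have "variance (\<lambda>\<omega>. \<bar>f \<omega>\<bar>) = expectation (\<lambda>\<omega>. \<bar>f \<omega>\<bar>\<^sup>2) - (expectation (\<lambda>\<omega>. \<bar>f \<omega>\<bar>))\<^sup>2"
    using f i by (intro variance_eq) auto
  moreover have "0 \<le> variance (\<lambda>\<omega>. \<bar>f \<omega>\<bar>)" by simp
  ultimately show "expectation (\<lambda>\<omega>. \<bar>f \<omega>\<bar>) \<le> sqrt (expectation (\<lambda>\<omega>. (f \<omega>)\<^sup>2))"
    by (intro real_le_rsqrt) simp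
qed

text \<open>Two moments make the Taylor remainder quadratic in the increment, so differentiation
  under the integral sign follows from an explicit bound.\<close>

lemma iexp_expectation_has_vector_derivative:
  fixes F :: "'a \<Rightarrow> real"
  assumes [measurable]: "F \<in> borel_measurable M" and i2: "integrable M (\<lambda>\<omega>. (F \<omega>)\<^sup>2)"
  shows "((\<lambda>x. expectation (\<lambda>\<omega>. iexp (x * F \<omega>))) has_vector_derivative
            \<i> * expectation (\<lambda>\<omega>. F \<omega> * iexp (\<xi> * F \<omega>))) (at \<xi>)"
proof -
  let ?\<phi> = "\<lambda>x. expectation (\<lambda>\<omega>. iexp (x * F \<omega>))" and ?D = "\<i> * expectation (\<lambda>\<omega>. F \<omega> * iexp (\<xi> * F \<omega>))"
  let ?C = "expectation (\<lambda>\<omega>. (F \<omega>)\<^sup>2)"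
  have i1: "integrable M F" by (rule expectation_abs_le_sqrt[OF assms])
  have ie: "integrable M (\<lambda>\<omega>. iexp (x * F \<omega>))" for x by (rule integrable_const_bound[where B=1]) auto
  have iF: "integrable M (\<lambda>\<omega>. F \<omega> * iexp (\<xi> * F \<omega>))"
    by (rule Bochner_Integration.integrable_bound[OF i1]) (auto simp: norm_mult)
  have key: "norm (?\<phi> y - ?\<phi> \<xi> - (y - \<xi>) *\<^sub>R ?D) \<le> (y - \<xi>)\<^sup>2 * ?C" for y
  proof -
    have "?\<phi> y - ?\<phi> \<xi> - (y - \<xi>) *\<^sub>R ?D =
      expectation (\<lambda>\<omega>. iexp (y * F \<omega>) - iexp (\<xi> * F \<omega>) - (\<i> * (y - \<xi>)) * (F \<omega> * iexp (\<xi> * F \<omega>)))"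
      using ie iF by (simp add: scaleR_conv_of_real)
    also have "norm \<dots> \<le> expectation (\<lambda>\<omega>. (y - \<xi>)\<^sup>2 * (F \<omega>)\<^sup>2)"
    proof (rule norm_integral_le)
      show "(\<lambda>\<omega>. iexp (y * F \<omega>) - iexp (\<xi> * F \<omega>) - (\<i> * (y - \<xi>)) * (F \<omega> * iexp (\<xi> * F \<omega>))) \<in> borel_measurable M"
        using ie iF by simp
      show "integrable M (\<lambda>\<omega>. (y - \<xi>)\<^sup>2 * (F \<omega>)\<^sup>2)" using i2 by simp
      fix \<omega>
      let ?h = "(y - \<xi>) * F \<omega>"
      have "iexp (y * F \<omega>) = iexp (\<xi> * F \<omega>) * iexp ?h"
        unfolding exp_add[symmetric] by (simp add: algebra_simps)
      then have "iexp (y * F \<omega>) - iexp (\<xi> * F \<omega>) - (\<i> * (y - \<xi>)) * (F \<omega> * iexp (\<xi> * F \<omega>))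
        = iexp (\<xi> * F \<omega>) * (iexp ?h - (1 + \<i> * ?h))" by (simp add: algebra_simps)
      then have "norm (iexp (y * F \<omega>) - iexp (\<xi> * F \<omega>) - (\<i> * (y - \<xi>)) * (F \<omega> * iexp (\<xi> * F \<omega>))) 
        = norm (iexp ?h - (1 + \<i> * ?h))" by (simp add: norm_mult)
      also have "\<dots> \<le> ?h\<^sup>2 / 2" using norm_iexp_minus_linear_le[of ?h] by simp
      also have "\<dots> \<le> (y - \<xi>)\<^sup>2 * (F \<omega>)\<^sup>2" by (simp add: power_mult_distrib)
      finally show "norm (iexp (y * F \<omega>) - iexp (\<xi> * F \<omega>) - (\<i> * (y - \<xi>)) * (F \<omega> * iexp (\<xi> * F \<omega>))) \<le> (y - \<xi>)\<^sup>2 * (F \<omega>)\<^sup>2" .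
    qed
    finally show ?thesis using i2 by simp
  qed
  show ?thesis
    unfolding has_vector_derivative_def has_derivative_at
  proof (intro conjI bounded_linear_scaleR_left)
    have "((\<lambda>h::real. norm h * ?C) \<longlongrightarrow> norm (0::real) * ?C) (at 0)" by (intro tendsto_intros)
    then have l: "((\<lambda>h. norm h * ?C) \<longlongrightarrow> 0) (at (0::real))" by simp
    show "(\<lambda>h. norm (?\<phi> (\<xi> + h) - ?\<phi> \<xi> - h *\<^sub>R ?D) / norm h) \<midarrow>0\<rightarrow> 0"
    proof (rule Lim_null_comparison[OF _ l], rule always_eventually, rule allI)
      fix h :: real
      have "norm (?\<phi> (\<xi> + h) - ?\<phi> \<xi> - h *\<^sub>R ?D) \<le> h\<^sup>2 * ?C" using key[of "\<xi> + h"] by simp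
      then have "norm (?\<phi> (\<xi> + h) - ?\<phi> \<xi> - h *\<^sub>R ?D) / norm h \<le> h\<^sup>2 * ?C / norm h"
        by (rule divide_right_mono) simp
      also have "\<dots> = norm h * ?C" by (cases "h = 0") (auto simp: power2_eq_square abs_if)
      finally show "norm (norm (?\<phi> (\<xi> + h) - ?\<phi> \<xi> - h *\<^sub>R ?D) / norm h) \<le> norm h * ?C" by simp
    qed
  qed
qed

end

section \<open>The influence of a single innovation on the characteristic function\<close>

context iid_innovations
begin

lemma expectation_abs_z_le:
  assumes "k \<le> 4" shows "expectation (\<lambda>\<omega>. \<bar>z t \<omega>\<bar> ^ k) \<le> 1 + mu4"
proof -
  have "expectation (\<lambda>\<omega>. \<bar>z t \<omega>\<bar> ^ k) \<le> expectation (\<lambda>\<omega>. 1 + z t \<omega> ^ 4)"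
    using integrable_abs_power_z[OF assms, of t] integrable_power_z[of 4 t] power_le_one_plus_fourth[OF assms]
    by (intro integral_mono) auto
  also have "\<dots> = 1 + mu4" using integrable_power_z[of 4 t] expectation_z4[of t] by (simp add: prob_space)
  finally show ?thesis .
qed

lemma abs_mu3_le: "\<bar>mu3\<bar> \<le> 1 + mu4"
proof -
  have "\<bar>mu3\<bar> \<le> expectation (\<lambda>\<omega>. \<bar>z 0 \<omega> ^ 3\<bar>)" unfolding mu3_def by (rule integral_abs_bound)
  then show ?thesis using expectation_abs_z_le[of 3 0] by (simp add: power_abs)
qed

text \<open>AM-GM between the second and the fourth moment, weighted by the scale \<open>r\<close>;
  the weight keeps the bound homogeneous of order \<open>r ^ 3\<close>.\<close>

lemma lin_abs_cube:
  assumes T: "finite T" and r: "0 < r" and d: "(\<Sum>s\<in>T. (d s)\<^sup>2) \<le> r\<^sup>2"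
  shows "integrable M (\<lambda>\<omega>. \<bar>lin d T \<omega>\<bar> ^ 3)"
    and "expectation (\<lambda>\<omega>. \<bar>lin d T \<omega>\<bar> ^ 3) \<le> (mu4 + 2) * r ^ 3"
proof -
  let ?L = "lin d T"
  have le: "\<bar>x\<bar> ^ 3 \<le> (r * x\<^sup>2 + x ^ 4 / r) / 2" for x :: real
  proof -
    have "0 \<le> \<bar>x\<bar>\<^sup>2 * (\<bar>x\<bar> - r)\<^sup>2" by simp
    then have "2 * r * \<bar>x\<bar> ^ 3 \<le> \<bar>x\<bar> ^ 4 + r\<^sup>2 * \<bar>x\<bar>\<^sup>2"
      by (simp add: power2_eq_square power3_eq_cube power4_eq_xxxx algebra_simps)
    then show ?thesis using r by (simp add: field_simps power2_eq_square power_even_abs)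
  qed
  note m2 = lin_moments[OF T, of d] and m4 = lin_fourth_moment[OF T, of d]
  have i: "integrable M (\<lambda>\<omega>. (r * (?L \<omega>)\<^sup>2 + (?L \<omega>) ^ 4 / r) / 2)" using m2 m4 by simp
  show i3: "integrable M (\<lambda>\<omega>. \<bar>?L \<omega>\<bar> ^ 3)"
    by (rule Bochner_Integration.integrable_bound[OF i]) (use le in \<open>auto intro!: AE_I2 order_trans[OF _ abs_ge_self] simp: power_abs\<close>)
  have "(\<Sum>s\<in>T. (d s)\<^sup>2)\<^sup>2 \<le> (r\<^sup>2)\<^sup>2" using d by (intro power_mono) (auto intro: sum_nonneg)
  then have "(mu4 + 3) * (\<Sum>s\<in>T. (d s)\<^sup>2)\<^sup>2 \<le> (mu4 + 3) * (r\<^sup>2)\<^sup>2" using mu4_ge_1 by (intro mult_left_mono) auto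
  then have e4: "expectation (\<lambda>\<omega>. (?L \<omega>) ^ 4) / r \<le> (mu4 + 3) * r ^ 3"
    using m4(2) r by (simp add: field_simps power2_eq_square power3_eq_cube) 
  have e2: "r * expectation (\<lambda>\<omega>. (?L \<omega>)\<^sup>2) \<le> r ^ 3"
    using m2 d r by (simp add: power3_eq_cube power2_eq_square)
  have "expectation (\<lambda>\<omega>. \<bar>?L \<omega>\<bar> ^ 3) \<le> expectation (\<lambda>\<omega>. (r * (?L \<omega>)\<^sup>2 + (?L \<omega>) ^ 4 / r) / 2)"
    using i3 i le by (intro integral_mono) auto
  also have "\<dots> = (r * expectation (\<lambda>\<omega>. (?L \<omega>)\<^sup>2) + expectation (\<lambda>\<omega>. (?L \<omega>) ^ 4) / r) / 2"
    using m2 m4 by simp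
  also have "\<dots> \<le> (r ^ 3 + (mu4 + 3) * r ^ 3) / 2" using e2 e4 by (intro divide_right_mono add_mono) auto
  also have "\<dots> \<le> (mu4 + 2) * r ^ 3" using mu4_ge_1 r by (simp add: field_simps)
  finally show "expectation (\<lambda>\<omega>. \<bar>?L \<omega>\<bar> ^ 3) \<le> (mu4 + 2) * r ^ 3" .
qed

text \<open>This is the mean of \<open>cubic_cap R (2 * r * |eta|)\<close> divided by
  \<open>r\<^sup>2\<close>. It takes the place of \<open>r\<close> times a third absolute moment of
  \<open>eta\<close>, which may be infinite.\<close>

definition cap_moment :: "real \<Rightarrow> real \<Rightarrow> real" where
  "cap_moment R r = expectation (\<lambda>\<omega>. (eta (z 0 \<omega>))\<^sup>2 * min (4 * R\<^sup>2 * r * \<bar>eta (z 0 \<omega>)\<bar>) (8 * R))"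

lemma cap_moment_integrable:
  assumes "0 \<le> R" "0 \<le> r"
  shows "integrable M (\<lambda>\<omega>. (eta (z t \<omega>))\<^sup>2 * min (4 * R\<^sup>2 * r * \<bar>eta (z t \<omega>)\<bar>) (8 * R))"
proof (rule Bochner_Integration.integrable_bound)
  show "integrable M (\<lambda>\<omega>. 8 * R * (eta (z t \<omega>))\<^sup>2)" using eta_moments(3)[of t] by simp
  have "norm ((eta x)\<^sup>2 * min (4 * R\<^sup>2 * r * \<bar>eta x\<bar>) (8 * R)) \<le> norm (8 * R * (eta x)\<^sup>2)" for x
    using mult_left_mono[of "min (4 * R\<^sup>2 * r * \<bar>eta x\<bar>) (8 * R)" "8 * R" "(eta x)\<^sup>2"] assms
    by (simp add: mult.commute)
  then show "AE \<omega> in M. norm ((eta (z t \<omega>))\<^sup>2 * min (4 * R\<^sup>2 * r * \<bar>eta (z t \<omega>)\<bar>) (8 * R)) \<le> norm (8 * R * (eta (z t \<omega>))\<^sup>2)"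
    by (intro AE_I2)
qed measurable

text \<open>Dominated convergence with majorant \<open>8 * R * eta\<^sup>2\<close>. There is no
  rate, since nothing beyond the second moment of \<open>eta\<close> is assumed.\<close>

lemma cap_moment_tendsto_0:
  assumes R: "0 \<le> R" and r: "r \<longlonglongrightarrow> 0" "\<And>n. 0 \<le> r n"
  shows "(\<lambda>n. cap_moment R (r n)) \<longlonglongrightarrow> 0"
proof -
  have "(\<lambda>n. cap_moment R (r n)) \<longlonglongrightarrow> expectation (\<lambda>\<omega>. 0)"
    unfolding cap_moment_def
  proof (rule integral_dominated_convergence)
    show "integrable M (\<lambda>\<omega>. 8 * R * (eta (z 0 \<omega>))\<^sup>2)" using eta_moments(3)[of 0] by simp
    show "AE \<omega> in M. (\<lambda>n. (eta (z 0 \<omega>))\<^sup>2 * min (4 * R\<^sup>2 * r n * \<bar>eta (z 0 \<omega>)\<bar>) (8 * R)) \<longlonglongrightarrow> 0"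
    proof (rule AE_I2)
      fix \<omega>
      have "(\<lambda>n. (eta (z 0 \<omega>))\<^sup>2 * min (4 * R\<^sup>2 * r n * \<bar>eta (z 0 \<omega>)\<bar>) (8 * R))
         \<longlonglongrightarrow> (eta (z 0 \<omega>))\<^sup>2 * min (4 * R\<^sup>2 * 0 * \<bar>eta (z 0 \<omega>)\<bar>) (8 * R)"
        by (intro tendsto_intros r)
      then show "(\<lambda>n. (eta (z 0 \<omega>))\<^sup>2 * min (4 * R\<^sup>2 * r n * \<bar>eta (z 0 \<omega>)\<bar>) (8 * R)) \<longlonglongrightarrow> 0"
        using R by simp
    qed
    have "norm ((eta x)\<^sup>2 * min (4 * R\<^sup>2 * r n * \<bar>eta x\<bar>) (8 * R)) \<le> 8 * R * (eta x)\<^sup>2" for x n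
      using mult_left_mono[of "min (4 * R\<^sup>2 * r n * \<bar>eta x\<bar>) (8 * R)" "8 * R" "(eta x)\<^sup>2"] R r(2)[of n]
      by (simp add: mult.commute)
    then show "AE \<omega> in M. norm ((eta (z 0 \<omega>))\<^sup>2 * min (4 * R\<^sup>2 * r n * \<bar>eta (z 0 \<omega>)\<bar>) (8 * R)) \<le> 8 * R * (eta (z 0 \<omega>))\<^sup>2" for n
      by (intro AE_I2)
  qed measurable
  then show ?thesis by simp
qed

lemma integrable_mult_iexp:
  fixes f g :: "'w \<Rightarrow> real"
  assumes "integrable M f" "g \<in> borel_measurable M"
  shows "integrable M (\<lambda>\<omega>. complex_of_real (f \<omega>) * iexp (g \<omega>))"
  by (rule Bochner_Integration.integrable_bound[OF assms(1)])
    (use assms borel_measurable_integrable[OF assms(1)] in \<open>auto simp: norm_mult\<close>)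

text \<open>With \<open>w\<close> the conditional mean of \<open>k * h\<close> given the other coordinates, this is the
  one-coordinate step of Stein's method: the linear term in the expansion of
  \<open>iexp (\<xi> * (F' + h))\<close> around \<open>F'\<close> is the only one that survives.\<close>

lemma stein_step:
  assumes T: "finite T" and t: "t \<in> T"
    and sym: "\<And>s t. s \<in> T \<Longrightarrow> t \<in> T \<Longrightarrow> B s t = B t s"
    and r: "0 < r" and al: "\<bar>B t t\<bar> \<le> r" and d: "(\<Sum>s\<in>T - {t}. (B t s)\<^sup>2) \<le> r\<^sup>2"
    and R: "\<bar>\<xi>\<bar> \<le> R"
  defines "Y \<equiv> lin (B t) (T - {t})" and "F \<equiv> qf B T" and "\<alpha> \<equiv> B t t"
  defines "w \<equiv> \<lambda>\<omega>. \<alpha>\<^sup>2 * (mu4 - 1) + 3 * \<alpha> * mu3 * Y \<omega> + 2 * (Y \<omega>)\<^sup>2"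
  shows "norm (expectation (\<lambda>\<omega>. (\<alpha> * eta (z t \<omega>) + z t \<omega> * Y \<omega>) * iexp (\<xi> * F \<omega>))
      - \<i> * \<xi> * expectation (\<lambda>\<omega>. w \<omega> * iexp (\<xi> * F \<omega>)))
    \<le> r\<^sup>2 * cap_moment R r + 100 * R\<^sup>2 * (mu4 + 1) * (mu4 + 3) * r ^ 3" (is "norm ?lhs \<le> ?rhs")
    and "integrable M w"
    and "integrable M (\<lambda>\<omega>. \<alpha> * eta (z t \<omega>) + z t \<omega> * Y \<omega>)"
proof -
  define T' where "T' = T - {t}"
  have T': "finite T'" "t \<notin> T'" "insert t T' = T" using T t by (auto simp: T'_def)
  define F' where "F' = qf B T'"
  \<comment> \<open>\<open>h\<close> is the whole dependence of \<open>F\<close> on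
    \<open>z t\<close>, whereas \<open>k\<close> takes the cross term only once: an off-diagonal
    pair is shared by two coordinates, so the \<open>k\<close> of all coordinates sum to
    \<open>F\<close>.\<close>
  define h where "h \<omega> = \<alpha> * eta (z t \<omega>) + 2 * z t \<omega> * Y \<omega>" for \<omega>
  define k where "k \<omega> = \<alpha> * eta (z t \<omega>) + z t \<omega> * Y \<omega>" for \<omega>
  define e' where "e' \<omega> = iexp (\<xi> * F' \<omega>)" for \<omega>
  have R0: "0 \<le> R" using R by simp
  have Fh: "F \<omega> = F' \<omega> + h \<omega>" for \<omega>
    using qf_insert[OF T'(1,2), of B \<omega>] sym T' t
    by (simp add: F_def F'_def h_def \<alpha>_def Y_def T'_def)
  have [measurable]: "F \<in> borel_measurable M" "F' \<in> borel_measurable M" "Y \<in> borel_measurable M"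
    unfolding F_def F'_def Y_def by auto
  have [measurable]: "e' \<in> borel_measurable M" "h \<in> borel_measurable M" "k \<in> borel_measurable M"
    "w \<in> borel_measurable M"
    unfolding e'_def[abs_def] h_def[abs_def] k_def[abs_def] w_def by measurable
  have Y2: "integrable M (\<lambda>\<omega>. (Y \<omega>)\<^sup>2)" "expectation (\<lambda>\<omega>. (Y \<omega>)\<^sup>2) \<le> r\<^sup>2" and Y1: "integrable M Y"
    using lin_moments[OF T'(1), of "B t"] integrable_lin[OF T'(1), of "B t"] d by (auto simp: Y_def T'_def)
  have Y3: "integrable M (\<lambda>\<omega>. \<bar>Y \<omega>\<bar> ^ 3)" "expectation (\<lambda>\<omega>. \<bar>Y \<omega>\<bar> ^ 3) \<le> (mu4 + 2) * r ^ 3"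
    using lin_abs_cube[OF T'(1) r, of "B t"] d by (auto simp: Y_def T'_def)
  have depY: "dep T' Y" unfolding Y_def T'_def by (rule dep_lin)
  have depe: "dep T' e'" unfolding e'_def[abs_def] F'_def
    by (rule dep_compose[OF dep_qf]) measurable
  have depYc: "dep T' (\<lambda>\<omega>. complex_of_real (Y \<omega>))" by (rule dep_compose[OF depY]) measurable
  show iw: "integrable M w" unfolding w_def using Y1 Y2 by simp
  have zY: "integrable M (\<lambda>\<omega>. z t \<omega> * Y \<omega>)"
    using indep_factor(1)[OF T'(2) depY, of "\<lambda>x. x"] integrable_z Y1 by simp
  have ik: "integrable M k" unfolding k_def[abs_def] using zY eta_moments(1)[of t] by simp
  then show "integrable M (\<lambda>\<omega>. \<alpha> * eta (z t \<omega>) + z t \<omega> * Y \<omega>)" unfolding k_def .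

  \<comment> \<open>Integrating out \<open>z t\<close>: whatever multiplies \<open>f (z t)\<close>
    depends on the other coordinates only, including the exponential of \<open>F'\<close>.\<close>
  have fac: "integrable M (\<lambda>\<omega>. complex_of_real (f (z t \<omega>)) * (complex_of_real (g \<omega>) * e' \<omega>))"
      "expectation (\<lambda>\<omega>. complex_of_real (f (z t \<omega>)) * (complex_of_real (g \<omega>) * e' \<omega>))
         = complex_of_real (expectation (\<lambda>\<omega>. f (z t \<omega>))) * expectation (\<lambda>\<omega>. complex_of_real (g \<omega>) * e' \<omega>)"
    if f: "f \<in> borel_measurable borel" "integrable M (\<lambda>\<omega>. f (z t \<omega>))" and g: "dep T' g" "integrable M g" for f g
  proof -
    have i: "integrable M (\<lambda>\<omega>. complex_of_real (g \<omega>) * e' \<omega>)"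
      unfolding e'_def by (rule integrable_mult_iexp[OF g(2)]) measurable
    have dp: "dep T' (\<lambda>\<omega>. complex_of_real (g \<omega>) * e' \<omega>)"
      by (intro dep_mult depe dep_compose[OF g(1)]) measurable
    have m: "(\<lambda>x. complex_of_real (f x)) \<in> borel_measurable borel" using f(1) by measurable
    show "integrable M (\<lambda>\<omega>. complex_of_real (f (z t \<omega>)) * (complex_of_real (g \<omega>) * e' \<omega>))"
      "expectation (\<lambda>\<omega>. complex_of_real (f (z t \<omega>)) * (complex_of_real (g \<omega>) * e' \<omega>))
         = complex_of_real (expectation (\<lambda>\<omega>. f (z t \<omega>))) * expectation (\<lambda>\<omega>. complex_of_real (g \<omega>) * e' \<omega>)"
      using indep_factor[OF T'(2) dp m integrable_of_real[OF f(2)] i] by simp_all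
  qed
  have depY2: "dep T' (\<lambda>\<omega>. (Y \<omega>)\<^sup>2)" by (rule dep_compose[OF depY]) measurable
  note f1 = fac[of eta "\<lambda>_. 1", OF eta_measurable eta_moments(1) dep_const]
  note f2 = fac[of "\<lambda>x. x" Y, OF _ integrable_z depY Y1]
  note f3 = fac[of "\<lambda>x. (eta x)\<^sup>2" "\<lambda>_. 1", OF _ eta_moments(3) dep_const]
  note f4 = fac[of "\<lambda>x. eta x * x" Y, OF _ eta_moments(5) depY Y1]
  note f5 = fac[of "\<lambda>x. x\<^sup>2" "\<lambda>\<omega>. (Y \<omega>)\<^sup>2", OF _ integrable_power_z[of 2] depY2 Y2(1)]

  \<comment> \<open>The zeroth-order term is linear in \<open>eta (z t)\<close> and
    \<open>z t\<close>, hence has mean zero. The product \<open>k * h\<close> contributes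
    \<open>\<alpha>\<^sup>2 eta\<^sup>2\<close>, \<open>(1 + 2) \<alpha> eta z Y\<close> and
    \<open>2 z\<^sup>2 Y\<^sup>2\<close>, and averaging over \<open>z t\<close> yields the
    coefficients of \<open>w\<close>.\<close>
  have kh: "complex_of_real (k \<omega>) * e' \<omega> * (1 + \<i> * (\<xi> * h \<omega>)) =
      \<alpha> * (complex_of_real (eta (z t \<omega>)) * (complex_of_real 1 * e' \<omega>)) + complex_of_real (z t \<omega>) * (complex_of_real (Y \<omega>) * e' \<omega>)
     + \<i> * \<xi> * (\<alpha>\<^sup>2 * (complex_of_real ((eta (z t \<omega>))\<^sup>2) * (complex_of_real 1 * e' \<omega>))
        + 3 * \<alpha> * (complex_of_real (eta (z t \<omega>) * z t \<omega>) * (complex_of_real (Y \<omega>) * e' \<omega>))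
        + 2 * (complex_of_real ((z t \<omega>)\<^sup>2) * (complex_of_real ((Y \<omega>)\<^sup>2) * e' \<omega>)))" for \<omega>
    unfolding k_def h_def by (simp add: power2_eq_square algebra_simps)
  have ie: "integrable M e'" unfolding e'_def[abs_def] by (rule integrable_const_bound[where B=1]) auto
  have iYe: "integrable M (\<lambda>\<omega>. complex_of_real (Y \<omega>) * e' \<omega>)" 
    "integrable M (\<lambda>\<omega>. complex_of_real ((Y \<omega>)\<^sup>2) * e' \<omega>)"
    unfolding e'_def by (intro integrable_mult_iexp Y1 Y2; measurable)+
  have we: "complex_of_real (w \<omega>) * e' \<omega> = complex_of_real (\<alpha>\<^sup>2 * (mu4 - 1)) * e' \<omega> 
      + complex_of_real (3 * \<alpha> * mu3) * (complex_of_real (Y \<omega>) * e' \<omega>) + 2 * (complex_of_real ((Y \<omega>)\<^sup>2) * e' \<omega>)" for \<omega>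
    unfolding w_def by (simp add: algebra_simps)
  have iwe: "integrable M (\<lambda>\<omega>. complex_of_real (w \<omega>) * e' \<omega>)" unfolding we using ie iYe by simp
  have ikh: "integrable M (\<lambda>\<omega>. complex_of_real (k \<omega>) * e' \<omega> * (1 + \<i> * (\<xi> * h \<omega>)))"
    unfolding kh using f1 f2 f3 f4 f5 by simp
  have main: "expectation (\<lambda>\<omega>. complex_of_real (k \<omega>) * e' \<omega> * (1 + \<i> * (\<xi> * h \<omega>)))
     = \<i> * \<xi> * expectation (\<lambda>\<omega>. complex_of_real (w \<omega>) * e' \<omega>)"
  proof -
    let ?e0 = "expectation e'" and ?e1 = "expectation (\<lambda>\<omega>. complex_of_real (Y \<omega>) * e' \<omega>)"
      and ?e2 = "expectation (\<lambda>\<omega>. complex_of_real ((Y \<omega>)\<^sup>2) * e' \<omega>)"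
    have E1: "expectation (\<lambda>\<omega>. complex_of_real (k \<omega>) * e' \<omega> * (1 + \<i> * (\<xi> * h \<omega>)))
      = \<i> * \<xi> * (\<alpha>\<^sup>2 * (complex_of_real (mu4 - 1) * ?e0) + 3 * \<alpha> * (complex_of_real mu3 * ?e1) + 2 * ?e2)"
      unfolding kh using f1 f2 f3 f4 f5 by (simp add: eta_moments expectation_z expectation_z2)
    have E2: "expectation (\<lambda>\<omega>. complex_of_real (w \<omega>) * e' \<omega>)
      = complex_of_real (\<alpha>\<^sup>2 * (mu4 - 1)) * ?e0 + complex_of_real (3 * \<alpha> * mu3) * ?e1 + 2 * ?e2"
      unfolding we using ie iYe by simp
    show ?thesis unfolding E1 E2 by (simp add: algebra_simps)
  qed

  have ikF: "integrable M (\<lambda>\<omega>. complex_of_real (k \<omega>) * iexp (\<xi> * F \<omega>))"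
    "integrable M (\<lambda>\<omega>. complex_of_real (w \<omega>) * iexp (\<xi> * F \<omega>))"
    by (intro integrable_mult_iexp ik iw; measurable)+
  have "?lhs = expectation (\<lambda>\<omega>. complex_of_real (k \<omega>) * iexp (\<xi> * F \<omega>))
      - expectation (\<lambda>\<omega>. complex_of_real (k \<omega>) * e' \<omega> * (1 + \<i> * (\<xi> * h \<omega>)))
      + \<i> * \<xi> * (expectation (\<lambda>\<omega>. complex_of_real (w \<omega>) * e' \<omega>) - expectation (\<lambda>\<omega>. complex_of_real (w \<omega>) * iexp (\<xi> * F \<omega>)))"
    unfolding main k_def[symmetric] by (simp only: right_diff_distrib add_diff_eq diff_add_cancel)
  also have "\<dots> = expectation (\<lambda>\<omega>. complex_of_real (k \<omega>) * iexp (\<xi> * F \<omega>) 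
        - complex_of_real (k \<omega>) * e' \<omega> * (1 + \<i> * (\<xi> * h \<omega>))
      + \<i> * \<xi> * (complex_of_real (w \<omega>) * e' \<omega> - complex_of_real (w \<omega>) * iexp (\<xi> * F \<omega>)))"
    using ikF ikh iwe by simp
  finally have lhs: "?lhs = \<dots>" .

  define m where "m = mu4 + 1"
  have m2: "2 \<le> m" using mu4_ge_1 by (simp add: m_def)
  \<comment> \<open>Pointwise majorant of the integrand: the capped Taylor remainder in
    \<open>eta\<close>, the cubic remainder of the cross term, and the cost of putting
    \<open>F\<close> back in place of \<open>F'\<close> in the exponential next to
    \<open>w\<close>.\<close>
  define G where "G \<omega> = r\<^sup>2 * ((eta (z t \<omega>))\<^sup>2 * min (4 * R\<^sup>2 * r * \<bar>eta (z t \<omega>)\<bar>) (8 * R))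
     + 32 * R\<^sup>2 * (\<bar>z t \<omega>\<bar> ^ 3 * \<bar>Y \<omega>\<bar> ^ 3)
     + R\<^sup>2 * (24 * m * ((1 + (z t \<omega>)\<^sup>2) * (r ^ 3 + \<bar>Y \<omega>\<bar> ^ 3)))" for \<omega>
  have depY3: "dep T' (\<lambda>\<omega>. \<bar>Y \<omega>\<bar> ^ 3)" by (rule dep_compose[OF depY]) measurable
  have depY3': "dep T' (\<lambda>\<omega>. r ^ 3 + \<bar>Y \<omega>\<bar> ^ 3)" by (rule dep_compose[OF depY]) measurable
  have g1: "integrable M (\<lambda>\<omega>. \<bar>z t \<omega>\<bar> ^ 3 * \<bar>Y \<omega>\<bar> ^ 3)"
    "expectation (\<lambda>\<omega>. \<bar>z t \<omega>\<bar> ^ 3 * \<bar>Y \<omega>\<bar> ^ 3) = expectation (\<lambda>\<omega>. \<bar>z t \<omega>\<bar> ^ 3) * expectation (\<lambda>\<omega>. \<bar>Y \<omega>\<bar> ^ 3)"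
    using indep_factor[OF T'(2) depY3, of "\<lambda>x. \<bar>x\<bar> ^ 3"] integrable_abs_power_z[of 3 t] Y3 by auto
  have i12: "integrable M (\<lambda>\<omega>. 1 + (z t \<omega>)\<^sup>2)" "expectation (\<lambda>\<omega>. 1 + (z t \<omega>)\<^sup>2) = 2"
    using integrable_power_z[of 2 t] expectation_z2[of t] by (simp_all add: prob_space)
  have iY3': "integrable M (\<lambda>\<omega>. r ^ 3 + \<bar>Y \<omega>\<bar> ^ 3)" using Y3 by simp
  have g2: "integrable M (\<lambda>\<omega>. (1 + (z t \<omega>)\<^sup>2) * (r ^ 3 + \<bar>Y \<omega>\<bar> ^ 3))"
    "expectation (\<lambda>\<omega>. (1 + (z t \<omega>)\<^sup>2) * (r ^ 3 + \<bar>Y \<omega>\<bar> ^ 3)) = 2 * (r ^ 3 + expectation (\<lambda>\<omega>. \<bar>Y \<omega>\<bar> ^ 3))"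
    using indep_factor[OF T'(2) depY3', of "\<lambda>x. 1 + x\<^sup>2", OF _ i12(1) iY3'] i12 Y3 by (auto simp: prob_space)
  have g0: "integrable M (\<lambda>\<omega>. (eta (z t \<omega>))\<^sup>2 * min (4 * R\<^sup>2 * r * \<bar>eta (z t \<omega>)\<bar>) (8 * R))"
    "expectation (\<lambda>\<omega>. (eta (z t \<omega>))\<^sup>2 * min (4 * R\<^sup>2 * r * \<bar>eta (z t \<omega>)\<bar>) (8 * R)) = cap_moment R r"
    using cap_moment_integrable[of R r t] R0 r
      expectation_ident[of "\<lambda>x. (eta x)\<^sup>2 * min (4 * R\<^sup>2 * r * \<bar>eta x\<bar>) (8 * R)" t] by (auto simp: cap_moment_def)
  have iG: "integrable M G" unfolding G_def[abs_def] using g0 g1 g2 by simp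
  have "expectation G = r\<^sup>2 * cap_moment R r + 32 * R\<^sup>2 * (expectation (\<lambda>\<omega>. \<bar>z t \<omega>\<bar> ^ 3) * expectation (\<lambda>\<omega>. \<bar>Y \<omega>\<bar> ^ 3))
     + R\<^sup>2 * (24 * m * (2 * (r ^ 3 + expectation (\<lambda>\<omega>. \<bar>Y \<omega>\<bar> ^ 3))))"
    unfolding G_def[abs_def] using g0 g1 g2 by simp
  also have "\<dots> \<le> r\<^sup>2 * cap_moment R r + 32 * R\<^sup>2 * (m * ((mu4 + 2) * r ^ 3))
     + R\<^sup>2 * (24 * m * (2 * (r ^ 3 + (mu4 + 2) * r ^ 3)))"
    using expectation_abs_z_le[of 3 t] Y3(2) m2 r
    by (intro add_mono mult_left_mono mult_mono order_refl) (auto simp: m_def)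
  \<comment> \<open>The coefficient of \<open>R\<^sup>2 * m * r ^ 3\<close> is
    \<open>32 (mu4 + 2) + 48 (mu4 + 3)\<close>, which is below \<open>100 (mu4 + 3)\<close>.\<close>
  also have "\<dots> \<le> ?rhs"
  proof -
    have "0 \<le> R\<^sup>2 * (m * r ^ 3)" using m2 r by simp
    moreover have "0 \<le> R\<^sup>2 * (m * r ^ 3) * mu4" using m2 r mu4_ge_1 by simp
    ultimately show ?thesis unfolding m_def[symmetric] by (simp add: algebra_simps)
  qed
  finally have EG: "expectation G \<le> ?rhs" .

  show "norm ?lhs \<le> ?rhs" unfolding lhs
  proof (rule order_trans[OF norm_integral_le[OF _ iG] EG])
    show "(\<lambda>\<omega>. complex_of_real (k \<omega>) * iexp (\<xi> * F \<omega>) 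
        - complex_of_real (k \<omega>) * e' \<omega> * (1 + \<i> * (\<xi> * h \<omega>))
      + \<i> * \<xi> * (complex_of_real (w \<omega>) * e' \<omega> - complex_of_real (w \<omega>) * iexp (\<xi> * F \<omega>))) \<in> borel_measurable M"
      by measurable
    fix \<omega>
    \<comment> \<open>\<open>q\<close> carries the factor 2 of \<open>h\<close>, so the single bound
      \<open>p + q\<close> serves for both \<open>k\<close> and \<open>h\<close>.\<close>
    define p q where "p = \<bar>\<alpha> * eta (z t \<omega>)\<bar>" and "q = 2 * \<bar>z t \<omega> * Y \<omega>\<bar>"
    have pq: "0 \<le> p" "0 \<le> q" by (auto simp: p_def q_def)
    have kb: "\<bar>k \<omega>\<bar> \<le> p + q" and hb: "\<bar>h \<omega>\<bar> \<le> p + q"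
      unfolding k_def h_def p_def q_def by (auto simp: abs_mult intro!: order_trans[OF abs_triangle_ineq] add_mono)
    have eF: "iexp (\<xi> * F \<omega>) = e' \<omega> * iexp (\<xi> * h \<omega>)"
      unfolding e'_def Fh exp_add[symmetric] by (simp add: algebra_simps)
    have ne: "norm (e' \<omega>) = 1" by (simp add: e'_def)
    have a: "norm (complex_of_real (k \<omega>) * iexp (\<xi> * F \<omega>) - complex_of_real (k \<omega>) * e' \<omega> * (1 + \<i> * (\<xi> * h \<omega>)))
      \<le> cubic_cap R (2 * p) + cubic_cap R (2 * q)"
    proof -
      have "complex_of_real (k \<omega>) * iexp (\<xi> * F \<omega>) - complex_of_real (k \<omega>) * e' \<omega> * (1 + \<i> * (\<xi> * h \<omega>))
        = complex_of_real (k \<omega>) * e' \<omega> * (iexp (\<xi> * h \<omega>) - (1 + \<i> * complex_of_real (\<xi> * h \<omega>)))"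
        unfolding eF by (simp add: algebra_simps)
      then have "norm (complex_of_real (k \<omega>) * iexp (\<xi> * F \<omega>) - complex_of_real (k \<omega>) * e' \<omega> * (1 + \<i> * (\<xi> * h \<omega>)))
        = \<bar>k \<omega>\<bar> * norm (iexp (\<xi> * h \<omega>) - (1 + \<i> * complex_of_real (\<xi> * h \<omega>)))"
        using ne by (simp add: norm_mult)
      also have "\<dots> \<le> \<bar>k \<omega>\<bar> * min ((\<xi> * h \<omega>)\<^sup>2 / 2) (2 * \<bar>\<xi> * h \<omega>\<bar>)"
        using norm_iexp_minus_linear_le[of "\<xi> * h \<omega>"] by (intro mult_left_mono) auto
      also have "\<dots> \<le> (p + q) * min (R\<^sup>2 * (p + q)\<^sup>2 / 2) (2 * R * (p + q))"
      proof -
        have "\<bar>\<xi> * h \<omega>\<bar> \<le> R * (p + q)" unfolding abs_mult using R hb by (intro mult_mono) auto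
        then have b1: "2 * \<bar>\<xi> * h \<omega>\<bar> \<le> 2 * R * (p + q)" by simp
        have "\<bar>\<xi> * h \<omega>\<bar>\<^sup>2 \<le> (R * (p + q))\<^sup>2" 
          using \<open>\<bar>\<xi> * h \<omega>\<bar> \<le> R * (p + q)\<close> by (intro power_mono) auto
        then have b2: "(\<xi> * h \<omega>)\<^sup>2 / 2 \<le> R\<^sup>2 * (p + q)\<^sup>2 / 2" by (simp add: power_mult_distrib)
        show ?thesis using mult_mono[OF kb min.mono[OF b2 b1]] pq by simp
      qed
      also have "\<dots> \<le> cubic_cap R (2 * p) + cubic_cap R (2 * q)"
        using cubic_cap_add[OF pq R0] by (simp add: cubic_cap_def)
      finally show ?thesis .
    qed
    have c1: "cubic_cap R (2 * p) \<le> r\<^sup>2 * ((eta (z t \<omega>))\<^sup>2 * min (4 * R\<^sup>2 * r * \<bar>eta (z t \<omega>)\<bar>) (8 * R))"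
    proof -
      let ?x = "2 * (r * \<bar>eta (z t \<omega>)\<bar>)"
      have "cubic_cap R (2 * p) \<le> cubic_cap R ?x"
        unfolding p_def abs_mult using al R0 by (intro cubic_cap_mono mult_left_mono mult_right_mono) (auto simp: \<alpha>_def)
      also have "\<dots> = r\<^sup>2 * ((eta (z t \<omega>))\<^sup>2 * min (4 * R\<^sup>2 * r * \<bar>eta (z t \<omega>)\<bar>) (8 * R))"
      proof -
        have "min (R\<^sup>2 * ?x\<^sup>2 / 2) (2 * R * ?x) = min ((r * \<bar>eta (z t \<omega>)\<bar> / 2) * (4 * R\<^sup>2 * r * \<bar>eta (z t \<omega>)\<bar>)) ((r * \<bar>eta (z t \<omega>)\<bar> / 2) * (8 * R))"
          by (intro arg_cong2[where f=min]) (auto simp: power2_eq_square algebra_simps)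
        also have "\<dots> = (r * \<bar>eta (z t \<omega>)\<bar> / 2) * min (4 * R\<^sup>2 * r * \<bar>eta (z t \<omega>)\<bar>) (8 * R)"
          using r by (intro mult_min_right[symmetric]) auto
        finally have e: "min (R\<^sup>2 * ?x\<^sup>2 / 2) (2 * R * ?x)
          = (r * \<bar>eta (z t \<omega>)\<bar> / 2) * min (4 * R\<^sup>2 * r * \<bar>eta (z t \<omega>)\<bar>) (8 * R)" .
        have "2 * (r * a) * (r * a / 2 * m) = r\<^sup>2 * (a\<^sup>2 * m)" for a m :: real
          by (simp add: power2_eq_square)
        from this[of "\<bar>eta (z t \<omega>)\<bar>"] show ?thesis unfolding cubic_cap_def e by (simp only: power2_abs)
      qed
      finally show ?thesis .
    qed
    have c2: "cubic_cap R (2 * q) \<le> 32 * R\<^sup>2 * (\<bar>z t \<omega>\<bar> ^ 3 * \<bar>Y \<omega>\<bar> ^ 3)"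
      using cubic_cap_le_cube[of "2 * q" R] pq unfolding q_def 
      by (simp add: power_mult_distrib abs_mult algebra_simps)
    \<comment> \<open>A first-order expansion of the exponential suffices here, since
      \<open>w\<close> is already quadratic in the size of the influence.\<close>
    have b: "norm (\<i> * \<xi> * (complex_of_real (w \<omega>) * e' \<omega> - complex_of_real (w \<omega>) * iexp (\<xi> * F \<omega>)))
       \<le> R\<^sup>2 * (24 * m * ((1 + (z t \<omega>)\<^sup>2) * (r ^ 3 + \<bar>Y \<omega>\<bar> ^ 3)))"
    proof -
      have "complex_of_real (w \<omega>) * e' \<omega> - complex_of_real (w \<omega>) * iexp (\<xi> * F \<omega>) = - (complex_of_real (w \<omega>) * e' \<omega> * (iexp (\<xi> * h \<omega>) - 1))"
        unfolding eF by (simp add: algebra_simps)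
      then have "norm (\<i> * \<xi> * (complex_of_real (w \<omega>) * e' \<omega> - complex_of_real (w \<omega>) * iexp (\<xi> * F \<omega>)))
        = \<bar>\<xi>\<bar> * (\<bar>w \<omega>\<bar> * norm (iexp (\<xi> * h \<omega>) - 1))" using ne by (simp add: norm_mult)
      also have "\<dots> \<le> R * (\<bar>w \<omega>\<bar> * (R * \<bar>h \<omega>\<bar>))"
      proof -
        have "norm (iexp (\<xi> * h \<omega>) - 1) \<le> \<bar>\<xi>\<bar> * \<bar>h \<omega>\<bar>" using norm_iexp_minus_1_le[of "\<xi> * h \<omega>"] by (simp add: abs_mult)
        also have "\<dots> \<le> R * \<bar>h \<omega>\<bar>" using R by (intro mult_right_mono) auto
        finally show ?thesis using R by (intro mult_mono) auto
      qed
      also have "\<dots> = R\<^sup>2 * (\<bar>w \<omega>\<bar> * \<bar>h \<omega>\<bar>)" by (simp add: power2_eq_square)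
      also have "\<bar>w \<omega>\<bar> * \<bar>h \<omega>\<bar> \<le> 24 * m * ((1 + (z t \<omega>)\<^sup>2) * (r ^ 3 + \<bar>Y \<omega>\<bar> ^ 3))"
      proof -
        let ?y = "\<bar>Y \<omega>\<bar>" and ?Z = "1 + (z t \<omega>)\<^sup>2"
        have al': "\<bar>\<alpha>\<bar> \<le> r" using al by (simp add: \<alpha>_def)
        then have "\<alpha>\<^sup>2 \<le> r\<^sup>2" using power_mono[of "\<bar>\<alpha>\<bar>" r 2] by simp
        then have w1: "\<bar>\<alpha>\<^sup>2 * (mu4 - 1)\<bar> \<le> r\<^sup>2 * m" unfolding abs_mult using mu4_ge_1 by (intro mult_mono) (auto simp: m_def)
        have "\<bar>\<alpha>\<bar> * \<bar>mu3\<bar> * ?y \<le> r * m * ?y" using al' abs_mu3_le r m2 by (intro mult_mono mult_right_mono) (auto simp: m_def)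
        moreover have "m * (2 * r * ?y) \<le> m * (r\<^sup>2 + ?y\<^sup>2)" using m2 sum_squares_bound[of r ?y] by (intro mult_left_mono) auto
        ultimately have w2: "\<bar>3 * \<alpha> * mu3 * Y \<omega>\<bar> \<le> 3 * m * (r\<^sup>2 + ?y\<^sup>2) / 2" by (simp add: abs_mult algebra_simps)
        have w3: "\<bar>2 * (Y \<omega>)\<^sup>2\<bar> \<le> m * ?y\<^sup>2" using m2 by (simp add: mult_right_mono)
        have "\<bar>w \<omega>\<bar> \<le> \<bar>\<alpha>\<^sup>2 * (mu4 - 1)\<bar> + \<bar>3 * \<alpha> * mu3 * Y \<omega>\<bar> + \<bar>2 * (Y \<omega>)\<^sup>2\<bar>" unfolding w_def by linarith
        also have "\<dots> \<le> r\<^sup>2 * m + 3 * m * (r\<^sup>2 + ?y\<^sup>2) / 2 + m * ?y\<^sup>2" using w1 w2 w3 by linarith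
        also have "\<dots> \<le> 6 * m * (r\<^sup>2 + ?y\<^sup>2)"
        proof -
          have "0 \<le> m * r\<^sup>2" "0 \<le> m * ?y\<^sup>2" using m2 by auto
          then show ?thesis by (simp add: algebra_simps)
        qed
        finally have wb: "\<bar>w \<omega>\<bar> \<le> 6 * m * (r\<^sup>2 + ?y\<^sup>2)" .
        have zb: "\<bar>z t \<omega>\<bar> \<le> ?Z" using sum_squares_bound[of 1 "\<bar>z t \<omega>\<bar>"] by simp
        have eb: "\<bar>eta (z t \<omega>)\<bar> \<le> ?Z" unfolding eta_def by (rule abs_leI) auto
        have h1: "\<bar>\<alpha> * eta (z t \<omega>)\<bar> \<le> r * ?Z" unfolding abs_mult using al' eb r by (intro mult_mono) auto
        have h2: "\<bar>z t \<omega> * Y \<omega>\<bar> \<le> ?Z * ?y" unfolding abs_mult using zb by (intro mult_right_mono) auto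
        have h3: "0 \<le> r * ?Z" using r by simp
        have "\<bar>h \<omega>\<bar> \<le> \<bar>\<alpha> * eta (z t \<omega>)\<bar> + 2 * \<bar>z t \<omega> * Y \<omega>\<bar>" unfolding h_def by linarith
        also have "\<dots> \<le> 2 * (r * ?Z) + 2 * (?Z * ?y)" using h1 h2 h3 by linarith
        also have "\<dots> = 2 * (?Z * (r + ?y))" by (simp add: algebra_simps)
        finally have hb: "\<bar>h \<omega>\<bar> \<le> 2 * (?Z * (r + ?y))" .
        have "\<bar>w \<omega>\<bar> * \<bar>h \<omega>\<bar> \<le> (6 * m * (r\<^sup>2 + ?y\<^sup>2)) * (2 * (?Z * (r + ?y)))"
          using wb hb m2 by (intro mult_mono) auto
        also have "\<dots> = 12 * m * ?Z * ((r\<^sup>2 + ?y\<^sup>2) * (r + ?y))" by (simp only: mult_ac) 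
        also have "\<dots> \<le> 12 * m * ?Z * (2 * (r ^ 3 + ?y ^ 3))"
          using sq_sum_times_sum_le[of r ?y] r m2 by (intro mult_left_mono) auto
        finally show ?thesis by (simp add: algebra_simps)
      qed
      finally show ?thesis by (simp add: mult_left_mono)
    qed
    show "norm (complex_of_real (k \<omega>) * iexp (\<xi> * F \<omega>) 
        - complex_of_real (k \<omega>) * e' \<omega> * (1 + \<i> * (\<xi> * h \<omega>))
      + \<i> * \<xi> * (complex_of_real (w \<omega>) * e' \<omega> - complex_of_real (w \<omega>) * iexp (\<xi> * F \<omega>))) \<le> G \<omega>"
      unfolding G_def using norm_triangle_mono[OF a b] c1 c2 by linarith
  qed
qed

end

section \<open>From one coordinate to the characteristic function of a quadratic form\<close>

context iid_innovations
begin

definition offdiag :: "(int \<Rightarrow> int \<Rightarrow> real) \<Rightarrow> int \<Rightarrow> int \<Rightarrow> real" where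
  "offdiag B s t = (if s = t then 0 else B s t)"

text \<open>Entries of \<open>G\<^sup>2\<close> for the off-diagonal part \<open>G\<close> of a
  symmetric \<open>B\<close>. The matrix enters because the squared leave-one-out linear forms sum
  to its quadratic form.\<close>

definition offdiag_square :: "(int \<Rightarrow> int \<Rightarrow> real) \<Rightarrow> int set \<Rightarrow> int \<Rightarrow> int \<Rightarrow> real" where
  "offdiag_square B T s u = (\<Sum>t\<in>T. offdiag B t s * offdiag B t u)"

lemma lin_offdiag:
  assumes "finite T" "t \<in> T"
  shows "lin (B t) (T - {t}) = lin (offdiag B t) T"
proof
  fix \<omega>
  have "lin (offdiag B t) T \<omega> = (\<Sum>s\<in>T - {t}. offdiag B t s * z s \<omega>)"
    unfolding lin_def using assms by (subst sum.remove[of _ t]) (auto simp: offdiag_def)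
  also have "\<dots> = lin (B t) (T - {t}) \<omega>" unfolding lin_def by (intro sum.cong) (auto simp: offdiag_def)
  finally show "lin (B t) (T - {t}) \<omega> = lin (offdiag B t) T \<omega>" ..
qed

lemma qf_as_sum:
  assumes "finite T"
  shows "qf B T \<omega> = (\<Sum>t\<in>T. B t t * eta (z t \<omega>) + z t \<omega> * lin (B t) (T - {t}) \<omega>)"
proof -
  have "(\<Sum>s\<in>T. B t s * z t \<omega> * z s \<omega>) = B t t * (z t \<omega>)\<^sup>2 + z t \<omega> * lin (B t) (T - {t}) \<omega>" if "t \<in> T" for t
    using assms that
    by (subst sum.remove[of _ t]) (auto simp: lin_def sum_distrib_left power2_eq_square intro!: sum.cong)
  then show ?thesis unfolding qf_def sum_subtractf[symmetric]
    by (intro sum.cong) (auto simp: eta_def algebra_simps)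
qed

lemma sum_lin: "(\<Sum>t\<in>T. lin (D t) T \<omega>) = lin (\<lambda>s. \<Sum>t\<in>T. D t s) T \<omega>"
  unfolding lin_def sum_distrib_right by (rule sum.swap)

text \<open>The mean that the centring of \<open>qf\<close> removes is the trace of
  \<open>G\<^sup>2\<close>, the squared Frobenius norm of \<open>G\<close>; it is later cancelled by
  the condition of unit variance.\<close>

lemma sum_lin_square:
  "(\<Sum>t\<in>T. (lin (offdiag B t) T \<omega>)\<^sup>2) = qf (offdiag_square B T) T \<omega> + (\<Sum>s\<in>T. \<Sum>t\<in>T. (offdiag B t s)\<^sup>2)"
proof -
  have "(\<Sum>t\<in>T. (lin (offdiag B t) T \<omega>)\<^sup>2) = (\<Sum>t\<in>T. \<Sum>s\<in>T. \<Sum>u\<in>T. offdiag B t s * offdiag B t u * z s \<omega> * z u \<omega>)"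
    unfolding lin_def power2_eq_square sum_product by (simp add: mult_ac)
  also have "\<dots> = (\<Sum>s\<in>T. \<Sum>t\<in>T. \<Sum>u\<in>T. offdiag B t s * offdiag B t u * z s \<omega> * z u \<omega>)" by (rule sum.swap)
  also have "\<dots> = (\<Sum>s\<in>T. \<Sum>u\<in>T. \<Sum>t\<in>T. offdiag B t s * offdiag B t u * z s \<omega> * z u \<omega>)"
    by (intro sum.cong refl sum.swap)
  finally show ?thesis
    unfolding qf_def offdiag_square_def by (simp add: sum_distrib_right power2_eq_square)
qed

text \<open>The row sums are \<open>G 1\<close> for the symmetric matrix \<open>G = offdiag B\<close>, and
  \<open>\<parallel>G 1\<parallel>\<^sup>2 = 1\<^sup>T G\<^sup>2 1\<close> is at most \<open>card T\<close> times the Frobenius norm of \<open>G\<^sup>2\<close>.\<close>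

lemma sum_row_sums_le:
  assumes T: "finite T" and sym: "\<And>s t. s \<in> T \<Longrightarrow> t \<in> T \<Longrightarrow> B s t = B t s"
    and \<delta>: "(\<Sum>s\<in>T. \<Sum>u\<in>T. (offdiag_square B T s u)\<^sup>2) \<le> \<delta>"
  shows "(\<Sum>s\<in>T. (\<Sum>t\<in>T. offdiag B t s)\<^sup>2) \<le> card T * sqrt \<delta>"
proof -
  have "(\<Sum>s\<in>T. (\<Sum>t\<in>T. offdiag B t s)\<^sup>2) = (\<Sum>s\<in>T. \<Sum>t\<in>T. \<Sum>u\<in>T. offdiag B t s * offdiag B u s)"
    unfolding power2_eq_square sum_product ..
  also have "\<dots> = (\<Sum>t\<in>T. \<Sum>s\<in>T. \<Sum>u\<in>T. offdiag B t s * offdiag B u s)" by (rule sum.swap)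
  also have "\<dots> = (\<Sum>t\<in>T. \<Sum>u\<in>T. \<Sum>s\<in>T. offdiag B t s * offdiag B u s)"
    by (intro sum.cong refl sum.swap)
  also have "\<dots> = (\<Sum>t\<in>T. \<Sum>u\<in>T. offdiag_square B T t u)"
    unfolding offdiag_square_def by (intro sum.cong refl) (auto simp: offdiag_def sym)
  finally have e: "(\<Sum>s\<in>T. (\<Sum>t\<in>T. offdiag B t s)\<^sup>2) = (\<Sum>p\<in>T\<times>T. offdiag_square B T (fst p) (snd p))"
    by (simp add: sum.cartesian_product split_def)
  have "(\<Sum>p\<in>T\<times>T. offdiag_square B T (fst p) (snd p))\<^sup>2 \<le> (\<Sum>p\<in>T\<times>T. (offdiag_square B T (fst p) (snd p))\<^sup>2) * card (T \<times> T)"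
    by (rule sum_squared_le_sum_of_squares)
  also have "\<dots> \<le> \<delta> * card (T \<times> T)"
    using \<delta> by (intro mult_right_mono) (auto simp: sum.cartesian_product split_def)
  finally have "(\<Sum>p\<in>T\<times>T. offdiag_square B T (fst p) (snd p)) \<le> sqrt (\<delta> * card (T \<times> T))"
    by (rule real_le_rsqrt)
  then show ?thesis unfolding e by (simp add: card_cartesian_product real_sqrt_mult mult.commute)
qed

text \<open>Summation of the one-coordinate steps. The weights \<open>w t\<close> add up to one plus
  a small variable, because their means add up exactly to the variance of the form. What remains is
  \<open>\<phi>' = -\<xi> \<phi>\<close> up to an error, to be compared with the Gaussian.\<close>

lemma qf_char_bound:
  assumes T: "finite T" and sym: "\<And>s t. s \<in> T \<Longrightarrow> t \<in> T \<Longrightarrow> B s t = B t s"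
    and diag: "\<And>t. t \<in> T \<Longrightarrow> B t t = \<alpha>" and r: "0 < r" and al: "\<bar>\<alpha>\<bar> \<le> r"
    and row: "\<And>t. t \<in> T \<Longrightarrow> (\<Sum>s\<in>T - {t}. (B t s)\<^sup>2) \<le> r\<^sup>2"
    and var: "expectation (\<lambda>\<omega>. (qf B T \<omega>)\<^sup>2) = 1"
    and \<delta>: "(\<Sum>s\<in>T. \<Sum>u\<in>T. (offdiag_square B T s u)\<^sup>2) \<le> \<delta>"
    and \<xi>: "\<bar>\<xi>\<bar> \<le> R"
  shows "norm (expectation (\<lambda>\<omega>. iexp (\<xi> * qf B T \<omega>)) - complex_of_real (exp (- (\<xi>\<^sup>2) / 2)))
    \<le> (card T * (r\<^sup>2 * cap_moment R r + 100 * R\<^sup>2 * (mu4 + 1) * (mu4 + 3) * r ^ 3)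
        + R * (3 * r * (mu4 + 1) * sqrt (card T * sqrt \<delta>) + 2 * sqrt ((mu4 + 2) * \<delta>))) * exp (R\<^sup>2 / 2) * R"
proof -
  define F where "F = qf B T"
  define H where "H = offdiag_square B T"
  define \<rho> where "\<rho> s = (\<Sum>t\<in>T. offdiag B t s)" for s
  define Y where "Y t = lin (B t) (T - {t})" for t
  define w where "w t \<omega> = (B t t)\<^sup>2 * (mu4 - 1) + 3 * B t t * mu3 * Y t \<omega> + 2 * (Y t \<omega>)\<^sup>2" for t \<omega>
  define k where "k t \<omega> = B t t * eta (z t \<omega>) + z t \<omega> * Y t \<omega>" for t \<omega>
  have Hsym: "H s u = H u s" for s u unfolding H_def offdiag_square_def by (simp add: mult.commute)
  have [measurable]: "F \<in> borel_measurable M" unfolding F_def by simp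
  note qm = qf_moments[of T B, OF T sym]
  have F2: "integrable M (\<lambda>\<omega>. (F \<omega>)\<^sup>2)" unfolding F_def using qm by blast
  have k: "F \<omega> = (\<Sum>t\<in>T. k t \<omega>)" for \<omega> unfolding F_def k_def Y_def by (rule qf_as_sum[OF T])
  have d0: "0 \<le> \<delta>" by (rule order_trans[OF _ \<delta>]) (intro sum_nonneg, auto)

  have "(\<Sum>s\<in>T. \<Sum>t\<in>T. (B s t)\<^sup>2) = (\<Sum>s\<in>T. \<alpha>\<^sup>2 + (\<Sum>t\<in>T. (offdiag B t s)\<^sup>2))"
  proof (intro sum.cong refl)
    fix s assume s: "s \<in> T"
    have "(\<Sum>t\<in>T. (B s t)\<^sup>2) = \<alpha>\<^sup>2 + (\<Sum>t\<in>T-{s}. (B s t)\<^sup>2)" using T s diag by (subst sum.remove[of _ s]) auto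
    also have "(\<Sum>t\<in>T-{s}. (B s t)\<^sup>2) = (\<Sum>t\<in>T-{s}. (offdiag B t s)\<^sup>2)"
      using s by (intro sum.cong refl) (auto simp: offdiag_def sym)
    also have "\<dots> = (\<Sum>t\<in>T. (offdiag B t s)\<^sup>2)"
      using T s by (subst (2) sum.remove[of _ s]) (auto simp: offdiag_def)
    finally show "(\<Sum>t\<in>T. (B s t)\<^sup>2) = \<alpha>\<^sup>2 + (\<Sum>t\<in>T. (offdiag B t s)\<^sup>2)" .
  qed
  \<comment> \<open>Unit variance with the diagonal split off: \<open>mu4 - 3\<close> plus the 2
    from the full double sum. The right-hand side is the mean of the sum of the \<open>w t\<close>
    and therefore cancels in \<open>V\<close>.\<close>
  then have tot: "1 = (mu4 - 1) * (card T * \<alpha>\<^sup>2) + 2 * (\<Sum>s\<in>T. \<Sum>t\<in>T. (offdiag B t s)\<^sup>2)"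
    using qm var diag by (simp add: sum.distrib algebra_simps)
  have V: "(\<Sum>t\<in>T. w t \<omega>) - 1 = 3 * \<alpha> * mu3 * lin \<rho> T \<omega> + 2 * qf H T \<omega>" for \<omega>
  proof -
    have "(\<Sum>t\<in>T. w t \<omega>) = (\<Sum>t\<in>T. \<alpha>\<^sup>2 * (mu4 - 1) + 3 * \<alpha> * mu3 * lin (offdiag B t) T \<omega> + 2 * (lin (offdiag B t) T \<omega>)\<^sup>2)"
      unfolding w_def Y_def by (intro sum.cong refl) (simp add: diag lin_offdiag[OF T])
    also have "\<dots> = card T * (\<alpha>\<^sup>2 * (mu4 - 1)) + 3 * \<alpha> * mu3 * (\<Sum>t\<in>T. lin (offdiag B t) T \<omega>) + 2 * (\<Sum>t\<in>T. (lin (offdiag B t) T \<omega>)\<^sup>2)"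
      by (simp add: sum.distrib sum_distrib_left)
    finally show ?thesis unfolding sum_lin sum_lin_square using tot by (simp add: \<rho>_def[abs_def] H_def algebra_simps)
  qed
  \<comment> \<open>Fluctuation of the sum of the \<open>w t\<close>. Its first absolute moment is
    enough, as the exponential beside it has modulus one.\<close>
  define v where "v \<omega> = 3 * \<alpha> * mu3 * lin \<rho> T \<omega> + 2 * qf H T \<omega>" for \<omega>
  note lm = lin_moments[OF T, of \<rho>] and hm = qf_moments[of T H, OF T Hsym]
  have il: "integrable M (lin \<rho> T)" using integrable_lin[OF T] .
  have ih: "integrable M (qf H T)" using integrable_qf[of T H, OF T Hsym] .
  have iv: "integrable M v" unfolding v_def[abs_def] using il ih by simp
  have Ev: "expectation (\<lambda>\<omega>. \<bar>v \<omega>\<bar>) \<le> 3 * r * (mu4 + 1) * sqrt (card T * sqrt \<delta>) + 2 * sqrt ((mu4 + 2) * \<delta>)"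
  proof -
    have "expectation (\<lambda>\<omega>. \<bar>v \<omega>\<bar>) \<le> expectation (\<lambda>\<omega>. 3 * (\<bar>\<alpha>\<bar> * \<bar>mu3\<bar>) * \<bar>lin \<rho> T \<omega>\<bar> + 2 * \<bar>qf H T \<omega>\<bar>)"
    proof (intro integral_mono)
      fix \<omega>
      have "\<bar>v \<omega>\<bar> \<le> \<bar>3 * \<alpha> * mu3 * lin \<rho> T \<omega>\<bar> + \<bar>2 * qf H T \<omega>\<bar>" unfolding v_def by (rule abs_triangle_ineq)
      then show "\<bar>v \<omega>\<bar> \<le> 3 * (\<bar>\<alpha>\<bar> * \<bar>mu3\<bar>) * \<bar>lin \<rho> T \<omega>\<bar> + 2 * \<bar>qf H T \<omega>\<bar>" by (simp add: abs_mult)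
    qed (use iv il ih in auto)
    also have "\<dots> = 3 * (\<bar>\<alpha>\<bar> * \<bar>mu3\<bar>) * expectation (\<lambda>\<omega>. \<bar>lin \<rho> T \<omega>\<bar>) + 2 * expectation (\<lambda>\<omega>. \<bar>qf H T \<omega>\<bar>)"
      using il ih by simp
    also have "\<dots> \<le> 3 * (r * (mu4 + 1)) * sqrt (card T * sqrt \<delta>) + 2 * sqrt ((mu4 + 2) * \<delta>)"
    proof (intro add_mono mult_mono)
      have "expectation (\<lambda>\<omega>. (lin \<rho> T \<omega>)\<^sup>2) \<le> card T * sqrt \<delta>"
        using lm sum_row_sums_le[of T B \<delta>, OF T sym \<delta>] by (simp add: \<rho>_def)
      then show "expectation (\<lambda>\<omega>. \<bar>lin \<rho> T \<omega>\<bar>) \<le> sqrt (card T * sqrt \<delta>)"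
        using expectation_abs_le_sqrt(2)[of "lin \<rho> T"] lm by (auto intro: order_trans)
      have "expectation (\<lambda>\<omega>. (qf H T \<omega>)\<^sup>2) \<le> (mu4 + 2) * (\<Sum>s\<in>T. \<Sum>u\<in>T. (H s u)\<^sup>2)"
        using qf_second_moment_le[of T H, OF T Hsym] .
      also have "\<dots> \<le> (mu4 + 2) * \<delta>" using \<delta> mu4_ge_1 by (intro mult_left_mono) (auto simp: H_def)
      finally show "expectation (\<lambda>\<omega>. \<bar>qf H T \<omega>\<bar>) \<le> sqrt ((mu4 + 2) * \<delta>)"
        using expectation_abs_le_sqrt(2)[of "qf H T"] hm by (auto intro: order_trans)
    qed (use al abs_mu3_le r mu4_ge_1 d0 in auto)
    finally show ?thesis by simp
  qed

  let ?E = "r\<^sup>2 * cap_moment R r + 100 * R\<^sup>2 * (mu4 + 1) * (mu4 + 3) * r ^ 3"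
  have stein: "norm (expectation (\<lambda>\<omega>. F \<omega> * iexp (x * F \<omega>)) - \<i> * x * expectation (\<lambda>\<omega>. iexp (x * F \<omega>)))
     \<le> card T * ?E + R * (3 * r * (mu4 + 1) * sqrt (card T * sqrt \<delta>) + 2 * sqrt ((mu4 + 2) * \<delta>))"
    if x: "\<bar>x\<bar> \<le> R" for x
  proof -
    have step: "norm (expectation (\<lambda>\<omega>. k t \<omega> * iexp (x * F \<omega>)) - \<i> * x * expectation (\<lambda>\<omega>. w t \<omega> * iexp (x * F \<omega>))) \<le> ?E"
      "integrable M (w t)" "integrable M (k t)" if "t \<in> T" for t
      using stein_step[of T t B r x R, OF T that sym r _ row[OF that] x] al diag[OF that]
      unfolding w_def[abs_def] k_def[abs_def] Y_def F_def by auto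
    have ie: "integrable M (\<lambda>\<omega>. iexp (x * F \<omega>))" by (rule integrable_const_bound[where B=1]) auto
    have ik: "integrable M (\<lambda>\<omega>. k t \<omega> * iexp (x * F \<omega>))" "integrable M (\<lambda>\<omega>. w t \<omega> * iexp (x * F \<omega>))" if "t \<in> T" for t
      by (intro integrable_mult_iexp step[OF that]; measurable)+
    have ive: "integrable M (\<lambda>\<omega>. v \<omega> * iexp (x * F \<omega>))" by (intro integrable_mult_iexp iv; measurable)
    have a: "expectation (\<lambda>\<omega>. F \<omega> * iexp (x * F \<omega>)) = (\<Sum>t\<in>T. expectation (\<lambda>\<omega>. k t \<omega> * iexp (x * F \<omega>)))"
    proof -
      have "complex_of_real (F \<omega>) * iexp (x * F \<omega>) = (\<Sum>t\<in>T. k t \<omega> * iexp (x * F \<omega>))" for \<omega>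
        unfolding sum_distrib_right[symmetric] of_real_sum[symmetric] k[symmetric] ..
      then show ?thesis using ik by simp
    qed
    \<comment> \<open>The identity that the sum of the \<open>w t\<close> minus \<open>v\<close>
      equals 1 is inserted under the expectation, which expresses the characteristic function itself
      through the weights \<open>w t\<close>.\<close>
    have b: "expectation (\<lambda>\<omega>. iexp (x * F \<omega>)) = (\<Sum>t\<in>T. expectation (\<lambda>\<omega>. w t \<omega> * iexp (x * F \<omega>))) - expectation (\<lambda>\<omega>. v \<omega> * iexp (x * F \<omega>))"
    proof -
      have "iexp (x * F \<omega>) = (\<Sum>t\<in>T. w t \<omega> * iexp (x * F \<omega>)) - v \<omega> * iexp (x * F \<omega>)" for \<omega>
      proof -
        have "(\<Sum>t\<in>T. w t \<omega>) - v \<omega> = 1" using V[of \<omega>] by (simp add: v_def)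
        then have "complex_of_real ((\<Sum>t\<in>T. w t \<omega>) - v \<omega>) * iexp (x * F \<omega>) = iexp (x * F \<omega>)" by simp
        then show ?thesis by (simp only: of_real_diff of_real_sum left_diff_distrib sum_distrib_right)
      qed
      then have "expectation (\<lambda>\<omega>. iexp (x * F \<omega>)) = expectation (\<lambda>\<omega>. (\<Sum>t\<in>T. w t \<omega> * iexp (x * F \<omega>)) - v \<omega> * iexp (x * F \<omega>))"
        by (rule Bochner_Integration.integral_cong[OF refl])
      then show ?thesis using ik ive by simp
    qed
    have "expectation (\<lambda>\<omega>. F \<omega> * iexp (x * F \<omega>)) - \<i> * x * expectation (\<lambda>\<omega>. iexp (x * F \<omega>))
       = (\<Sum>t\<in>T. expectation (\<lambda>\<omega>. k t \<omega> * iexp (x * F \<omega>)) - \<i> * x * expectation (\<lambda>\<omega>. w t \<omega> * iexp (x * F \<omega>)))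
         + \<i> * x * expectation (\<lambda>\<omega>. v \<omega> * iexp (x * F \<omega>))"
      unfolding a b by (simp only: sum_subtractf right_diff_distrib sum_distrib_left) simp
    also have "norm \<dots> \<le> card T * ?E + R * (3 * r * (mu4 + 1) * sqrt (card T * sqrt \<delta>) + 2 * sqrt ((mu4 + 2) * \<delta>))"
    proof (intro norm_triangle_mono)
      show "norm (\<Sum>t\<in>T. expectation (\<lambda>\<omega>. k t \<omega> * iexp (x * F \<omega>)) - \<i> * x * expectation (\<lambda>\<omega>. w t \<omega> * iexp (x * F \<omega>))) \<le> card T * ?E"
        using sum_norm_le[of T _ "\<lambda>_. ?E", OF step(1)] by simp
      have "norm (expectation (\<lambda>\<omega>. v \<omega> * iexp (x * F \<omega>))) \<le> expectation (\<lambda>\<omega>. \<bar>v \<omega>\<bar>)"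
        using iv ive by (intro norm_integral_le) (auto simp: norm_mult)
      then have "norm (expectation (\<lambda>\<omega>. v \<omega> * iexp (x * F \<omega>))) \<le> 3 * r * (mu4 + 1) * sqrt (card T * sqrt \<delta>) + 2 * sqrt ((mu4 + 2) * \<delta>)"
        using Ev by linarith
      then show "norm (\<i> * x * expectation (\<lambda>\<omega>. v \<omega> * iexp (x * F \<omega>))) \<le> R * (3 * r * (mu4 + 1) * sqrt (card T * sqrt \<delta>) + 2 * sqrt ((mu4 + 2) * \<delta>))"
        using x unfolding norm_mult by (intro mult_mono) auto
    qed
    finally show ?thesis .
  qed
  show ?thesis unfolding F_def[symmetric]
  proof (rule norm_close_to_gaussian_char[OF iexp_expectation_has_vector_derivative[OF _ F2] _ _ \<xi>])
    show "expectation (\<lambda>\<omega>. iexp (0 * F \<omega>)) = 1" by (simp add: prob_space)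
    fix x assume x: "\<bar>x\<bar> \<le> R"
    have "\<i> * expectation (\<lambda>\<omega>. F \<omega> * iexp (x * F \<omega>)) + x * expectation (\<lambda>\<omega>. iexp (x * F \<omega>))
      = \<i> * (expectation (\<lambda>\<omega>. F \<omega> * iexp (x * F \<omega>)) - \<i> * x * expectation (\<lambda>\<omega>. iexp (x * F \<omega>)))"
      unfolding right_diff_distrib by (simp flip: mult.assoc)
    then show "norm (\<i> * expectation (\<lambda>\<omega>. F \<omega> * iexp (x * F \<omega>)) + x * expectation (\<lambda>\<omega>. iexp (x * F \<omega>)))
      \<le> card T * ?E + R * (3 * r * (mu4 + 1) * sqrt (card T * sqrt \<delta>) + 2 * sqrt ((mu4 + 2) * \<delta>))"
      using stein[OF x] by (simp add: norm_mult)
  qed simp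
qed

text \<open>The scale is \<open>r = sqrt (K / n)\<close>: then \<open>n * r\<^sup>2 = K\<close>,
  while \<open>n * r ^ 3 = K * r\<close> tends to zero, and the cardinality under the square root is
  absorbed by the factor \<open>r\<close> in front of it.\<close>

lemma qf_char_tendsto_gaussian:
  assumes sym: "\<And>n s t. B n s t = B n t s" and K: "0 < K"
    and ev: "\<forall>\<^sub>F n in sequentially. (\<forall>t\<in>{1..int n}. B n t t = \<alpha> n \<and> (\<Sum>s\<in>{1..int n} - {t}. (B n t s)\<^sup>2) \<le> K / n)
      \<and> (\<alpha> n)\<^sup>2 \<le> K / n \<and> expectation (\<lambda>\<omega>. (qf (B n) {1..int n} \<omega>)\<^sup>2) = 1
      \<and> (\<Sum>s\<in>{1..int n}. \<Sum>u\<in>{1..int n}. (offdiag_square (B n) {1..int n} s u)\<^sup>2) \<le> \<delta> n"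
    and \<delta>: "\<delta> \<longlonglongrightarrow> 0"
  shows "(\<lambda>n. expectation (\<lambda>\<omega>. iexp (\<xi> * qf (B n) {1..int n} \<omega>))) \<longlonglongrightarrow> complex_of_real (exp (- (\<xi>\<^sup>2) / 2))"
proof -
  define r where "r n = sqrt (K / real n)" for n
  define R where "R = \<bar>\<xi>\<bar>"
  define g where "g n = ((K * cap_moment R (r n) + 100 * R\<^sup>2 * (mu4 + 1) * (mu4 + 3) * (K * r n))
        + R * (3 * (mu4 + 1) * sqrt (K * sqrt (\<delta> n)) + 2 * sqrt ((mu4 + 2) * \<delta> n))) * exp (R\<^sup>2 / 2) * R" for n
  have r0: "r \<longlonglongrightarrow> 0"
    using tendsto_real_sqrt[OF tendsto_mult[OF tendsto_const[of K] lim_inverse_n]] by (simp add: r_def[abs_def] divide_inverse)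
  have "g \<longlonglongrightarrow> ((K * 0 + 100 * R\<^sup>2 * (mu4 + 1) * (mu4 + 3) * (K * 0))
        + R * (3 * (mu4 + 1) * sqrt (K * sqrt 0) + 2 * sqrt ((mu4 + 2) * 0))) * exp (R\<^sup>2 / 2) * R"
    unfolding g_def[abs_def] using K
    by (intro tendsto_intros r0 \<delta> cap_moment_tendsto_0) (auto simp: R_def r_def)
  then have g0: "g \<longlonglongrightarrow> 0" by simp
  have "(\<lambda>n. expectation (\<lambda>\<omega>. iexp (\<xi> * qf (B n) {1..int n} \<omega>)) - complex_of_real (exp (- (\<xi>\<^sup>2) / 2))) \<longlonglongrightarrow> 0"
  proof (rule Lim_null_comparison[OF _ g0])
    show "\<forall>\<^sub>F n in sequentially. norm (expectation (\<lambda>\<omega>. iexp (\<xi> * qf (B n) {1..int n} \<omega>)) - complex_of_real (exp (- (\<xi>\<^sup>2) / 2))) \<le> g n"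
      using ev eventually_gt_at_top[of "0::nat"]
    proof eventually_elim
      case (elim n)
      have r: "0 < r n" "(r n)\<^sup>2 = K / n" using K elim by (auto simp: r_def)
      have al: "\<bar>\<alpha> n\<bar> \<le> r n" unfolding r_def using elim by (intro real_le_rsqrt) auto
      have "norm (expectation (\<lambda>\<omega>. iexp (\<xi> * qf (B n) {1..int n} \<omega>)) - complex_of_real (exp (- (\<xi>\<^sup>2) / 2)))
         \<le> (card {1..int n} * ((r n)\<^sup>2 * cap_moment R (r n) + 100 * R\<^sup>2 * (mu4 + 1) * (mu4 + 3) * (r n) ^ 3)
        + R * (3 * (r n) * (mu4 + 1) * sqrt (card {1..int n} * sqrt (\<delta> n)) + 2 * sqrt ((mu4 + 2) * \<delta> n))) * exp (R\<^sup>2 / 2) * R"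
        by (rule qf_char_bound[where \<alpha>="\<alpha> n"]) (use elim r al sym in \<open>auto simp: R_def\<close>)
      also have "\<dots> = g n"
      proof -
        have "n * ((r n)\<^sup>2 * cap_moment R (r n) + 100 * R\<^sup>2 * (mu4 + 1) * (mu4 + 3) * (r n) ^ 3)
          = (n * (r n)\<^sup>2) * cap_moment R (r n) + 100 * R\<^sup>2 * (mu4 + 1) * (mu4 + 3) * ((n * (r n)\<^sup>2) * r n)"
          by (simp add: power2_eq_square power3_eq_cube algebra_simps)
        moreover have "n * (r n)\<^sup>2 = K" using r elim by simp
        moreover have "3 * r n * (mu4 + 1) * sqrt (n * sqrt (\<delta> n)) = 3 * (mu4 + 1) * sqrt (K * sqrt (\<delta> n))"
        proof -
          have "r n * sqrt (real n) = sqrt K" unfolding r_def real_sqrt_mult[symmetric] using elim by simp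
          moreover have "3 * r n * (mu4 + 1) * sqrt (n * sqrt (\<delta> n)) = 3 * (mu4 + 1) * (r n * sqrt n) * sqrt (sqrt (\<delta> n))"
            by (simp add: real_sqrt_mult)
          ultimately show ?thesis by (simp add: real_sqrt_mult)
        qed
        ultimately show ?thesis unfolding g_def by simp
      qed
      finally show ?case .
    qed
  qed
  then show ?thesis by (simp add: LIM_zero_iff)
qed

end

subsection \<open>Discrete orthogonality and circulant quadratic forms\<close>

lemma cis_eq_1_iff: "cis x = 1 \<longleftrightarrow> (\<exists>k::int. x = 2 * pi * k)"
proof -
  have "cis x = 1 \<longleftrightarrow> exp (\<i> * complex_of_real x) = 1" by (simp add: cis_conv_exp)
  also have "\<dots> \<longleftrightarrow> (\<exists>k::int. x = 2 * pi * k)"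
    by (subst exp_eq_1) (auto simp: mult_ac)
  finally show ?thesis .
qed

lemma sum_int_Icc: "(\<Sum>t\<in>{1..int n}. f t) = (\<Sum>t=1..n. f (int t))"
proof -
  have "{1..int n} = int ` {1..n}" using image_int_atLeastAtMost[of 1 n] by simp
  then show ?thesis by (simp add: sum.reindex)
qed

lemma sum_cis_eq_0:
  assumes n: "0 < n" and m: "\<not> int n dvd m"
  shows "(\<Sum>t\<in>{1..int n}. cis (real_of_int t * (2 * pi * real_of_int m / real n))) = 0"
proof -
  define w where "w = cis (2 * pi * real_of_int m / real n)"
  have w1: "w \<noteq> 1"
  proof
    assume "w = 1"
    then obtain k :: int where "2 * pi * real_of_int m / real n = 2 * pi * k" unfolding w_def cis_eq_1_iff by auto
    then have "real_of_int m = real_of_int k * real n" using n by (simp add: field_simps)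
    then have "m = k * int n" by (metis of_int_eq_iff of_int_mult of_int_of_nat_eq)
    then show False using m by simp
  qed
  have wn: "w ^ n = 1"
    unfolding w_def Complex.DeMoivre using n by (simp add: cis_eq_1_iff)
  have "(\<Sum>t\<in>{1..int n}. cis (real_of_int t * (2 * pi * real_of_int m / real n))) = (\<Sum>t=1..n. w ^ t)"
    unfolding sum_int_Icc w_def Complex.DeMoivre by simp
  also have "\<dots> = (\<Sum>t<n. w * w ^ t)"
    by (rule sum.reindex_bij_witness[of _ Suc "\<lambda>t. t - 1"]) (auto simp flip: power_Suc)
  also have "\<dots> = w * ((w ^ n - 1) / (w - 1))"
    unfolding sum_distrib_left[symmetric] using w1 by (simp add: geometric_sum)
  finally show ?thesis using wn by simp
qed

lemma sum_cos_eq_0: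
  assumes n: "0 < n" and m: "\<not> int n dvd m"
  shows "(\<Sum>t\<in>{1..int n}. cos (\<theta> + real_of_int t * (2 * pi * real_of_int m / real n))) = 0"
proof -
  have "(\<Sum>t\<in>{1..int n}. cos (\<theta> + real_of_int t * (2 * pi * real_of_int m / real n)))
    = Re (cis \<theta> * (\<Sum>t\<in>{1..int n}. cis (real_of_int t * (2 * pi * real_of_int m / real n))))"
    unfolding sum_distrib_left cis_mult by simp
  then show ?thesis unfolding sum_cis_eq_0[OF assms] by simp
qed

text \<open>Strictness keeps the frequencies away from \<open>\<pi>\<close>, and the sum of two
  admissible indices below \<open>n\<close>; this is what rules out aliasing.\<close>

lemma nu_double_less: "1 \<le> j \<Longrightarrow> j \<le> nu n \<Longrightarrow> 2 * j < n"
  unfolding nu_def by auto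

lemma nu_le: "2 * nu n \<le> n"
  unfolding nu_def by auto

lemma not_dvd_diff_freq:
  assumes "1 \<le> j" "j \<le> nu n" "1 \<le> k" "k \<le> nu n"
  shows "\<not> int n dvd (int j + int k)" and "j \<noteq> k \<Longrightarrow> \<not> int n dvd (int j - int k)"
proof -
  have jk: "2 * j < n" "2 * k < n" using assms nu_double_less by auto
  show "\<not> int n dvd (int j + int k)" using jk assms by (intro zdvd_not_zless) auto
  assume ne: "j \<noteq> k"
  show "\<not> int n dvd (int j - int k)"
  proof (cases "k < j")
    case True then show ?thesis using jk by (intro zdvd_not_zless) auto
  next
    case False
    then have "\<not> int n dvd (int k - int j)" using jk ne by (intro zdvd_not_zless) auto
    then show ?thesis by (metis dvd_minus_iff minus_diff_eq)
  qed
qed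

lemma sum_cis_orthogonal:
  assumes j: "1 \<le> j" "j \<le> nu n" and k: "1 \<le> k" "k \<le> nu n"
  shows "(\<Sum>t\<in>{1..int n}. cis (real_of_int t * freq n j) * cnj (cis (real_of_int t * freq n k))) = (if j = k then of_nat n else 0)"
proof (cases "j = k")
  case True then show ?thesis unfolding cis_cnj cis_mult by simp
next
  case False
  have n: "0 < n" using nu_double_less[OF j] by simp
  have "cis (real_of_int t * freq n j) * cnj (cis (real_of_int t * freq n k)) = cis (real_of_int t * (2 * pi * real_of_int (int j - int k) / real n))" for t
    unfolding cis_cnj cis_mult freq_def by (simp add: add_divide_distrib diff_divide_distrib algebra_simps)
  then show ?thesis using sum_cis_eq_0[OF n not_dvd_diff_freq(2)[OF j k False]] False by simp
qed

text \<open>Product-to-sum formula: the phase with \<open>j + k\<close> always averages out over the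
  \<open>n\<close> time points, the one with \<open>j - k\<close> does so unless the indices agree.
  In matrix terms, cosine kernels at different frequencies annihilate each other.\<close>

lemma sum_cos_cos:
  assumes j: "1 \<le> j" "j \<le> nu n" and k: "1 \<le> k" "k \<le> nu n"
  shows "(\<Sum>t\<in>{1..int n}. cos (real_of_int (s - t) * freq n j) * cos (real_of_int (t - u) * freq n k))
      = (if j = k then n / 2 * cos (real_of_int (s - u) * freq n j) else 0)"
proof -
  have n: "0 < n" using nu_double_less[OF j] by simp
  define \<theta>1 where "\<theta>1 = real_of_int s * freq n j + real_of_int u * freq n k"
  define \<theta>2 where "\<theta>2 = real_of_int s * freq n j - real_of_int u * freq n k"
  have e1: "real_of_int (s - t) * freq n j - real_of_int (t - u) * freq n k
     = \<theta>1 + real_of_int t * (2 * pi * real_of_int (- (int j + int k)) / real n)" for t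
    unfolding \<theta>1_def freq_def by (simp add: add_divide_distrib diff_divide_distrib algebra_simps)
  have e2: "real_of_int (s - t) * freq n j + real_of_int (t - u) * freq n k
     = \<theta>2 + real_of_int t * (2 * pi * real_of_int (- (int j - int k)) / real n)" for t
    unfolding \<theta>2_def freq_def by (simp add: add_divide_distrib diff_divide_distrib algebra_simps)
  have "(\<Sum>t\<in>{1..int n}. cos (real_of_int (s - t) * freq n j) * cos (real_of_int (t - u) * freq n k))
    = ((\<Sum>t\<in>{1..int n}. cos (\<theta>1 + real_of_int t * (2 * pi * real_of_int (- (int j + int k)) / real n)))
     + (\<Sum>t\<in>{1..int n}. cos (\<theta>2 + real_of_int t * (2 * pi * real_of_int (- (int j - int k)) / real n)))) / 2"
    unfolding cos_times_cos e1 e2 by (simp only: sum_divide_distrib[symmetric] sum.distrib)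
  also have "(\<Sum>t\<in>{1..int n}. cos (\<theta>1 + real_of_int t * (2 * pi * real_of_int (- (int j + int k)) / real n))) = 0"
    by (rule sum_cos_eq_0[OF n]) (use not_dvd_diff_freq(1)[OF j k] in \<open>simp only: dvd_minus_iff not_False_eq_True\<close>)
  also have "(\<Sum>t\<in>{1..int n}. cos (\<theta>2 + real_of_int t * (2 * pi * real_of_int (- (int j - int k)) / real n)))
     = (if j = k then n * cos (real_of_int (s - u) * freq n j) else 0)"
  proof (cases "j = k")
    case True then show ?thesis by (simp add: \<theta>2_def algebra_simps)
  next
    case False
    have "\<not> int n dvd - (int j - int k)" using not_dvd_diff_freq(2)[OF j k False] by (simp only: dvd_minus_iff not_False_eq_True)
    from sum_cos_eq_0[OF n this] False show ?thesis by simp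
  qed
  finally show ?thesis by (cases "j = k") (simp_all del: of_int_diff)
qed

text \<open>Circulant matrix of the weighted periodogram sum of the innovations. On the plane
  spanned by the cosine and sine vectors of the \<open>j\<close>-th frequency it acts as
  \<open>c j / 2\<close>, and it vanishes on the orthogonal complement of all these planes.\<close>

definition cosker :: "nat \<Rightarrow> (nat \<Rightarrow> real) \<Rightarrow> int \<Rightarrow> int \<Rightarrow> real" where
  "cosker n c s t = (\<Sum>j=1..nu n. c j * cos (real_of_int (s - t) * freq n j)) / n"

lemma cosker_sym: "cosker n c s t = cosker n c t s"
proof -
  have "cos (real_of_int (s - t) * freq n j) = cos (real_of_int (t - s) * freq n j)" for j
    using cos_minus[of "real_of_int (s - t) * freq n j"] by (simp add: algebra_simps)
  then show ?thesis unfolding cosker_def by simp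
qed

lemma cosker_diag: "cosker n c s s = (\<Sum>j=1..nu n. c j) / n"
  unfolding cosker_def by simp

text \<open>Eigenvalues multiply, and \<open>(c j / 2) * (d j / 2)\<close> is half of
  \<open>c j * d j / 2\<close>.\<close>

lemma cosker_mult:
  "(\<Sum>t\<in>{1..int n}. cosker n c s t * cosker n d t u) = cosker n (\<lambda>j. c j * d j / 2) s u"
proof (cases "n = 0")
  case True then show ?thesis by (simp add: cosker_def nu_def)
next
  case False
  let ?C = "\<lambda>s t j. cos (real_of_int (s - t) * freq n j)"
  have "(\<Sum>t\<in>{1..int n}. cosker n c s t * cosker n d t u)
     = (\<Sum>t\<in>{1..int n}. \<Sum>j=1..nu n. \<Sum>k=1..nu n. c j * d k * (?C s t j * ?C t u k)) / (n * n)"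
    unfolding cosker_def times_divide_times_eq sum_product sum_divide_distrib[symmetric] by (simp add: mult_ac)
  also have "(\<Sum>t\<in>{1..int n}. \<Sum>j=1..nu n. \<Sum>k=1..nu n. c j * d k * (?C s t j * ?C t u k))
     = (\<Sum>j=1..nu n. \<Sum>t\<in>{1..int n}. \<Sum>k=1..nu n. c j * d k * (?C s t j * ?C t u k))" by (rule sum.swap)
  also have "\<dots> = (\<Sum>j=1..nu n. \<Sum>k=1..nu n. \<Sum>t\<in>{1..int n}. c j * d k * (?C s t j * ?C t u k))"
    by (intro sum.cong refl sum.swap)
  also have "\<dots> = (\<Sum>j=1..nu n. \<Sum>k=1..nu n. if j = k then c j * d k * (n / 2 * ?C s u j) else 0)"
    unfolding sum_distrib_left[symmetric] by (intro sum.cong refl) (simp del: of_int_diff add: sum_cos_cos)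
  also have "\<dots> = (\<Sum>j=1..nu n. c j * d j * (n / 2 * ?C s u j))" by (simp add: sum.delta)
  also have "\<dots> / (n * n) = cosker n (\<lambda>j. c j * d j / 2) s u"
    unfolding cosker_def sum_divide_distrib using False by (intro sum.cong refl) (simp add: field_simps)
  finally show ?thesis .
qed

text \<open>The squared norm of a row is a diagonal entry of the squared matrix, and all diagonal
  entries of a circulant matrix are equal.\<close>

lemma cosker_row_squares: "(\<Sum>t\<in>{1..int n}. (cosker n c s t)\<^sup>2) = (\<Sum>j=1..nu n. (c j)\<^sup>2) / (2 * n)"
proof -
  have "(\<Sum>t\<in>{1..int n}. (cosker n c s t)\<^sup>2) = (\<Sum>t\<in>{1..int n}. cosker n c s t * cosker n c t s)"
    by (simp add: power2_eq_square cosker_sym[of n c s])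
  also have "\<dots> = (\<Sum>j=1..nu n. (c j)\<^sup>2) / (2 * n)"
    unfolding cosker_mult cosker_diag by (simp add: sum_divide_distrib power2_eq_square field_simps)
  finally show ?thesis .
qed

lemma cosker_frobenius:
  "0 < n \<Longrightarrow> (\<Sum>s\<in>{1..int n}. \<Sum>t\<in>{1..int n}. (cosker n c s t)\<^sup>2) = (\<Sum>j=1..nu n. (c j)\<^sup>2) / 2"
  unfolding cosker_row_squares by simp

context iid_innovations
begin

lemma qf_cosker:
  assumes n: "0 < n"
  shows "qf (cosker n c) {1..int n} \<omega>
    = (\<Sum>j=1..nu n. c j * ((cmod (\<Sum>t\<in>{1..int n}. cis (real_of_int t * freq n j) * z t \<omega>))\<^sup>2 / n - 1))"
proof -
  have sq: "(cmod (\<Sum>t\<in>{1..int n}. cis (real_of_int t * u) * z t \<omega>))\<^sup>2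
     = (\<Sum>s\<in>{1..int n}. \<Sum>t\<in>{1..int n}. cos (real_of_int (s - t) * u) * z s \<omega> * z t \<omega>)" for u
  proof -
    let ?w = "\<Sum>t\<in>{1..int n}. cis (real_of_int t * u) * z t \<omega>"
    have "(cmod ?w)\<^sup>2 = Re (?w * cnj ?w)" by (simp only: complex_norm_square[symmetric] Re_complex_of_real)
    also have "\<dots> = (\<Sum>s\<in>{1..int n}. \<Sum>t\<in>{1..int n}. Re (cis (real_of_int s * u) * z s \<omega> * (cnj (cis (real_of_int t * u)) * z t \<omega>)))"
      by (simp only: cnj_sum sum_product Re_sum complex_cnj_mult complex_cnj_complex_of_real)
    also have "\<dots> = (\<Sum>s\<in>{1..int n}. \<Sum>t\<in>{1..int n}. cos (real_of_int (s - t) * u) * z s \<omega> * z t \<omega>)"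
      by (intro sum.cong refl) (simp add: cos_diff algebra_simps)
    finally show ?thesis .
  qed
  have "(\<Sum>s\<in>{1..int n}. \<Sum>t\<in>{1..int n}. cosker n c s t * z s \<omega> * z t \<omega>)
    = (\<Sum>s\<in>{1..int n}. \<Sum>t\<in>{1..int n}. \<Sum>j=1..nu n. c j / n * (cos (real_of_int (s - t) * freq n j) * z s \<omega> * z t \<omega>))"
    unfolding cosker_def sum_divide_distrib sum_distrib_right by (intro sum.cong refl) (simp del: of_int_diff)
  also have "\<dots> = (\<Sum>s\<in>{1..int n}. \<Sum>j=1..nu n. \<Sum>t\<in>{1..int n}. c j / n * (cos (real_of_int (s - t) * freq n j) * z s \<omega> * z t \<omega>))"
    by (intro sum.cong refl sum.swap)
  also have "\<dots> = (\<Sum>j=1..nu n. \<Sum>s\<in>{1..int n}. \<Sum>t\<in>{1..int n}. c j / n * (cos (real_of_int (s - t) * freq n j) * z s \<omega> * z t \<omega>))"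
    by (rule sum.swap)
  also have "\<dots> = (\<Sum>j=1..nu n. c j / n * (cmod (\<Sum>t\<in>{1..int n}. cis (real_of_int t * freq n j) * z t \<omega>))\<^sup>2)"
    unfolding sq by (simp add: sum_distrib_left)
  finally show ?thesis using n
    unfolding qf_def cosker_diag by (simp add: right_diff_distrib sum_subtractf mult.commute)
qed

text \<open>When \<open>c j\<close> is \<open>b n j\<close> times the spectral density, the second
  moment is exactly the radicand of \<open>v_norm\<close>, for every positive \<open>n\<close>: the
  squared diagonal entries sum to \<open>(\<Sum> c)\<^sup>2 / n\<close>, all squared entries to
  \<open>(\<Sum> c\<^sup>2) / 2\<close>.\<close>

lemma qf_cosker_moments:
  assumes n: "0 < n"
  shows "integrable M (\<lambda>\<omega>. (qf (cosker n c) {1..int n} \<omega>)\<^sup>2)"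
    and "expectation (qf (cosker n c) {1..int n}) = 0"
    and "expectation (\<lambda>\<omega>. (qf (cosker n c) {1..int n} \<omega>)\<^sup>2)
      = (\<Sum>j=1..nu n. (c j)\<^sup>2) + (mu4 - 3) * (1 / n) * (\<Sum>j=1..nu n. c j)\<^sup>2"
  using qf_moments[of "{1..int n}" "cosker n c", OF _ cosker_sym] n
  by (auto simp: cosker_frobenius cosker_diag power_divide) (simp add: power2_eq_square)

text \<open>With \<open>C\<close> the circulant matrix and \<open>\<alpha>\<close> its diagonal
  value, the off-diagonal part is \<open>C - \<alpha> I\<close>, whose square is
  \<open>C\<^sup>2 - 2 \<alpha> C + \<alpha>\<^sup>2 I\<close>.\<close>

lemma offdiag_square_cosker:
  fixes c :: "nat \<Rightarrow> real"
  assumes n: "0 < n" and s: "s \<in> {1..int n}" and u: "u \<in> {1..int n}"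
  defines "\<alpha> \<equiv> (\<Sum>j=1..nu n. c j) / n"
  shows "offdiag_square (cosker n c) {1..int n} s u
    = cosker n (\<lambda>j. c j * c j / 2) s u - 2 * \<alpha> * cosker n c s u + (if s = u then \<alpha>\<^sup>2 else 0)"
proof -
  let ?C = "cosker n c"
  have G: "offdiag ?C t s = ?C s t - (if s = t then \<alpha> else 0)" for t s
    unfolding offdiag_def \<alpha>_def using cosker_diag[of n c] cosker_sym[of n c t s] by auto
  have "offdiag ?C t s * offdiag ?C t u = ?C s t * ?C t u - (if t = s then \<alpha> * ?C s u else 0) - (if t = u then \<alpha> * ?C s u else 0)
      + (if t = s then (if s = u then \<alpha>\<^sup>2 else 0) else 0)" for t
    unfolding G by (auto simp: power2_eq_square algebra_simps cosker_sym[of n c u])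
  then show ?thesis unfolding offdiag_square_def
    using s u by (simp add: sum.distrib sum_subtractf cosker_mult sum.delta)
qed

text \<open>Only the part \<open>C\<^sup>2\<close> needs the small maximal weight: its squared
  Frobenius norm is the sum of the \<open>c\<^sup>4 / 8\<close>. The squared norms of the other two
  parts carry a factor \<open>\<alpha>\<^sup>2\<close>, which is of order
  \<open>1 / n\<close>.\<close>

lemma offdiag_square_cosker_frobenius:
  fixes c :: "nat \<Rightarrow> real"
  assumes n: "0 < n"
  defines "\<alpha> \<equiv> (\<Sum>j=1..nu n. c j) / n"
  assumes K: "(\<Sum>j=1..nu n. (c j)\<^sup>2) \<le> K" and m: "\<And>j. j \<in> {1..nu n} \<Longrightarrow> \<bar>c j\<bar> \<le> \<epsilon>" and e0: "0 \<le> \<epsilon>"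
    and al: "\<alpha>\<^sup>2 \<le> K / n"
  shows "(\<Sum>s\<in>{1..int n}. \<Sum>u\<in>{1..int n}. (offdiag_square (cosker n c) {1..int n} s u)\<^sup>2)
    \<le> 3 * (\<epsilon>\<^sup>2 * K + 3 * K\<^sup>2 / n)"
proof -
  let ?I = "{1..int n}" and ?d = "\<lambda>j. c j * c j / 2"
  have le: "(x - y + w)\<^sup>2 \<le> 3 * (x\<^sup>2 + y\<^sup>2 + w\<^sup>2)" for x y w :: real
  proof -
    have "0 \<le> (x + y)\<^sup>2 + (x - w)\<^sup>2 + (y + w)\<^sup>2" by simp
    then show ?thesis by (simp add: power2_eq_square algebra_simps)
  qed
  have K0: "0 \<le> K" using K by (rule order_trans[rotated]) (intro sum_nonneg, auto)
  have "(\<Sum>s\<in>?I. \<Sum>u\<in>?I. (offdiag_square (cosker n c) ?I s u)\<^sup>2)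
    \<le> (\<Sum>s\<in>?I. \<Sum>u\<in>?I. 3 * ((cosker n ?d s u)\<^sup>2 + (2 * \<alpha> * cosker n c s u)\<^sup>2 + (if s = u then \<alpha>\<^sup>2 else 0)\<^sup>2))"
    by (intro sum_mono) (simp only: offdiag_square_cosker[OF n] \<alpha>_def[symmetric] le)
  also have "\<dots> = 3 * ((\<Sum>s\<in>?I. \<Sum>u\<in>?I. (cosker n ?d s u)\<^sup>2) + 4 * \<alpha>\<^sup>2 * (\<Sum>s\<in>?I. \<Sum>u\<in>?I. (cosker n c s u)\<^sup>2) + (\<Sum>s\<in>?I. \<Sum>u\<in>?I. if s = u then (\<alpha>\<^sup>2)\<^sup>2 else 0))"
    by (simp add: sum.distrib sum_distrib_left[symmetric] power_mult_distrib if_distrib[of "\<lambda>x. x\<^sup>2"] mult.assoc cong: if_cong)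
  also have "\<dots> = 3 * ((\<Sum>j=1..nu n. (?d j)\<^sup>2) / 2 + 2 * \<alpha>\<^sup>2 * (\<Sum>j=1..nu n. (c j)\<^sup>2) + n * (\<alpha>\<^sup>2)\<^sup>2)"
    unfolding cosker_frobenius[OF n] by (simp add: sum.delta)
  also have "\<dots> \<le> 3 * (\<epsilon>\<^sup>2 * K + 2 * (K / n) * K + n * (K / n)\<^sup>2)"
  proof (intro mult_left_mono add_mono)
    have "(\<Sum>j=1..nu n. (?d j)\<^sup>2) / 2 \<le> (\<Sum>j=1..nu n. \<epsilon>\<^sup>2 * (c j)\<^sup>2)"
    proof -
      have "(?d j)\<^sup>2 / 2 \<le> \<epsilon>\<^sup>2 * (c j)\<^sup>2" if "j \<in> {1..nu n}" for j
      proof -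
        have "(c j)\<^sup>2 \<le> \<epsilon>\<^sup>2" using power_mono[OF m[OF that], of 2] by simp
        then have "(c j)\<^sup>2 * (c j)\<^sup>2 \<le> \<epsilon>\<^sup>2 * (c j)\<^sup>2" by (intro mult_right_mono) auto
        moreover have "(?d j)\<^sup>2 / 2 = (c j)\<^sup>2 * (c j)\<^sup>2 / 8" by (simp add: power2_eq_square)
        moreover have "0 \<le> (c j)\<^sup>2 * (c j)\<^sup>2" by simp
        ultimately show ?thesis by linarith
      qed
      then show ?thesis unfolding sum_divide_distrib by (intro sum_mono)
    qed
    also have "\<dots> \<le> \<epsilon>\<^sup>2 * K" unfolding sum_distrib_left[symmetric] using K by (intro mult_left_mono) auto
    finally show "(\<Sum>j=1..nu n. (?d j)\<^sup>2) / 2 \<le> \<epsilon>\<^sup>2 * K" .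
    show "2 * \<alpha>\<^sup>2 * (\<Sum>j=1..nu n. (c j)\<^sup>2) \<le> 2 * (K / n) * K"
      using al K K0 by (intro mult_mono) (auto intro: sum_nonneg)
    show "(\<alpha>\<^sup>2)\<^sup>2 \<le> (K / n)\<^sup>2" using al by (intro power_mono) auto
  qed auto
  also have "\<dots> = 3 * (\<epsilon>\<^sup>2 * K + 3 * K\<^sup>2 / n)" using n by (simp add: power2_eq_square field_simps)
  finally show ?thesis .
qed

lemma qf_cosker_char_tendsto:
  fixes c :: "nat \<Rightarrow> nat \<Rightarrow> real"
  assumes K: "0 < K" and \<epsilon>: "\<epsilon> \<longlonglongrightarrow> 0" "\<And>n. 0 \<le> \<epsilon> n"
    and ev: "\<forall>\<^sub>F n in sequentially. (\<Sum>j=1..nu n. (c n j)\<^sup>2) \<le> K \<and> (\<forall>j\<in>{1..nu n}. \<bar>c n j\<bar> \<le> \<epsilon> n)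
      \<and> (\<Sum>j=1..nu n. (c n j)\<^sup>2) + (mu4 - 3) * (1 / n) * (\<Sum>j=1..nu n. c n j)\<^sup>2 = 1"
  shows "(\<lambda>n. expectation (\<lambda>\<omega>. iexp (\<xi> * qf (cosker n (c n)) {1..int n} \<omega>))) \<longlonglongrightarrow> complex_of_real (exp (- (\<xi>\<^sup>2) / 2))"
proof (rule qf_char_tendsto_gaussian[where \<alpha>="\<lambda>n. (\<Sum>j=1..nu n. c n j) / n" and K=K and \<delta>="\<lambda>n. 3 * ((\<epsilon> n)\<^sup>2 * K + 3 * K\<^sup>2 / n)"])
  have "(\<lambda>n. 3 * ((\<epsilon> n)\<^sup>2 * K + 3 * K\<^sup>2 * (1 / real n))) \<longlonglongrightarrow> 3 * (0\<^sup>2 * K + 3 * K\<^sup>2 * 0)"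
    by (intro tendsto_intros \<epsilon> lim_1_over_n)
  then show "(\<lambda>n. 3 * ((\<epsilon> n)\<^sup>2 * K + 3 * K\<^sup>2 / real n)) \<longlonglongrightarrow> 0" by simp
  show "\<forall>\<^sub>F n in sequentially. (\<forall>t\<in>{1..int n}. cosker n (c n) t t = (\<Sum>j=1..nu n. c n j) / n
        \<and> (\<Sum>s\<in>{1..int n} - {t}. (cosker n (c n) t s)\<^sup>2) \<le> K / n)
      \<and> ((\<Sum>j=1..nu n. c n j) / n)\<^sup>2 \<le> K / n \<and> expectation (\<lambda>\<omega>. (qf (cosker n (c n)) {1..int n} \<omega>)\<^sup>2) = 1
      \<and> (\<Sum>s\<in>{1..int n}. \<Sum>u\<in>{1..int n}. (offdiag_square (cosker n (c n)) {1..int n} s u)\<^sup>2) \<le> 3 * ((\<epsilon> n)\<^sup>2 * K + 3 * K\<^sup>2 / n)"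
    using ev eventually_gt_at_top[of "0::nat"]
  proof eventually_elim
    case (elim n)
    \<comment> \<open>Cauchy-Schwarz over at most \<open>n\<close> frequencies; it makes the
      diagonal of order \<open>n powr (-1/2)\<close>.\<close>
    have al: "((\<Sum>j=1..nu n. c n j) / n)\<^sup>2 \<le> K / n"
    proof -
      have "(\<Sum>j=1..nu n. c n j)\<^sup>2 \<le> (\<Sum>j=1..nu n. (c n j)\<^sup>2) * card {1..nu n}" by (rule sum_squared_le_sum_of_squares)
      also have "\<dots> \<le> K * n" using elim nu_le[of n] K by (intro mult_mono) auto
      finally show ?thesis using elim by (simp add: power_divide power2_eq_square field_simps)
    qed
    have "(\<Sum>s\<in>{1..int n} - {t}. (cosker n (c n) t s)\<^sup>2) \<le> K / n" if "t \<in> {1..int n}" for t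
    proof -
      have "(\<Sum>s\<in>{1..int n} - {t}. (cosker n (c n) t s)\<^sup>2) \<le> (\<Sum>s\<in>{1..int n}. (cosker n (c n) t s)\<^sup>2)"
        by (intro sum_mono2) auto
      also have "\<dots> = (\<Sum>j=1..nu n. (c n j)\<^sup>2) / (2 * n)" by (rule cosker_row_squares)
      also have "\<dots> \<le> K / n" using elim K by (intro frac_le) auto
      finally show ?thesis .
    qed
    moreover have "(\<Sum>s\<in>{1..int n}. \<Sum>u\<in>{1..int n}. (offdiag_square (cosker n (c n)) {1..int n} s u)\<^sup>2) \<le> 3 * ((\<epsilon> n)\<^sup>2 * K + 3 * K\<^sup>2 / n)"
      by (rule offdiag_square_cosker_frobenius) (use elim al \<epsilon> in auto)
    ultimately show ?case using elim al qf_cosker_moments(3)[of n "c n"] cosker_diag[of n "c n"] by auto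
  qed
qed (use K cosker_sym in auto)

end

subsection \<open>Parseval's identity and the Toeplitz operator of the filter\<close>

lemma has_integral_cis:
  fixes m :: int
  shows "((\<lambda>u. cis (real_of_int m * u)) has_integral (if m = 0 then 2 * pi else 0)) {-pi..pi}"
proof (cases "m = 0")
  case True
  then show ?thesis using has_integral_const_real[of "1::complex" "-pi" pi] by (simp add: scaleR_conv_of_real)
next
  case False
  have "((\<lambda>u. cis (real_of_int m * u)) has_integral
     cis (real_of_int m * pi) / (\<i> * m) - cis (real_of_int m * (- pi)) / (\<i> * m)) {-pi..pi}"
  proof (rule fundamental_theorem_of_calculus)
    fix u
    have "((\<lambda>u. cis (real_of_int m * u)) has_vector_derivative (\<i> * m * cis (real_of_int m * u))) (at u within {-pi..pi})"
      unfolding has_vector_derivative_def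
      by (rule derivative_eq_intros refl)+ (auto simp: scaleR_conv_of_real algebra_simps)
    from has_vector_derivative_divide[OF this, of "\<i> * m"]
    show "((\<lambda>u. cis (real_of_int m * u) / (\<i> * m)) has_vector_derivative cis (real_of_int m * u)) (at u within {-pi..pi})"
      using False by simp
  qed simp
  moreover have "cis (real_of_int m * pi) = cis (real_of_int m * (- pi))"
  proof -
    have "cis (real_of_int m * pi) = cis (real_of_int m * (- pi)) * cis (2 * pi * real_of_int m)"
      unfolding cis_mult by (simp add: algebra_simps)
    then show ?thesis by (simp add: cis_multiple_2pi)
  qed
  ultimately show ?thesis using False by simp
qed

lemma cmod_sum_square:
  fixes p :: "'a \<Rightarrow> complex"
  shows "complex_of_real ((cmod (\<Sum>s\<in>I. p s))\<^sup>2) = (\<Sum>s\<in>I. \<Sum>t\<in>I. p s * cnj (p t))"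
  unfolding complex_norm_square cnj_sum sum_product ..

lemma parseval_finite:
  fixes p :: "int \<Rightarrow> complex"
  assumes I: "finite I"
  shows "((\<lambda>u. (cmod (\<Sum>s\<in>I. p s * cis (- (real_of_int s * u))))\<^sup>2) has_integral 2 * pi * (\<Sum>s\<in>I. (cmod (p s))\<^sup>2)) {-pi..pi}"
proof -
  have e: "complex_of_real ((cmod (\<Sum>s\<in>I. p s * cis (- (real_of_int s * u))))\<^sup>2)
     = (\<Sum>s\<in>I. \<Sum>t\<in>I. p s * cnj (p t) * cis (real_of_int (t - s) * u))" for u
    unfolding cmod_sum_square
  proof (intro sum.cong refl)
    fix s t
    have "cis (- (real_of_int s * u)) * cnj (cis (- (real_of_int t * u))) = cis (real_of_int (t - s) * u)"
      unfolding cis_cnj cis_mult by (simp add: algebra_simps)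
    then show "p s * cis (- (real_of_int s * u)) * cnj (p t * cis (- (real_of_int t * u))) = p s * cnj (p t) * cis (real_of_int (t - s) * u)"
      unfolding complex_cnj_mult by (simp only: mult_ac)
  qed
  have "((\<lambda>u. complex_of_real ((cmod (\<Sum>s\<in>I. p s * cis (- (real_of_int s * u))))\<^sup>2)) has_integral
    (\<Sum>s\<in>I. \<Sum>t\<in>I. p s * cnj (p t) * (if t - s = 0 then 2 * pi else 0))) {-pi..pi}"
    unfolding e using I by (intro has_integral_sum has_integral_mult_right has_integral_cis) auto
  also have "(\<Sum>s\<in>I. \<Sum>t\<in>I. p s * cnj (p t) * (if t - s = 0 then 2 * pi else 0)) = (\<Sum>s\<in>I. \<Sum>t\<in>I. if t = s then p s * cnj (p t) * (2 * pi) else 0)"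
    by (intro sum.cong refl) auto
  also have "\<dots> = complex_of_real (2 * pi * (\<Sum>s\<in>I. (cmod (p s))\<^sup>2))"
    using I by (simp add: sum.delta' complex_norm_square[symmetric] sum_distrib_left mult.commute del: of_real_power)
  finally have "((\<lambda>u. Re (complex_of_real ((cmod (\<Sum>s\<in>I. p s * cis (- (real_of_int s * u))))\<^sup>2))) has_integral
    Re (complex_of_real (2 * pi * (\<Sum>s\<in>I. (cmod (p s))\<^sup>2)))) {-pi..pi}"
    by (intro has_integral_linear[OF _ bounded_linear_Re, unfolded o_def])
  then show ?thesis by simp
qed

definition trunc_transfer :: "(nat \<Rightarrow> real) \<Rightarrow> nat \<Rightarrow> real \<Rightarrow> complex" where
  "trunc_transfer a N u = (\<Sum>k<N. cis (- (real k * u)) * complex_of_real (a k))"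

text \<open>Extension by zero to all integers, so that sums over times and over innovations can be
  exchanged without tracking ranges.\<close>

definition trunc_coeff :: "(nat \<Rightarrow> real) \<Rightarrow> nat \<Rightarrow> int \<Rightarrow> real" where
  "trunc_coeff a N k = (if 0 \<le> k \<and> k < int N then a (nat k) else 0)"

text \<open>The index set of the innovations that occur in the truncated process at times \<open>1, \<dots>, n\<close>.\<close>

definition window :: "nat \<Rightarrow> nat \<Rightarrow> int set" where
  "window n N = {1 - int N..int n}"

text \<open>Transpose of the truncated filter: the coefficient of the innovation at time
  \<open>s\<close> in the combination of the process values with weights \<open>y\<close>.\<close>

definition toep :: "(nat \<Rightarrow> real) \<Rightarrow> nat \<Rightarrow> nat \<Rightarrow> (int \<Rightarrow> complex) \<Rightarrow> int \<Rightarrow> complex" where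
  "toep a n N y s = (\<Sum>t\<in>{1..int n}. y t * complex_of_real (trunc_coeff a N (t - s)))"

definition trig :: "nat \<Rightarrow> (int \<Rightarrow> complex) \<Rightarrow> real \<Rightarrow> complex" where
  "trig n y u = (\<Sum>t\<in>{1..int n}. y t * cis (- (real_of_int t * u)))"

lemma finite_window [simp]: "finite (window n N)" and window_superset: "{1..int n} \<subseteq> window n N"
  unfolding window_def by auto

lemma sum_trunc_coeff:
  fixes g :: "int \<Rightarrow> 'b::real_algebra_1"
  assumes t: "t \<in> {1..int n}"
  shows "(\<Sum>s\<in>window n N. of_real (trunc_coeff a N (t - s)) * g s) = (\<Sum>k<N. of_real (a k) * g (t - int k))"
proof -
  have "(\<Sum>s\<in>window n N. of_real (trunc_coeff a N (t - s)) * g s) = (\<Sum>s\<in>(\<lambda>k. t - int k) ` {..<N}. of_real (trunc_coeff a N (t - s)) * g s)"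
  proof (rule sum.mono_neutral_right)
    show "(\<lambda>k. t - int k) ` {..<N} \<subseteq> window n N" using t by (auto simp: window_def)
    show "\<forall>s\<in>window n N - (\<lambda>k. t - int k) ` {..<N}. of_real (trunc_coeff a N (t - s)) * g s = 0"
    proof
      fix s assume s: "s \<in> window n N - (\<lambda>k. t - int k) ` {..<N}"
      have "\<not> (0 \<le> t - s \<and> t - s < int N)"
      proof
        assume b: "0 \<le> t - s \<and> t - s < int N"
        then have "s = t - int (nat (t - s))" "nat (t - s) < N" by auto
        then show False using s by blast
      qed
      then show "of_real (trunc_coeff a N (t - s)) * g s = 0" by (auto simp: trunc_coeff_def)
    qed
  qed simp
  also have "\<dots> = (\<Sum>k<N. of_real (trunc_coeff a N (int k)) * g (t - int k))"
    by (subst sum.reindex) (auto simp: inj_on_def)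
  also have "\<dots> = (\<Sum>k<N. of_real (a k) * g (t - int k))" by (simp add: trunc_coeff_def)
  finally show ?thesis .
qed

text \<open>A filter becomes a multiplier on the Fourier side; the conjugate appears because
  \<open>toep\<close> is the transposed filter.\<close>

lemma toep_transform:
  "(\<Sum>s\<in>window n N. toep a n N y s * cis (- (real_of_int s * u))) = trig n y u * cnj (trunc_transfer a N u)"
proof -
  have "(\<Sum>s\<in>window n N. toep a n N y s * cis (- (real_of_int s * u)))
    = (\<Sum>t\<in>{1..int n}. \<Sum>s\<in>window n N. y t * (of_real (trunc_coeff a N (t - s)) * cis (- (real_of_int s * u))))"
    unfolding toep_def sum_distrib_right by (subst sum.swap) (simp add: mult_ac)
  also have "\<dots> = (\<Sum>t\<in>{1..int n}. y t * (\<Sum>k<N. of_real (a k) * cis (- (real_of_int (t - int k) * u))))"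
    unfolding sum_distrib_left[symmetric]
    by (intro sum.cong refl arg_cong2[where f="(*)"] sum_trunc_coeff)
  also have "\<dots> = (\<Sum>t\<in>{1..int n}. y t * cis (- (real_of_int t * u)) * (\<Sum>k<N. of_real (a k) * cis (real k * u)))"
  proof -
    have c: "cis (- (real_of_int (t - int k) * u)) = cis (- (real_of_int t * u)) * cis (real k * u)" for t k
      unfolding cis_mult by (simp add: algebra_simps)
    show ?thesis unfolding c by (intro sum.cong refl) (simp add: sum_distrib_left mult_ac)
  qed
  also have "\<dots> = trig n y u * cnj (trunc_transfer a N u)"
    unfolding trig_def trunc_transfer_def sum_distrib_right[symmetric] by (simp add: cis_cnj mult.commute)
  finally show ?thesis .
qed

text \<open>Deviation of the filter from multiplication by a constant. With \<open>\<kappa>\<close>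
  the value of the transfer function at the frequency of \<open>y\<close>, it is small when the
  transform of \<open>y\<close> is concentrated there.\<close>

definition toep_diff :: "(nat \<Rightarrow> real) \<Rightarrow> nat \<Rightarrow> nat \<Rightarrow> (int \<Rightarrow> complex) \<Rightarrow> complex \<Rightarrow> int \<Rightarrow> complex" where
  "toep_diff a n N y \<kappa> s = toep a n N y s - cnj \<kappa> * (if s \<in> {1..int n} then y s else 0)"

lemma toep_diff_norm:
  "((\<lambda>u. (cmod (trig n y u))\<^sup>2 * (cmod (trunc_transfer a N u - \<kappa>))\<^sup>2) has_integral
      2 * pi * (\<Sum>s\<in>window n N. (cmod (toep_diff a n N y \<kappa> s))\<^sup>2)) {-pi..pi}"
proof -
  have e: "(\<Sum>s\<in>window n N. toep_diff a n N y \<kappa> s * cis (- (real_of_int s * u))) = trig n y u * cnj (trunc_transfer a N u - \<kappa>)" for u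
  proof -
    have "(\<Sum>s\<in>window n N. (if s \<in> {1..int n} then y s else 0) * cis (- (real_of_int s * u))) = trig n y u"
      unfolding trig_def using window_superset[of n N]
      by (intro sum.mono_neutral_cong_right) auto
    then have "(\<Sum>s\<in>window n N. cnj \<kappa> * (if s \<in> {1..int n} then y s else 0) * cis (- (real_of_int s * u))) = cnj \<kappa> * trig n y u"
      unfolding mult.assoc sum_distrib_left[symmetric] by simp
    then show ?thesis
      unfolding toep_diff_def left_diff_distrib sum_subtractf toep_transform by (simp add: algebra_simps)
  qed
  show ?thesis using parseval_finite[of "window n N" "toep_diff a n N y \<kappa>"]
    unfolding e by (simp add: norm_mult power_mult_distrib del: complex_cnj_diff)
qed

lemma trig_norm: "((\<lambda>u. (cmod (trig n y u))\<^sup>2) has_integral 2 * pi * (\<Sum>t\<in>{1..int n}. (cmod (y t))\<^sup>2)) {-pi..pi}"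
  unfolding trig_def by (rule parseval_finite) simp

lemma trig_square_le: "(cmod (trig n y u))\<^sup>2 \<le> n * (\<Sum>t\<in>{1..int n}. (cmod (y t))\<^sup>2)"
proof -
  have "cmod (trig n y u) \<le> (\<Sum>t\<in>{1..int n}. cmod (y t))"
    unfolding trig_def by (rule order_trans[OF norm_sum]) (simp add: norm_mult)
  then have "(cmod (trig n y u))\<^sup>2 \<le> (\<Sum>t\<in>{1..int n}. cmod (y t))\<^sup>2" by (intro power_mono) auto
  also have "\<dots> \<le> (\<Sum>t\<in>{1..int n}. (cmod (y t))\<^sup>2) * card {1..int n}" by (rule sum_squared_le_sum_of_squares)
  finally show ?thesis by (simp add: mult.commute)
qed

lemma continuous_on_trig [continuous_intros]: "continuous_on S (trig n y)"
  unfolding trig_def by (intro continuous_intros)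

lemma continuous_on_trunc_transfer [continuous_intros]: "continuous_on S (trunc_transfer a N)"
  unfolding trunc_transfer_def by (intro continuous_intros)

definition transfer_err :: "(nat \<Rightarrow> real) \<Rightarrow> (real \<Rightarrow> complex) \<Rightarrow> nat \<Rightarrow> real" where
  "transfer_err a A N = integral {-pi..pi} (\<lambda>u. (cmod (A u - trunc_transfer a N u))\<^sup>2)"

lemma transfer_err_nonneg: "0 \<le> transfer_err a A N"
  unfolding transfer_err_def
  by (cases "(\<lambda>u. (cmod (A u - trunc_transfer a N u))\<^sup>2) integrable_on {-pi..pi}")
    (auto intro: Henstock_Kurzweil_Integration.integral_nonneg simp: not_integrable_integral)

text \<open>Exchanging the truncated transfer function for \<open>A\<close> makes the main term free
  of \<open>N\<close>. The trivial bound of the transform of \<open>y\<close> by \<open>n\<close>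
  times its squared length is affordable in the error term, because \<open>N\<close> tends to
  infinity before \<open>n\<close> does.\<close>

lemma toep_diff_norm_le:
  assumes cA: "continuous_on {-pi..pi} A"
  shows "2 * pi * (\<Sum>s\<in>window n N. (cmod (toep_diff a n N y \<kappa> s))\<^sup>2)
    \<le> 2 * integral {-pi..pi} (\<lambda>u. (cmod (trig n y u))\<^sup>2 * (cmod (A u - \<kappa>))\<^sup>2)
      + 2 * (n * (\<Sum>t\<in>{1..int n}. (cmod (y t))\<^sup>2)) * transfer_err a A N"
proof -
  let ?Y = "\<Sum>t\<in>{1..int n}. (cmod (y t))\<^sup>2"
  let ?f = "\<lambda>u. (cmod (trig n y u))\<^sup>2 * (cmod (A u - \<kappa>))\<^sup>2" and ?g = "\<lambda>u. (cmod (A u - trunc_transfer a N u))\<^sup>2"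
  have i: "?f integrable_on {-pi..pi}" "?g integrable_on {-pi..pi}"
    by (intro integrable_continuous_interval continuous_intros cA)+
  have "2 * pi * (\<Sum>s\<in>window n N. (cmod (toep_diff a n N y \<kappa> s))\<^sup>2) \<le> 2 * integral {-pi..pi} ?f + 2 * (n * ?Y) * integral {-pi..pi} ?g"
  proof (rule has_integral_le[OF toep_diff_norm])
    show "((\<lambda>u. 2 * ?f u + 2 * (n * ?Y) * ?g u) has_integral 2 * integral {-pi..pi} ?f + 2 * (n * ?Y) * integral {-pi..pi} ?g) {-pi..pi}"
      using i by (intro has_integral_add has_integral_mult_right) auto
    fix u
    let ?T = "(cmod (trig n y u))\<^sup>2"
    have "cmod (trunc_transfer a N u - \<kappa>) \<le> cmod (A u - \<kappa>) + cmod (A u - trunc_transfer a N u)"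
      using norm_triangle_ineq4[of "A u - \<kappa>" "A u - trunc_transfer a N u"] by simp
    then have "(cmod (trunc_transfer a N u - \<kappa>))\<^sup>2 \<le> (cmod (A u - \<kappa>) + cmod (A u - trunc_transfer a N u))\<^sup>2"
      by (intro power_mono) auto
    also have "\<dots> \<le> 2 * (cmod (A u - \<kappa>))\<^sup>2 + 2 * ?g u"
      using sum_squares_bound[of "cmod (A u - \<kappa>)" "cmod (A u - trunc_transfer a N u)"] by (simp add: power2_sum)
    finally have "?T * (cmod (trunc_transfer a N u - \<kappa>))\<^sup>2 \<le> ?T * (2 * (cmod (A u - \<kappa>))\<^sup>2 + 2 * ?g u)"
      by (rule mult_left_mono) auto
    also have "\<dots> = 2 * ?f u + 2 * ?T * ?g u" by (simp add: algebra_simps)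
    also have "\<dots> \<le> 2 * ?f u + 2 * (n * ?Y) * ?g u"
      using trig_square_le[of n y u] by (intro add_left_mono mult_right_mono mult_left_mono) auto
    finally show "?T * (cmod (trunc_transfer a N u - \<kappa>))\<^sup>2 \<le> 2 * ?f u + 2 * (n * ?Y) * ?g u" .
  qed
  then show ?thesis unfolding transfer_err_def .
qed

text \<open>The case \<open>\<kappa> = 0\<close>: up to the truncation error, the operator norm of
  the filter is controlled by the supremum of \<open>A\<close>.\<close>

lemma toep_norm_le:
  assumes cA: "continuous_on {-pi..pi} A" and L: "\<And>u. u \<in> {-pi..pi} \<Longrightarrow> cmod (A u) \<le> L"
  shows "(\<Sum>s\<in>window n N. (cmod (toep a n N y s))\<^sup>2) \<le> (2 * L\<^sup>2 + n * transfer_err a A N / pi) * (\<Sum>t\<in>{1..int n}. (cmod (y t))\<^sup>2)"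
proof -
  let ?Y = "\<Sum>t\<in>{1..int n}. (cmod (y t))\<^sup>2"
  have "integral {-pi..pi} (\<lambda>u. (cmod (trig n y u))\<^sup>2 * (cmod (A u - 0))\<^sup>2) \<le> L\<^sup>2 * (2 * pi * ?Y)"
  proof (rule integral_le[THEN order_trans])
    show "(\<lambda>u. (cmod (trig n y u))\<^sup>2 * (cmod (A u - 0))\<^sup>2) integrable_on {-pi..pi}"
      by (intro integrable_continuous_interval continuous_intros cA)
    show "(\<lambda>u. L\<^sup>2 * (cmod (trig n y u))\<^sup>2) integrable_on {-pi..pi}"
      by (intro integrable_continuous_interval continuous_intros cA)
    show "integral {-pi..pi} (\<lambda>u. L\<^sup>2 * (cmod (trig n y u))\<^sup>2) \<le> L\<^sup>2 * (2 * pi * ?Y)"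
      using integral_unique[OF trig_norm[of n y]] by simp
    fix u assume "u \<in> {-pi..pi}"
    then have "(cmod (A u))\<^sup>2 \<le> L\<^sup>2" by (intro power_mono L) auto
    then show "(cmod (trig n y u))\<^sup>2 * (cmod (A u - 0))\<^sup>2 \<le> L\<^sup>2 * (cmod (trig n y u))\<^sup>2"
      by (subst mult.commute) (rule mult_right_mono, auto)
  qed
  then have "2 * pi * (\<Sum>s\<in>window n N. (cmod (toep a n N y s))\<^sup>2) \<le> 2 * (L\<^sup>2 * (2 * pi * ?Y)) + 2 * (n * ?Y) * transfer_err a A N"
    using toep_diff_norm_le[OF cA, where n=n and N=N and a=a and y=y and \<kappa>=0] by (simp add: toep_diff_def)
  then show ?thesis by (simp add: field_simps)
qed

text \<open>Scaled to unit length; the squared modulus of the resulting transform of the data is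
  \<open>2 \<pi>\<close> times the periodogram.\<close>

definition dft_vec :: "nat \<Rightarrow> nat \<Rightarrow> int \<Rightarrow> complex" where
  "dft_vec n j t = cis (real_of_int t * freq n j) / sqrt n"

lemma dft_vec_orthonormal:
  assumes "j \<in> {1..nu n}" "k \<in> {1..nu n}"
  shows "(\<Sum>t\<in>{1..int n}. dft_vec n j t * cnj (dft_vec n k t)) = (if j = k then 1 else 0)"
proof -
  have n: "0 < n" using assms nu_double_less[of j n] by simp
  have "(\<Sum>t\<in>{1..int n}. dft_vec n j t * cnj (dft_vec n k t))
    = (\<Sum>t\<in>{1..int n}. cis (real_of_int t * freq n j) * cnj (cis (real_of_int t * freq n k))) / n"
    unfolding dft_vec_def by (simp add: sum_divide_distrib flip: of_real_mult)
  then show ?thesis using sum_cis_orthogonal[of j n k] assms n by auto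
qed

lemma dft_vec_norm: "j \<in> {1..nu n} \<Longrightarrow> (\<Sum>t\<in>{1..int n}. (cmod (dft_vec n j t))\<^sup>2) = 1"
  using nu_double_less[of j n] by (simp add: dft_vec_def norm_divide power_divide)

text \<open>Orthonormality makes the passage from coefficients to time vectors an isometry; this is
  the operator norm of the Fourier factor.\<close>

lemma dft_vec_combination_norm:
  "(\<Sum>t\<in>{1..int n}. (cmod (\<Sum>j=1..nu n. x j * dft_vec n j t))\<^sup>2) = (\<Sum>j=1..nu n. (cmod (x j))\<^sup>2)"
proof -
  let ?J = "{1..nu n}"
  have "complex_of_real (\<Sum>t\<in>{1..int n}. (cmod (\<Sum>j\<in>?J. x j * dft_vec n j t))\<^sup>2)
    = (\<Sum>t\<in>{1..int n}. \<Sum>j\<in>?J. \<Sum>k\<in>?J. (x j * cnj (x k)) * (dft_vec n j t * cnj (dft_vec n k t)))"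
    unfolding of_real_sum cmod_sum_square by (simp add: mult_ac)
  also have "\<dots> = (\<Sum>j\<in>?J. \<Sum>t\<in>{1..int n}. \<Sum>k\<in>?J. (x j * cnj (x k)) * (dft_vec n j t * cnj (dft_vec n k t)))"
    by (rule sum.swap)
  also have "\<dots> = (\<Sum>j\<in>?J. \<Sum>k\<in>?J. \<Sum>t\<in>{1..int n}. (x j * cnj (x k)) * (dft_vec n j t * cnj (dft_vec n k t)))"
    by (intro sum.cong refl sum.swap)
  also have "\<dots> = (\<Sum>j\<in>?J. \<Sum>k\<in>?J. if j = k then x j * cnj (x k) else 0)"
    unfolding sum_distrib_left[symmetric] by (intro sum.cong refl) (simp add: dft_vec_orthonormal)
  also have "\<dots> = complex_of_real (\<Sum>j\<in>?J. (cmod (x j))\<^sup>2)"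
    by (simp add: sum.delta complex_norm_square[symmetric] del: of_real_power)
  finally show ?thesis by (simp only: of_real_eq_iff)
qed

text \<open>Entry \<open>(s, s')\<close> of the symmetric matrix of \<open>Q - S\<close> for the truncated process,
  where \<open>S\<close> is the quadratic form with weights \<open>b j * f j\<close> in the periodogram of the innovations.\<close>

definition diff_ker :: "(nat \<Rightarrow> real) \<Rightarrow> (real \<Rightarrow> complex) \<Rightarrow> nat \<Rightarrow> (nat \<Rightarrow> real) \<Rightarrow> nat \<Rightarrow> int \<Rightarrow> int \<Rightarrow> real" where
  "diff_ker a A n b N s s' = (\<Sum>j=1..nu n. b j / (2 * pi) *
     (Re (toep a n N (dft_vec n j) s * cnj (toep a n N (dft_vec n j) s'))
      - (cmod (A (freq n j)))\<^sup>2 * (if s \<in> {1..int n} \<and> s' \<in> {1..int n} then Re (dft_vec n j s * cnj (dft_vec n j s')) else 0)))"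

text \<open>Fejer mean of the squared oscillation of \<open>A\<close> around its value at the
  \<open>j\<close>-th frequency.\<close>

definition local_err :: "(real \<Rightarrow> complex) \<Rightarrow> nat \<Rightarrow> nat \<Rightarrow> real" where
  "local_err A n j = integral {-pi..pi} (\<lambda>u. (cmod (trig n (dft_vec n j) u))\<^sup>2 * (cmod (A u - A (freq n j)))\<^sup>2) / (2 * pi)"

lemma freq_in: "j \<in> {1..nu n} \<Longrightarrow> freq n j \<in> {0<..<pi}"
  using nu_double_less[of j n] unfolding freq_def by (auto simp: field_simps)

text \<open>With \<open>W = D + \<kappa> U\<close> one has \<open>W W\<^sup>* - |\<kappa>|\<^sup>2 U U\<^sup>* = D W\<^sup>* + \<kappa> U D\<^sup>*\<close>; in both products one
  factor has bounded operator norm and the other a small Frobenius norm.\<close>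

lemma diff_ker_frobenius:
  assumes cA: "continuous_on {-pi..pi} A" and L: "\<And>u. u \<in> {-pi..pi} \<Longrightarrow> cmod (A u) \<le> L"
  shows "(\<Sum>s\<in>window n N. \<Sum>s'\<in>window n N. (diff_ker a A n b N s s')\<^sup>2)
    \<le> (3 * L\<^sup>2 + n * transfer_err a A N / pi) * (\<Sum>j=1..nu n. (b j)\<^sup>2 * (2 * local_err A n j + n * transfer_err a A N / pi))"
proof -
  let ?I = "window n N" and ?J = "{1..nu n}"
  define \<rho> where "\<rho> = n * transfer_err a A N / pi"
  have r0: "0 \<le> \<rho>" unfolding \<rho>_def using transfer_err_nonneg by simp
  \<comment> \<open>Columns of the three matrices: \<open>W\<close> holds the filtered Fourier
    vectors, \<open>U\<close> the Fourier vectors padded by zeros to the window, \<open>D\<close>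
    their deviation.\<close>
  define W where "W j = toep a n N (dft_vec n j)" for j
  define U where "U j s = (if s \<in> {1..int n} then dft_vec n j s else 0)" for j s
  define D where "D j = toep_diff a n N (dft_vec n j) (A (freq n j))" for j
  define \<kappa> where "\<kappa> j = cnj (A (freq n j))" for j
  have WDU: "W j s = D j s + \<kappa> j * U j s" for j s unfolding W_def D_def \<kappa>_def U_def toep_diff_def by simp
  have kL: "(cmod (\<kappa> j))\<^sup>2 \<le> L\<^sup>2" if "j \<in> ?J" for j
    using L[of "freq n j"] freq_in[OF that] by (intro power_mono) (auto simp: \<kappa>_def)
  have Dn: "(\<Sum>s\<in>?I. (cmod (D j s))\<^sup>2) \<le> 2 * local_err A n j + \<rho>" if "j \<in> ?J" for j
    using toep_diff_norm_le[OF cA, where n=n and N=N and a=a and y="dft_vec n j" and \<kappa>="A (freq n j)"]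
    unfolding dft_vec_norm[OF that] local_err_def \<rho>_def D_def by (simp add: field_simps)
  \<comment> \<open>Combinations of columns of \<open>W\<close> are filtered combinations of
    orthonormal vectors, so \<open>W\<close> inherits the operator norm bound of the filter.\<close>
  have opW: "(\<Sum>s\<in>?I. (cmod (\<Sum>j\<in>?J. x j * W j s))\<^sup>2) \<le> (2 * L\<^sup>2 + \<rho>) * (\<Sum>j\<in>?J. (cmod (x j))\<^sup>2)" for x
  proof -
    have "(\<Sum>j\<in>?J. x j * W j s) = toep a n N (\<lambda>t. \<Sum>j\<in>?J. x j * dft_vec n j t) s" for s
      unfolding W_def toep_def sum_distrib_left sum_distrib_right mult.assoc by (rule sum.swap)
    then show ?thesis using toep_norm_le[OF cA L, where n=n and N=N and a=a and y="\<lambda>t. \<Sum>j\<in>?J. x j * dft_vec n j t"]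
      unfolding dft_vec_combination_norm \<rho>_def by simp
  qed
  have opU: "(\<Sum>s\<in>?I. (cmod (\<Sum>j\<in>?J. x j * U j s))\<^sup>2) = (\<Sum>j\<in>?J. (cmod (x j))\<^sup>2)" for x
  proof -
    have "(\<Sum>s\<in>?I. (cmod (\<Sum>j\<in>?J. x j * U j s))\<^sup>2) = (\<Sum>s\<in>{1..int n}. (cmod (\<Sum>j\<in>?J. x j * dft_vec n j s))\<^sup>2)"
      using window_superset[of n N] by (intro sum.mono_neutral_cong_right) (auto simp: U_def)
    then show ?thesis unfolding dft_vec_combination_norm .
  qed
  define P1 where "P1 s s' = (\<Sum>j\<in>?J. b j * D j s * cnj (W j s'))" for s s'
  define P2 where "P2 s s' = (\<Sum>j\<in>?J. b j * \<kappa> j * U j s * cnj (D j s'))" for s s'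
  have "diff_ker a A n b N s s' = Re (P1 s s' + P2 s s') / (2 * pi)" for s s'
  proof -
    have "Re (W j s * cnj (W j s')) - (cmod (A (freq n j)))\<^sup>2 * (if s \<in> {1..int n} \<and> s' \<in> {1..int n} then Re (dft_vec n j s * cnj (dft_vec n j s')) else 0)
      = Re (D j s * cnj (W j s') + \<kappa> j * U j s * cnj (D j s'))" for j
    proof -
      have u: "(if s \<in> {1..int n} \<and> s' \<in> {1..int n} then Re (dft_vec n j s * cnj (dft_vec n j s')) else 0) = Re (U j s * cnj (U j s'))"
        unfolding U_def by auto
      have rc: "c * Re X = Re (complex_of_real c * X)" for c X by simp
      have "complex_of_real ((cmod (A (freq n j)))\<^sup>2) = \<kappa> j * cnj (\<kappa> j)" unfolding \<kappa>_def complex_norm_square by (simp add: mult.commute)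
      then have "(cmod (A (freq n j)))\<^sup>2 * Re (U j s * cnj (U j s')) = Re (\<kappa> j * cnj (\<kappa> j) * (U j s * cnj (U j s')))"
        using rc[of "(cmod (A (freq n j)))\<^sup>2" "U j s * cnj (U j s')"] by (simp only:)
      moreover have "W j s * cnj (W j s') - \<kappa> j * cnj (\<kappa> j) * (U j s * cnj (U j s')) = D j s * cnj (W j s') + \<kappa> j * U j s * cnj (D j s')"
        unfolding WDU by (simp add: algebra_simps)
      ultimately show ?thesis unfolding u by (metis minus_complex.simps(1))
    qed
    then have "diff_ker a A n b N s s' = (\<Sum>j\<in>?J. b j / (2 * pi) * Re (D j s * cnj (W j s') + \<kappa> j * U j s * cnj (D j s')))"
      unfolding diff_ker_def W_def[symmetric] by (simp only:)
    also have "\<dots> = (\<Sum>j\<in>?J. Re (complex_of_real (b j) * (D j s * cnj (W j s') + \<kappa> j * U j s * cnj (D j s'))) / (2 * pi))"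
      by (intro sum.cong refl) simp
    also have "\<dots> = Re (\<Sum>j\<in>?J. complex_of_real (b j) * (D j s * cnj (W j s') + \<kappa> j * U j s * cnj (D j s'))) / (2 * pi)"
      by (simp only: sum_divide_distrib[symmetric] Re_sum)
    also have "(\<Sum>j\<in>?J. complex_of_real (b j) * (D j s * cnj (W j s') + \<kappa> j * U j s * cnj (D j s'))) = P1 s s' + P2 s s'"
      unfolding P1_def P2_def sum.distrib[symmetric] by (intro sum.cong refl) (simp only: distrib_left mult.assoc)
    finally show ?thesis .
  qed
  then have dk: "(diff_ker a A n b N s s')\<^sup>2 \<le> (cmod (P1 s s'))\<^sup>2 + (cmod (P2 s s'))\<^sup>2" for s s'
  proof -
    have "\<bar>Re (P1 s s' + P2 s s')\<bar> \<le> cmod (P1 s s') + cmod (P2 s s')"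
      using abs_Re_le_cmod norm_triangle_ineq order_trans by blast
    then have "\<bar>Re (P1 s s' + P2 s s')\<bar>\<^sup>2 \<le> (cmod (P1 s s') + cmod (P2 s s'))\<^sup>2" by (intro power_mono) auto
    also have "\<dots> \<le> 2 * ((cmod (P1 s s'))\<^sup>2 + (cmod (P2 s s'))\<^sup>2)"
      using sum_squares_bound[of "cmod (P1 s s')" "cmod (P2 s s')"] by (simp add: power2_sum)
    \<comment> \<open>The factor 2 from squaring a sum is absorbed by the \<open>2 \<pi>\<close> in
      the definition of the periodogram.\<close>
    also have "\<dots> \<le> (2 * pi)\<^sup>2 * ((cmod (P1 s s'))\<^sup>2 + (cmod (P2 s s'))\<^sup>2)"
    proof (rule mult_right_mono)
      have "2 * 1 \<le> (2 * pi) * (2 * pi)" using pi_gt3 by (intro mult_mono) auto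
      then show "2 \<le> (2 * pi)\<^sup>2" by (simp add: power2_eq_square)
    qed simp
    finally show ?thesis unfolding \<open>\<And>s s'. diff_ker a A n b N s s' = _\<close>
      by (simp add: power_divide field_simps)
  qed
  have SP1: "(\<Sum>s\<in>?I. \<Sum>s'\<in>?I. (cmod (P1 s s'))\<^sup>2) \<le> (2 * L\<^sup>2 + \<rho>) * (\<Sum>j\<in>?J. (b j)\<^sup>2 * (2 * local_err A n j + \<rho>))"
  proof -
    \<comment> \<open>For fixed \<open>s\<close> the row of \<open>P1\<close> is, up to conjugation,
      a combination of columns of \<open>W\<close> with coefficients \<open>b j * D j s\<close>: the
      operator norm is spent on \<open>W\<close>, the Frobenius norm on \<open>D\<close>.\<close>
    have "(\<Sum>s'\<in>?I. (cmod (P1 s s'))\<^sup>2) \<le> (2 * L\<^sup>2 + \<rho>) * (\<Sum>j\<in>?J. (b j)\<^sup>2 * (cmod (D j s))\<^sup>2)" for s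
    proof -
      have "cmod (P1 s s') = cmod (\<Sum>j\<in>?J. cnj (b j * D j s) * W j s')" for s'
        unfolding P1_def by (subst complex_mod_cnj[symmetric]) (simp add: mult_ac)
      then show ?thesis using opW[of "\<lambda>j. cnj (b j * D j s)"] by (simp add: norm_mult power_mult_distrib)
    qed
    then have "(\<Sum>s\<in>?I. \<Sum>s'\<in>?I. (cmod (P1 s s'))\<^sup>2) \<le> (\<Sum>s\<in>?I. (2 * L\<^sup>2 + \<rho>) * (\<Sum>j\<in>?J. (b j)\<^sup>2 * (cmod (D j s))\<^sup>2))"
      by (rule sum_mono)
    also have "\<dots> = (2 * L\<^sup>2 + \<rho>) * (\<Sum>j\<in>?J. (b j)\<^sup>2 * (\<Sum>s\<in>?I. (cmod (D j s))\<^sup>2))"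
      unfolding sum_distrib_left[symmetric] by (subst sum.swap) (simp add: sum_distrib_left)
    also have "\<dots> \<le> (2 * L\<^sup>2 + \<rho>) * (\<Sum>j\<in>?J. (b j)\<^sup>2 * (2 * local_err A n j + \<rho>))"
      using Dn r0 by (intro mult_left_mono sum_mono) auto
    finally show ?thesis .
  qed
  have SP2: "(\<Sum>s\<in>?I. \<Sum>s'\<in>?I. (cmod (P2 s s'))\<^sup>2) \<le> L\<^sup>2 * (\<Sum>j\<in>?J. (b j)\<^sup>2 * (2 * local_err A n j + \<rho>))"
  proof -
    have "(\<Sum>s\<in>?I. (cmod (P2 s s'))\<^sup>2) \<le> L\<^sup>2 * (\<Sum>j\<in>?J. (b j)\<^sup>2 * (cmod (D j s'))\<^sup>2)" for s'
    proof -
      have "P2 s s' = (\<Sum>j\<in>?J. (b j * \<kappa> j * cnj (D j s')) * U j s)" for s unfolding P2_def by (simp add: mult_ac)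
      then have "(\<Sum>s\<in>?I. (cmod (P2 s s'))\<^sup>2) = (\<Sum>j\<in>?J. (cmod (\<kappa> j))\<^sup>2 * ((b j)\<^sup>2 * (cmod (D j s'))\<^sup>2))"
        using opU[of "\<lambda>j. b j * \<kappa> j * cnj (D j s')"] by (simp add: norm_mult power_mult_distrib mult_ac)
      also have "\<dots> \<le> (\<Sum>j\<in>?J. L\<^sup>2 * ((b j)\<^sup>2 * (cmod (D j s'))\<^sup>2))"
        using kL by (intro sum_mono mult_right_mono) auto
      finally show ?thesis by (simp add: sum_distrib_left)
    qed
    then have "(\<Sum>s'\<in>?I. \<Sum>s\<in>?I. (cmod (P2 s s'))\<^sup>2) \<le> (\<Sum>s'\<in>?I. L\<^sup>2 * (\<Sum>j\<in>?J. (b j)\<^sup>2 * (cmod (D j s'))\<^sup>2))"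
      by (rule sum_mono)
    also have "\<dots> = L\<^sup>2 * (\<Sum>j\<in>?J. (b j)\<^sup>2 * (\<Sum>s\<in>?I. (cmod (D j s))\<^sup>2))"
      unfolding sum_distrib_left[symmetric] by (subst sum.swap) (simp add: sum_distrib_left)
    also have "\<dots> \<le> L\<^sup>2 * (\<Sum>j\<in>?J. (b j)\<^sup>2 * (2 * local_err A n j + \<rho>))"
      using Dn by (intro mult_left_mono sum_mono) auto
    finally show ?thesis by (subst sum.swap)
  qed
  have "(\<Sum>s\<in>?I. \<Sum>s'\<in>?I. (diff_ker a A n b N s s')\<^sup>2) \<le> (\<Sum>s\<in>?I. \<Sum>s'\<in>?I. (cmod (P1 s s'))\<^sup>2 + (cmod (P2 s s'))\<^sup>2)"
    using dk by (intro sum_mono)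
  \<comment> \<open>\<open>2 L\<^sup>2 + \<rho>\<close> comes from \<open>W\<close>, the third
    \<open>L\<^sup>2\<close> from \<open>\<kappa> U\<close>.\<close>
  also have "\<dots> \<le> (3 * L\<^sup>2 + \<rho>) * (\<Sum>j\<in>?J. (b j)\<^sup>2 * (2 * local_err A n j + \<rho>))"
    using SP1 SP2 unfolding sum.distrib by (simp add: algebra_simps)
  finally show ?thesis unfolding \<rho>_def .
qed

subsection \<open>Fejer means\<close>

text \<open>Jordan's inequality: by concavity the sine lies above its chord from 0 to
  \<open>\<pi> / 2\<close>.\<close>

lemma abs_sin_half_ge:
  fixes x :: real
  assumes "\<bar>x\<bar> \<le> pi"
  shows "\<bar>x\<bar> / pi \<le> \<bar>sin (x / 2)\<bar>"
proof -
  have conc: "concave_on {0..pi} sin"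
    by (rule f''_le0_imp_concave[where f'=cos and f''="\<lambda>x. - sin x"])
      (auto intro!: derivative_eq_intros sin_ge_zero)
  have "(1 - \<bar>x\<bar> / pi) * sin 0 + \<bar>x\<bar> / pi * sin (pi / 2) \<le> sin ((1 - \<bar>x\<bar> / pi) *\<^sub>R 0 + (\<bar>x\<bar> / pi) *\<^sub>R (pi / 2))"
    using assms by (intro concave_onD[OF conc]) auto
  then have "\<bar>x\<bar> / pi \<le> sin (\<bar>x\<bar> / 2)" by simp
  also have "\<dots> \<le> \<bar>sin (x / 2)\<bar>" by (cases "0 \<le> x") (auto simp: abs_if)
  finally show ?thesis .
qed

text \<open>Distance on the circle for \<open>u\<close> in \<open>[-\<pi>, \<pi>]\<close> and
  \<open>v\<close> in \<open>(0, \<pi>)\<close>. Only one wrap is possible, from \<open>u\<close>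
  near \<open>-\<pi>\<close> to \<open>v\<close> near \<open>\<pi>\<close>, hence a minimum of two
  terms rather than three.\<close>

definition circ_dist :: "real \<Rightarrow> real \<Rightarrow> real" where
  "circ_dist u v = min \<bar>u - v\<bar> (u + 2 * pi - v)"

lemma circ_dist_le_sin:
  assumes u: "u \<in> {-pi..pi}" and v: "v \<in> {0<..<pi}"
  shows "circ_dist u v \<le> pi * \<bar>sin ((u - v) / 2)\<bar>"
proof (cases "- pi \<le> u - v")
  case True
  then have "\<bar>u - v\<bar> / pi \<le> \<bar>sin ((u - v) / 2)\<bar>" using u v by (intro abs_sin_half_ge) auto
  then have "\<bar>u - v\<bar> \<le> pi * \<bar>sin ((u - v) / 2)\<bar>" by (simp add: field_simps)
  then show ?thesis unfolding circ_dist_def by simp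
next
  case False
  then have "\<bar>u + 2 * pi - v\<bar> / pi \<le> \<bar>sin ((u + 2 * pi - v) / 2)\<bar>" using u v by (intro abs_sin_half_ge) auto
  also have "sin ((u + 2 * pi - v) / 2) = - sin ((u - v) / 2)"
    using sin_periodic_pi[of "(u - v) / 2"] by (simp add: add_divide_distrib diff_divide_distrib algebra_simps)
  finally have "u + 2 * pi - v \<le> pi * \<bar>sin ((u - v) / 2)\<bar>" by (simp add: field_simps)
  then show ?thesis unfolding circ_dist_def by simp
qed

lemma cmod_1_minus_cis: "(cmod (1 - cis x))\<^sup>2 = 4 * (sin (x / 2))\<^sup>2"
proof -
  have "(cmod (1 - cis x))\<^sup>2 = (1 - cos x)\<^sup>2 + (sin x)\<^sup>2" by (simp add: cmod_power2)
  also have "\<dots> = 2 - 2 * cos x" using sin_cos_squared_add[of x] by (simp add: power2_eq_square algebra_simps)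
  also have "cos x = 1 - 2 * (sin (x / 2))\<^sup>2" using cos_double_sin[of "x / 2"] by simp
  finally show ?thesis by simp
qed

text \<open>Multiplication by \<open>1 - cis x\<close> telescopes the geometric sum. As nothing is
  divided, multiples of \<open>2 \<pi>\<close> need no separate treatment.\<close>

lemma cmod_sum_cis_sin_le: "(cmod (\<Sum>t\<in>{1..int n}. cis (real_of_int t * x)))\<^sup>2 * (sin (x / 2))\<^sup>2 \<le> 1"
proof -
  let ?S = "\<Sum>t\<in>{1..int n}. cis (real_of_int t * x)"
  have "(1 - cis x) * ?S = cis x - cis (real (n + 1) * x)"
    unfolding sum_int_Icc
  proof (induction n)
    case (Suc n)
    have "(1 - cis x) * (\<Sum>t=1..Suc n. cis (real_of_int (int t) * x)) = (cis x - cis (real (n + 1) * x)) + (1 - cis x) * cis (real (Suc n) * x)"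
      using Suc by (simp add: distrib_left)
    also have "\<dots> = cis x - cis (real (Suc n + 1) * x)" by (simp add: left_diff_distrib cis_mult algebra_simps)
    finally show ?case .
  qed simp
  then have "cmod (1 - cis x) * cmod ?S \<le> 2"
    using norm_triangle_ineq4[of "cis x" "cis (real (n + 1) * x)"] by (simp flip: norm_mult)
  then have "(cmod (1 - cis x) * cmod ?S)\<^sup>2 \<le> 2\<^sup>2" by (intro power_mono) auto
  then show ?thesis by (simp add: power_mult_distrib cmod_1_minus_cis algebra_simps)
qed

text \<open>Fejer kernel centred at the \<open>j\<close>-th frequency, with total mass
  \<open>2 \<pi>\<close>.\<close>

definition fejer :: "nat \<Rightarrow> nat \<Rightarrow> real \<Rightarrow> real" where
  "fejer n j u = (cmod (trig n (dft_vec n j) u))\<^sup>2"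

lemma fejer_nonneg: "0 \<le> fejer n j u" unfolding fejer_def by simp

lemma continuous_on_fejer [continuous_intros]: "continuous_on S (fejer n j)"
  unfolding fejer_def by (intro continuous_intros)

lemma fejer_le_n: "j \<in> {1..nu n} \<Longrightarrow> fejer n j u \<le> n"
  using trig_square_le[of n "dft_vec n j" u] dft_vec_norm[of j n] by (simp add: fejer_def)

lemma fejer_integral: "j \<in> {1..nu n} \<Longrightarrow> (fejer n j has_integral 2 * pi) {-pi..pi}"
  using trig_norm[of n "dft_vec n j"] dft_vec_norm[of j n] by (simp add: fejer_def[abs_def])

lemma fejer_sin_le:
  assumes n: "0 < n"
  shows "fejer n j u * (sin ((u - freq n j) / 2))\<^sup>2 \<le> 1 / real n"
proof -
  have "trig n (dft_vec n j) u = (\<Sum>t\<in>{1..int n}. cis (real_of_int t * (freq n j - u))) / complex_of_real (sqrt (real n))"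
    unfolding trig_def dft_vec_def sum_divide_distrib
    by (intro sum.cong refl) (simp add: cis_mult algebra_simps)
  then have "fejer n j u = (cmod (\<Sum>t\<in>{1..int n}. cis (real_of_int t * (freq n j - u))))\<^sup>2 / real n"
    unfolding fejer_def by (simp add: norm_divide power_divide)
  moreover have "(sin ((u - freq n j) / 2))\<^sup>2 = (sin ((freq n j - u) / 2))\<^sup>2"
    using sin_minus[of "(u - freq n j) / 2"] by (simp add: minus_divide_left del: sin_minus)
  ultimately show ?thesis
    using cmod_sum_cis_sin_le[where n=n and x="freq n j - u"] n by (simp add: divide_right_mono)
qed

lemma fejer_circ_dist_le:
  assumes j: "j \<in> {1..nu n}" and u: "u \<in> {-pi..pi}"
  shows "fejer n j u * (circ_dist u (freq n j))\<^sup>2 \<le> pi\<^sup>2 / n"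
proof -
  have n: "0 < n" using j nu_double_less[of j n] by simp
  note v = freq_in[OF j]
  have "0 \<le> circ_dist u (freq n j)" using u v by (auto simp: circ_dist_def)
  then have "(circ_dist u (freq n j))\<^sup>2 \<le> (pi * \<bar>sin ((u - freq n j) / 2)\<bar>)\<^sup>2"
    by (intro power_mono circ_dist_le_sin u v)
  then have "fejer n j u * (circ_dist u (freq n j))\<^sup>2 \<le> fejer n j u * (pi\<^sup>2 * (sin ((u - freq n j) / 2))\<^sup>2)"
    by (intro mult_left_mono fejer_nonneg) (simp add: power_mult_distrib)
  also have "\<dots> = pi\<^sup>2 * (fejer n j u * (sin ((u - freq n j) / 2))\<^sup>2)" by simp
  also have "\<dots> \<le> pi\<^sup>2 * (1 / n)" by (intro mult_left_mono fejer_sin_le n) auto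
  finally show ?thesis by simp
qed

text \<open>The tail of the Fejer kernel that wraps around the circle. Its integral blows up like
  \<open>1 / (\<pi> - v)\<close>, the source of the boundary term at frequencies close to
  \<open>\<pi>\<close>.\<close>

lemma integral_inverse_square:
  assumes v: "v \<in> {0<..<pi}"
  shows "((\<lambda>u. 1 / (u + 2 * pi - v)\<^sup>2) has_integral (1 / (pi - v) - 1 / (3 * pi - v))) {-pi..pi}"
proof -
  have "((\<lambda>u. 1 / (u + 2 * pi - v)\<^sup>2) has_integral (- 1 / (pi + 2 * pi - v)) - (- 1 / (- pi + 2 * pi - v))) {-pi..pi}"
  proof (rule fundamental_theorem_of_calculus)
    fix u assume u: "u \<in> {-pi..pi}"
    then have "u + 2 * pi - v \<noteq> 0" using v by auto
    then show "((\<lambda>u. - 1 / (u + 2 * pi - v)) has_vector_derivative 1 / (u + 2 * pi - v)\<^sup>2) (at u within {-pi..pi})"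
      unfolding has_real_derivative_iff_has_vector_derivative[symmetric]
      by (auto intro!: derivative_eq_intros simp: power2_eq_square)
  qed simp
  then show ?thesis by simp
qed

text \<open>\<open>A\<close> need not agree at \<open>-\<pi>\<close> and \<open>\<pi>\<close>; the last term is what a jump there costs at frequencies
  close to \<open>\<pi>\<close>.\<close>

lemma local_err_le:
  assumes j: "j \<in> {1..nu n}" and cA: "continuous_on {-pi..pi} A"
    and L: "\<And>u. u \<in> {-pi..pi} \<Longrightarrow> cmod (A u) \<le> L" and \<delta>: "0 < \<delta>"
    and close: "\<And>u v. u \<in> {-pi..pi} \<Longrightarrow> v \<in> {-pi..pi} \<Longrightarrow> \<bar>u - v\<bar> < \<delta> \<Longrightarrow> (cmod (A u - A v))\<^sup>2 \<le> \<epsilon>"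
    and \<epsilon>: "0 \<le> \<epsilon>"
  shows "local_err A n j \<le> \<epsilon> + 4 * L\<^sup>2 * pi\<^sup>2 / \<delta>\<^sup>2 * (1 / n) + 2 * L\<^sup>2 * (1 / (real n - 2 * real j))"
proof -
  let ?v = "freq n j"
  have n: "0 < n" using j nu_double_less[of j n] by simp
  note v = freq_in[OF j]
  have vP: "?v \<in> {-pi..pi}" using v by auto
  \<comment> \<open>\<open>c1\<close> bounds the part at distance at least \<open>\<delta>\<close>
    inside the interval, and \<open>c2\<close> is the coefficient of the part reached around the
    circle, where \<open>A\<close> may jump. Both use that the oscillation is at most
    \<open>2 L\<close>.\<close>
  define c1 where "c1 = 4 * L\<^sup>2 * pi\<^sup>2 / \<delta>\<^sup>2 * (1 / n)"
  define c2 where "c2 = 4 * L\<^sup>2 * pi\<^sup>2 / n"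
  have c0: "0 \<le> c1" "0 \<le> c2" unfolding c1_def c2_def by auto
  have pw: "fejer n j u * (cmod (A u - A ?v))\<^sup>2 \<le> \<epsilon> * fejer n j u + c1 + c2 * (1 / (u + 2 * pi - ?v)\<^sup>2)"
    if u: "u \<in> {-pi..pi}" for u
  proof (cases "\<bar>u - ?v\<bar> < \<delta>")
    case True
    then have "(cmod (A u - A ?v))\<^sup>2 * fejer n j u \<le> \<epsilon> * fejer n j u"
      by (intro mult_right_mono close u vP fejer_nonneg) auto
    moreover have "0 \<le> c2 * (1 / (u + 2 * pi - ?v)\<^sup>2)" using c0 by simp
    ultimately show ?thesis using c0 unfolding mult.commute[of "fejer n j u"] by linarith
  next
    case False
    have "cmod (A u - A ?v) \<le> 2 * L" using norm_triangle_ineq4[of "A u" "A ?v"] L[OF u] L[OF vP] by linarith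
    then have "(cmod (A u - A ?v))\<^sup>2 \<le> (2 * L)\<^sup>2" by (intro power_mono) auto
    then have a: "fejer n j u * (cmod (A u - A ?v))\<^sup>2 \<le> fejer n j u * (4 * L\<^sup>2)"
      by (intro mult_left_mono fejer_nonneg) (simp add: power_mult_distrib)
    have y: "0 < u + 2 * pi - ?v" using u v by auto
    \<comment> \<open>Whichever distance attains the minimum, the inverse square bound for the
      kernel holds with it; adding both bounds keeps the majorant free of case distinctions under
      the integral.\<close>
    have "fejer n j u \<le> pi\<^sup>2 / n / \<delta>\<^sup>2 + pi\<^sup>2 / n / (u + 2 * pi - ?v)\<^sup>2"
    proof (cases "\<bar>u - ?v\<bar> \<le> u + 2 * pi - ?v")
      case True
      then have "\<delta> \<le> circ_dist u ?v" using False by (simp add: circ_dist_def)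
      then have "\<delta>\<^sup>2 \<le> (circ_dist u ?v)\<^sup>2" using \<delta> by (intro power_mono) auto
      then have "fejer n j u * \<delta>\<^sup>2 \<le> pi\<^sup>2 / n"
        using fejer_circ_dist_le[OF j u] mult_left_mono[OF _ fejer_nonneg, of "\<delta>\<^sup>2" _ n j u] order_trans by blast
      then have "fejer n j u \<le> pi\<^sup>2 / n / \<delta>\<^sup>2" using \<delta> by (subst pos_le_divide_eq) auto
      moreover have "0 \<le> pi\<^sup>2 / n / (u + 2 * pi - ?v)\<^sup>2" by simp
      ultimately show ?thesis by linarith
    next
      case False
      then have "circ_dist u ?v = u + 2 * pi - ?v" by (simp add: circ_dist_def)
      then have "fejer n j u \<le> pi\<^sup>2 / n / (u + 2 * pi - ?v)\<^sup>2"
        using fejer_circ_dist_le[OF j u] y by (subst pos_le_divide_eq) auto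
      moreover have "0 \<le> pi\<^sup>2 / n / \<delta>\<^sup>2" by simp
      ultimately show ?thesis by linarith
    qed
    then have "fejer n j u * (4 * L\<^sup>2) \<le> (pi\<^sup>2 / n / \<delta>\<^sup>2 + pi\<^sup>2 / n / (u + 2 * pi - ?v)\<^sup>2) * (4 * L\<^sup>2)"
      by (rule mult_right_mono) simp
    also have "\<dots> = c1 + c2 * (1 / (u + 2 * pi - ?v)\<^sup>2)" unfolding c1_def c2_def by (simp add: field_simps)
    finally show ?thesis using a mult_nonneg_nonneg[OF \<epsilon> fejer_nonneg[of n j u]] by linarith
  qed
  have i: "((\<lambda>u. fejer n j u * (cmod (A u - A ?v))\<^sup>2) has_integral (2 * pi * local_err A n j)) {-pi..pi}"
  proof -
    have "(\<lambda>u. fejer n j u * (cmod (A u - A ?v))\<^sup>2) integrable_on {-pi..pi}"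
      by (intro integrable_continuous_interval continuous_intros cA)
    then show ?thesis unfolding local_err_def fejer_def by (simp add: has_integral_integral)
  qed
  have ib: "((\<lambda>u. \<epsilon> * fejer n j u + c1 + c2 * (1 / (u + 2 * pi - ?v)\<^sup>2)) has_integral
      (\<epsilon> * (2 * pi) + c1 * (2 * pi) + c2 * (1 / (pi - ?v) - 1 / (3 * pi - ?v)))) {-pi..pi}"
    using has_integral_const_real[of c1 "-pi" pi]
    by (intro has_integral_add has_integral_mult_right fejer_integral[OF j] integral_inverse_square[OF v]) (simp add: mult.commute)
  have "2 * pi * local_err A n j \<le> \<epsilon> * (2 * pi) + c1 * (2 * pi) + c2 * (1 / (pi - ?v) - 1 / (3 * pi - ?v))"
    by (rule has_integral_le[OF i ib]) (rule pw)
  also have "\<dots> \<le> \<epsilon> * (2 * pi) + c1 * (2 * pi) + c2 * (1 / (pi - ?v))"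
    using v c0 by (intro add_left_mono mult_left_mono) auto
  \<comment> \<open>\<open>\<pi> - v\<close> equals \<open>\<pi> (n - 2 j) / n\<close>, so the
    factor \<open>1 / n\<close> cancels and the bound does not decay in \<open>n\<close> while
    \<open>n - 2 j\<close> stays bounded.\<close>
  also have "c2 * (1 / (pi - ?v)) = 2 * pi * (2 * L\<^sup>2 * (1 / (real n - 2 * real j)))"
  proof -
    have "pi - ?v = pi * (real n - 2 * real j) / n" unfolding freq_def using n by (simp add: field_simps)
    then have "1 / (pi - ?v) = n / (pi * (real n - 2 * real j))" by simp
    moreover have "real n - 2 * real j \<noteq> 0" using nu_double_less[of j n] j by auto
    ultimately show ?thesis unfolding c2_def using n by (simp add: power2_eq_square)
  qed
  finally have "2 * pi * local_err A n j \<le> 2 * pi * (\<epsilon> + c1 + 2 * L\<^sup>2 * (1 / (real n - 2 * real j)))"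
    by (simp add: algebra_simps)
  then show ?thesis unfolding c1_def by (simp only: mult_le_cancel_left_pos pi_gt_zero mult_pos_pos zero_less_numeral)
qed

lemma sum_inverse_squares_le: "(\<Sum>k=1..n. 1 / (real k)\<^sup>2) \<le> 2"
proof -
  have "(\<Sum>k=1..n. 1 / (real k)\<^sup>2) \<le> 2 - 1 / real n"
  proof (induction n)
    case (Suc n)
    show ?case
    proof (cases "n = 0")
      case False
      then have n: "0 < real n" by simp
      have "1 / (real (Suc n))\<^sup>2 \<le> 1 / (real n * real (Suc n))"
        using n by (intro divide_left_mono) (auto simp: power2_eq_square)
      also have "\<dots> = 1 / real n - 1 / real (Suc n)" using n by (simp add: field_simps)
      finally show ?thesis using Suc by simp
    qed simp
  qed simp
  also have "\<dots> \<le> 2" by simp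
  finally show ?thesis .
qed

text \<open>One factor \<open>|b j|\<close> is bounded by \<open>m\<close>, the other is paired by
  Cauchy-Schwarz with \<open>1 / (n - 2 j)\<close>. As the \<open>n - 2 j\<close> are distinct
  positive integers, the squares of these reciprocals have a sum bounded uniformly in
  \<open>n\<close>.\<close>

lemma sum_weighted_boundary_le:
  assumes m: "\<And>j. j \<in> {1..nu n} \<Longrightarrow> \<bar>b j\<bar> \<le> m" and m0: "0 \<le> m"
  shows "(\<Sum>j=1..nu n. (b j)\<^sup>2 * (1 / (real n - 2 * real j))) \<le> 2 * m * sqrt (\<Sum>j=1..nu n. (b j)\<^sup>2)"
proof -
  let ?g = "\<lambda>j. 1 / (real n - 2 * real j)"
  have lt: "2 * j < n" if "j \<in> {1..nu n}" for j using that nu_double_less[of j n] by auto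
  have g0: "0 \<le> ?g j" if "j \<in> {1..nu n}" for j using lt[OF that] by simp
  have "(\<Sum>j=1..nu n. (b j)\<^sup>2 * ?g j) \<le> (\<Sum>j=1..nu n. m * (\<bar>b j\<bar> * ?g j))"
  proof (rule sum_mono)
    fix j assume j: "j \<in> {1..nu n}"
    have "\<bar>b j\<bar> * \<bar>b j\<bar> * ?g j \<le> m * \<bar>b j\<bar> * ?g j"
      by (intro mult_right_mono m j g0) auto
    then show "(b j)\<^sup>2 * ?g j \<le> m * (\<bar>b j\<bar> * ?g j)" by (simp add: power2_eq_square)
  qed
  also have "\<dots> = m * (\<Sum>j=1..nu n. \<bar>b j\<bar> * ?g j)" by (simp add: sum_distrib_left)
  also have "\<dots> \<le> m * sqrt ((\<Sum>j=1..nu n. (b j)\<^sup>2) * 4)"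
  proof (rule mult_left_mono[OF _ m0])
    have "(\<Sum>j=1..nu n. \<bar>b j\<bar> * ?g j) \<le> sqrt ((\<Sum>j=1..nu n. \<bar>b j\<bar>\<^sup>2) * (\<Sum>j=1..nu n. (?g j)\<^sup>2))"
      by (intro real_le_rsqrt Cauchy_Schwarz_ineq_sum)
    also have "\<dots> \<le> sqrt ((\<Sum>j=1..nu n. (b j)\<^sup>2) * 4)"
    proof -
      have "(\<Sum>j=1..nu n. (?g j)\<^sup>2) = (\<Sum>j=1..nu n. 1 / (real (n - 2 * j))\<^sup>2)"
        using lt by (intro sum.cong refl) (auto simp: power_divide of_nat_diff less_imp_le)
      also have "\<dots> = (\<Sum>k\<in>(\<lambda>j. n - 2 * j) ` {1..nu n}. 1 / (real k)\<^sup>2)"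
      proof (subst sum.reindex)
        show "inj_on (\<lambda>j. n - 2 * j) {1..nu n}"
        proof (rule inj_onI)
          fix x y assume "x \<in> {1..nu n}" "y \<in> {1..nu n}" "n - 2 * x = n - 2 * y"
          then show "x = y" using lt[of x] lt[of y] by linarith
        qed
      qed simp
      also have "\<dots> \<le> (\<Sum>k=1..n. 1 / (real k)\<^sup>2)"
      proof (rule sum_mono2)
        show "(\<lambda>j. n - 2 * j) ` {1..nu n} \<subseteq> {1..n}"
        proof
          fix k assume "k \<in> (\<lambda>j. n - 2 * j) ` {1..nu n}"
          then obtain j where "j \<in> {1..nu n}" "k = n - 2 * j" by blast
          then show "k \<in> {1..n}" using lt[of j] by auto
        qed
      qed auto
      \<comment> \<open>The sum is at most 2; the value 4 is taken for its rational square
        root.\<close>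
      also have "\<dots> \<le> 4" using sum_inverse_squares_le[of n] by simp
      finally show ?thesis by (intro real_sqrt_le_mono mult_mono) (auto intro: sum_nonneg)
    qed
    finally show "(\<Sum>j=1..nu n. \<bar>b j\<bar> * ?g j) \<le> sqrt ((\<Sum>j=1..nu n. (b j)\<^sup>2) * 4)" .
  qed
  finally show ?thesis by (simp add: real_sqrt_mult)
qed

text \<open>Uniform continuity handles the bulk. Near \<open>\<pi>\<close> the contribution is of
  order maximal weight times root of the sum of squares; relative to the sum of squares this is the
  ratio in the weight condition.\<close>

lemma weighted_local_err_tendsto_0:
  assumes cA: "continuous_on {-pi..pi} A"
    and weights: "(\<lambda>n. Max ((\<lambda>j. \<bar>b n j\<bar>) ` {1..nu n}) / sqrt (\<Sum>j=1..nu n. (b n j)\<^sup>2)) \<longlonglongrightarrow> 0"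
    and nz: "\<forall>\<^sub>F n in sequentially. (\<Sum>j=1..nu n. (b n j)\<^sup>2) \<noteq> 0"
  shows "(\<lambda>n. (\<Sum>j=1..nu n. (b n j)\<^sup>2 * local_err A n j) / (\<Sum>j=1..nu n. (b n j)\<^sup>2)) \<longlonglongrightarrow> 0"
proof -
  obtain L where L: "\<And>u. u \<in> {-pi..pi} \<Longrightarrow> cmod (A u) \<le> L"
    using compact_imp_bounded[OF compact_continuous_image[OF cA compact_Icc]] unfolding bounded_iff by (metis imageI)
  define B where "B n = (\<Sum>j=1..nu n. (b n j)\<^sup>2)" for n
  define m where "m n = Max ((\<lambda>j. \<bar>b n j\<bar>) ` {1..nu n})" for n
  have l0: "0 \<le> local_err A n j" for n j
    unfolding local_err_def
    by (intro divide_nonneg_nonneg Henstock_Kurzweil_Integration.integral_nonneg integrable_continuous_interval continuous_intros cA) auto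
  show ?thesis unfolding B_def[symmetric]
  proof (rule LIMSEQ_I)
    fix e :: real assume e: "0 < e"
    have "uniformly_continuous_on {-pi..pi} A" using cA by (rule compact_uniformly_continuous) simp
    then obtain \<delta> where \<delta>: "0 < \<delta>" and d: "\<And>u v. u \<in> {-pi..pi} \<Longrightarrow> v \<in> {-pi..pi} \<Longrightarrow> dist v u < \<delta> \<Longrightarrow> dist (A v) (A u) < sqrt (e / 2)"
      unfolding uniformly_continuous_on_def using e by (metis half_gt_zero real_sqrt_gt_zero)
    have close: "(cmod (A u - A v))\<^sup>2 \<le> e / 2" if "u \<in> {-pi..pi}" "v \<in> {-pi..pi}" "\<bar>u - v\<bar> < \<delta>" for u v
    proof -
      have "cmod (A u - A v) \<le> sqrt (e / 2)" using d[of v u] that by (simp add: dist_norm)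
      then have "(cmod (A u - A v))\<^sup>2 \<le> (sqrt (e / 2))\<^sup>2" by (intro power_mono) auto
      then show ?thesis using e by simp
    qed
    define g where "g n = 4 * L\<^sup>2 * pi\<^sup>2 / \<delta>\<^sup>2 * (1 / real n) + 4 * L\<^sup>2 * (m n / sqrt (B n))" for n
    have "g \<longlonglongrightarrow> 4 * L\<^sup>2 * pi\<^sup>2 / \<delta>\<^sup>2 * 0 + 4 * L\<^sup>2 * 0"
      unfolding g_def[abs_def] m_def B_def by (intro tendsto_intros weights lim_1_over_n)
    then have "\<forall>\<^sub>F n in sequentially. g n < e / 2" using e by (intro order_tendstoD) auto
    with nz have "\<forall>\<^sub>F n in sequentially. norm ((\<Sum>j=1..nu n. (b n j)\<^sup>2 * local_err A n j) / B n - 0) < e"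
    proof eventually_elim
      case (elim n)
      have Bp: "0 < B n" using elim unfolding B_def by (simp add: sum_nonneg order_less_le)
      \<comment> \<open>\<open>Max\<close> says something only for a nonempty index range, which a
        nonzero sum of squares guarantees.\<close>
      have ne: "{1..nu n} \<noteq> {}" using elim(1) by (intro notI) (simp only: sum.empty)
      have mj: "\<bar>b n j\<bar> \<le> m n" if "j \<in> {1..nu n}" for j unfolding m_def using that by (intro Max_ge) auto
      have m0: "0 \<le> m n" using mj ne abs_ge_zero order_trans by blast
      have "(\<Sum>j=1..nu n. (b n j)\<^sup>2 * local_err A n j)
        \<le> (\<Sum>j=1..nu n. (b n j)\<^sup>2 * (e / 2 + 4 * L\<^sup>2 * pi\<^sup>2 / \<delta>\<^sup>2 * (1 / n) + 2 * L\<^sup>2 * (1 / (real n - 2 * real j))))"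
        using e by (intro sum_mono mult_left_mono local_err_le cA L \<delta> close) auto
      also have "\<dots> = (e / 2 + 4 * L\<^sup>2 * pi\<^sup>2 / \<delta>\<^sup>2 * (1 / n)) * B n + 2 * L\<^sup>2 * (\<Sum>j=1..nu n. (b n j)\<^sup>2 * (1 / (real n - 2 * real j)))"
        unfolding B_def sum_distrib_left sum.distrib[symmetric] by (intro sum.cong refl) (simp only: distrib_left mult_ac)
      also have "\<dots> \<le> (e / 2 + 4 * L\<^sup>2 * pi\<^sup>2 / \<delta>\<^sup>2 * (1 / n)) * B n + 2 * L\<^sup>2 * (2 * m n * sqrt (B n))"
        unfolding B_def by (intro add_left_mono mult_left_mono sum_weighted_boundary_le mj m0) auto
      also have "\<dots> = (e / 2 + g n) * B n"
      proof -
        have "m n / sqrt (B n) * B n = m n * (B n / sqrt (B n))" by simp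
        also have "\<dots> = m n * sqrt (B n)" using Bp by (simp only: real_div_sqrt less_imp_le)
        finally have "2 * L\<^sup>2 * (2 * m n * sqrt (B n)) = 4 * L\<^sup>2 * (m n / sqrt (B n)) * B n" unfolding mult.assoc by simp
        then show ?thesis unfolding g_def by (simp only: distrib_right add.assoc)
      qed
      also have "\<dots> < e * B n" using elim Bp by (intro mult_strict_right_mono) auto
      finally have "(\<Sum>j=1..nu n. (b n j)\<^sup>2 * local_err A n j) / B n < e" using Bp by (simp add: pos_divide_less_eq)
      moreover have "0 \<le> (\<Sum>j=1..nu n. (b n j)\<^sup>2 * local_err A n j) / B n"
        using Bp l0 by (intro divide_nonneg_nonneg sum_nonneg mult_nonneg_nonneg) auto
      ultimately show ?case by simp
    qed
    then show "\<exists>no. \<forall>n\<ge>no. norm ((\<Sum>j=1..nu n. (b n j)\<^sup>2 * local_err A n j) / B n - 0) < e"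
      unfolding eventually_sequentially .
  qed
qed

section \<open>Rate of Fejer means under a Lipschitz condition\<close>

lemma has_integral_powr_shift:
  fixes b c p :: real
  assumes p: "- 1 < p" and ab: "c < b"
  shows "((\<lambda>u. (u - c) powr p) has_integral (b - c) powr (p + 1) / (p + 1)) {c..b}"
proof -
  have "((\<lambda>u. (u - c) powr p) has_integral (b - c) powr (p + 1) / (p + 1) - (c - c) powr (p + 1) / (p + 1)) {c..b}"
  proof (rule fundamental_theorem_of_calculus_interior[where f="\<lambda>u. (u - c) powr (p + 1) / (p + 1)"])
    \<comment> \<open>The integrand is singular at the left endpoint for negative \<open>p\<close>,
      but the antiderivative is continuous there because \<open>p + 1\<close> is positive.\<close>
    show "continuous_on {c..b} (\<lambda>u. (u - c) powr (p + 1) / (p + 1))"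
      using p by (intro continuous_intros continuous_on_powr') auto
    fix x assume x: "x \<in> {c<..<b}"
    have "((\<lambda>u. u - c) has_real_derivative 1) (at x)" by (auto intro!: derivative_eq_intros)
    from DERIV_fun_powr[OF this, of "p + 1"] x
    have "((\<lambda>u. (u - c) powr (p + 1)) has_real_derivative (p + 1) * (x - c) powr p) (at x)" by simp
    from DERIV_cdivide[OF this, of "p + 1"]
    have "((\<lambda>u. (u - c) powr (p + 1) / (p + 1)) has_real_derivative (x - c) powr p) (at x)"
      using p by simp
    then show "((\<lambda>u. (u - c) powr (p + 1) / (p + 1)) has_vector_derivative (x - c) powr p) (at x)"
      unfolding has_real_derivative_iff_has_vector_derivative .
  qed (use ab in simp)
  then show ?thesis using p by simp
qed

text \<open>Interpolating \<open>fejer \<le> n\<close> with \<open>fejer \<le> \<pi>\<^sup>2 / (n d\<^sup>2)\<close>, where \<open>d\<close> is the circular distance,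
  gives the rate \<open>n powr - \<gamma>\<close> with the integrable singularity \<open>d powr (\<beta> - 1 - \<gamma>)\<close>.\<close>

lemma fejer_powr_le:
  assumes j: "j \<in> {1..nu n}" and u: "u \<in> {-pi..pi}" and \<gamma>: "0 < \<gamma>" "\<gamma> < 1" and d: "0 < circ_dist u (freq n j)"
  shows "fejer n j u \<le> pi\<^sup>2 * real n powr - \<gamma> * circ_dist u (freq n j) powr (- 1 - \<gamma>)"
proof -
  let ?d = "circ_dist u (freq n j)" and ?T = "fejer n j u"
  \<comment> \<open>Interpolation weight chosen so that
    \<open>n powr (1 - 2 \<theta>) = n powr (-\<gamma>)\<close> and
    \<open>d powr (-2 \<theta>) = d powr (-1 - \<gamma>)\<close>.\<close>
  define \<theta> where "\<theta> = (1 + \<gamma>) / 2"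
  have th: "0 < \<theta>" "\<theta> < 1" using \<gamma> by (auto simp: \<theta>_def)
  have n: "0 < real n" using j nu_double_less[of j n] by simp
  show ?thesis
  proof (cases "?T = 0")
    case True then show ?thesis by simp
  next
    case False
    then have T: "0 < ?T" using fejer_nonneg[of n j u] by simp
    have b: "?T \<le> pi\<^sup>2 / n / ?d\<^sup>2" using fejer_circ_dist_le[OF j u] d by (subst pos_le_divide_eq) auto
    have "?T = ?T powr (1 - \<theta>) * ?T powr \<theta>" using T by (simp flip: powr_add)
    also have "\<dots> \<le> real n powr (1 - \<theta>) * (pi\<^sup>2 / n / ?d\<^sup>2) powr \<theta>"
      using T th b fejer_le_n[OF j] by (intro mult_mono powr_mono2) auto
    also have "(pi\<^sup>2 / n / ?d\<^sup>2) powr \<theta> = pi powr (1 + \<gamma>) * real n powr - \<theta> * ?d powr (- 1 - \<gamma>)"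
    proof -
      have sq: "(x\<^sup>2) powr \<theta> = x powr (1 + \<gamma>)" if "0 < x" for x :: real
      proof -
        have "2 * \<theta> = 1 + \<gamma>" by (simp add: \<theta>_def)
        moreover have "(x\<^sup>2) powr \<theta> = x powr (2 * \<theta>)" using that by (simp add: powr_powr flip: powr_numeral)
        ultimately show ?thesis by simp
      qed
      have "(pi\<^sup>2 / n / ?d\<^sup>2) powr \<theta> = (pi\<^sup>2) powr \<theta> / real n powr \<theta> / (?d\<^sup>2) powr \<theta>"
        using n d by (simp add: powr_divide powr_mult)
      also have "\<dots> = pi powr (1 + \<gamma>) * real n powr - \<theta> * ?d powr - (1 + \<gamma>)"
        unfolding sq[OF pi_gt_zero] sq[OF d] powr_minus by (simp add: divide_inverse)
      finally show ?thesis by simp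
    qed
    also have "real n powr (1 - \<theta>) * (pi powr (1 + \<gamma>) * real n powr - \<theta> * ?d powr (- 1 - \<gamma>))
      = pi powr (1 + \<gamma>) * (real n powr (1 - \<theta>) * real n powr - \<theta>) * ?d powr (- 1 - \<gamma>)" by (simp only: mult_ac)
    also have "real n powr (1 - \<theta>) * real n powr - \<theta> = real n powr - \<gamma>"
      unfolding powr_add[symmetric] \<theta>_def by (simp add: field_simps)
    also have "pi powr (1 + \<gamma>) * real n powr - \<gamma> * ?d powr (- 1 - \<gamma>) \<le> pi\<^sup>2 * real n powr - \<gamma> * ?d powr (- 1 - \<gamma>)"
    proof -
      have "pi powr (1 + \<gamma>) \<le> pi powr 2" using \<gamma> pi_gt3 by (intro powr_mono) auto
      then show ?thesis by (intro mult_right_mono) auto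
    qed
    finally show ?thesis .
  qed
qed

text \<open>Reflection: an even \<open>f\<close> satisfies \<open>f u = f |u|\<close>, so comparing
  \<open>|u|\<close> with \<open>v\<close> turns a Lipschitz condition on the interval into one for
  the circular distance, across the seam as well.\<close>

lemma abs_diff_abs_le_circ_dist:
  assumes "u \<in> {-pi..pi}" "v \<in> {0<..<pi}"
  shows "\<bar>\<bar>u\<bar> - v\<bar> \<le> circ_dist u v"
  using assms unfolding circ_dist_def by auto

text \<open>The error is the integral of the kernel against the Lipschitz bound, whose exponents
  combine to an integrable singularity. That \<open>K\<close> and \<open>\<gamma>\<close> do not
  depend on \<open>n\<close> and \<open>j\<close> allows summation over the frequencies.\<close>

lemma fejer_mean_error:
  fixes f :: "real \<Rightarrow> real"
  assumes cf: "continuous_on {-pi..pi} f" and even: "\<And>u. u \<in> {-pi..pi} \<Longrightarrow> f (- u) = f u"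
    and \<beta>: "1 / 2 < \<beta>" "\<beta> \<le> 1"
    and lip: "\<And>u v. u \<in> {-pi..pi} \<Longrightarrow> v \<in> {-pi..pi} \<Longrightarrow> \<bar>f u - f v\<bar> \<le> C * \<bar>u - v\<bar> powr \<beta>"
  shows "\<exists>K \<gamma>. 1 / 2 < \<gamma> \<and> (\<forall>n. \<forall>j\<in>{1..nu n}.
    \<bar>integral {-pi..pi} (\<lambda>u. fejer n j u * f u) / (2 * pi) - f (freq n j)\<bar> \<le> K * real n powr - \<gamma>)"
proof -
  \<comment> \<open>Midpoint of 1/2 and \<open>\<beta>\<close>: above 1/2 to beat the factor
    \<open>sqrt n\<close> when the errors are summed, below \<open>\<beta>\<close> so that
    \<open>p > -1\<close>.\<close>
  define \<gamma> where "\<gamma> = (\<beta> + 1 / 2) / 2"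
  define p where "p = \<beta> - 1 - \<gamma>"
  have g: "1 / 2 < \<gamma>" "\<gamma> < \<beta>" "0 < \<gamma>" "\<gamma> < 1" and p: "- 1 < p" "p < 0" using \<beta> by (auto simp: \<gamma>_def p_def)
  define C' where "C' = max C 0"
  define K where "K = pi\<^sup>2 * C' * (3 * ((4 * pi) powr (p + 1) / (p + 1))) / (2 * pi)"
  have "\<bar>integral {-pi..pi} (\<lambda>u. fejer n j u * f u) / (2 * pi) - f (freq n j)\<bar> \<le> K * real n powr - \<gamma>"
    if j: "j \<in> {1..nu n}" for n j
  proof -
    let ?v = "freq n j"
    let ?c = "pi\<^sup>2 * C' * real n powr - \<gamma>"
    note v = freq_in[OF j]
    have vP: "?v \<in> {-pi..pi}" using v by auto
    \<comment> \<open>The circular distance is one of the two bases, so its power is one of the two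
      summands, and each summand can be integrated by itself.\<close>
    define h where "h u = \<bar>u - ?v\<bar> powr p + (u + 2 * pi - ?v) powr p" for u
    have pw: "\<bar>fejer n j u * (f u - f ?v)\<bar> \<le> ?c * h u" if u: "u \<in> {-pi..pi}" for u
    proof -
      let ?d = "circ_dist u ?v"
      have d0: "0 \<le> ?d" using abs_diff_abs_le_circ_dist[OF u v] by linarith
      have "f u = f \<bar>u\<bar>" using even[OF u] by (auto simp: abs_if)
      then have "\<bar>f u - f ?v\<bar> \<le> C * \<bar>\<bar>u\<bar> - ?v\<bar> powr \<beta>" using lip[of "\<bar>u\<bar>" ?v] u vP by (auto simp: abs_le_iff)
      also have "\<dots> \<le> C' * \<bar>\<bar>u\<bar> - ?v\<bar> powr \<beta>" unfolding C'_def by (intro mult_right_mono) auto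
      also have "\<dots> \<le> C' * ?d powr \<beta>"
        using abs_diff_abs_le_circ_dist[OF u v] \<beta> by (intro mult_left_mono powr_mono2) (auto simp: C'_def)
      finally have fl: "\<bar>f u - f ?v\<bar> \<le> C' * ?d powr \<beta>" .
      show ?thesis
      proof (cases "?d = 0")
        case True
        then have "f u - f ?v = 0" using fl by simp
        moreover have "0 \<le> ?c * h u" unfolding h_def C'_def by simp
        ultimately show ?thesis by simp
      next
        case False
        then have d: "0 < ?d" using d0 by simp
        have "\<bar>fejer n j u * (f u - f ?v)\<bar> = fejer n j u * \<bar>f u - f ?v\<bar>" using fejer_nonneg[of n j u] by (simp add: abs_mult)
        also have "\<dots> \<le> (pi\<^sup>2 * real n powr - \<gamma> * ?d powr (- 1 - \<gamma>)) * (C' * ?d powr \<beta>)"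
          by (intro mult_mono fejer_powr_le j u g d fl) auto
        also have "\<dots> = ?c * (?d powr (- 1 - \<gamma>) * ?d powr \<beta>)" by simp
        also have "?d powr (- 1 - \<gamma>) * ?d powr \<beta> = ?d powr p"
          unfolding powr_add[symmetric] p_def by (simp add: algebra_simps)
        also have "?c * ?d powr p \<le> ?c * h u"
        proof (rule mult_left_mono)
          show "?d powr p \<le> h u" unfolding h_def circ_dist_def min_def by auto
        qed (simp add: C'_def)
        finally show ?thesis .
      qed
    qed
    have i1: "((\<lambda>u. \<bar>u - ?v\<bar> powr p) has_integral ((?v + pi) powr (p + 1) / (p + 1) + (pi - ?v) powr (p + 1) / (p + 1))) {-pi..pi}"
    proof (rule has_integral_combine[of _ ?v])
      \<comment> \<open>The part to the left of \<open>v\<close> is the reflection of the part to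
        the right of \<open>-v\<close>.\<close>
      have "((\<lambda>u. (u - - ?v) powr p) has_integral (pi - - ?v) powr (p + 1) / (p + 1)) {- ?v..pi}"
        by (rule has_integral_powr_shift) (use p v in auto)
      then have "((\<lambda>u. (- u - - ?v) powr p) has_integral (pi - - ?v) powr (p + 1) / (p + 1)) {- pi..- (- ?v)}"
        by (subst has_integral_reflect_real[of "\<lambda>u. (u - - ?v) powr p"])
      then have "((\<lambda>u. (?v - u) powr p) has_integral (?v + pi) powr (p + 1) / (p + 1)) {- pi..?v}"
        by (simp add: add.commute)
      then show "((\<lambda>u. \<bar>u - ?v\<bar> powr p) has_integral (?v + pi) powr (p + 1) / (p + 1)) {- pi..?v}"
        by (rule has_integral_eq[rotated]) auto
      have "((\<lambda>u. (u - ?v) powr p) has_integral (pi - ?v) powr (p + 1) / (p + 1)) {?v..pi}"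
        by (rule has_integral_powr_shift) (use p v in auto)
      then show "((\<lambda>u. \<bar>u - ?v\<bar> powr p) has_integral (pi - ?v) powr (p + 1) / (p + 1)) {?v..pi}"
        by (rule has_integral_eq[rotated]) auto
    qed (use v in auto)
    have i2: "(\<lambda>u. (u + 2 * pi - ?v) powr p) integrable_on {-pi..pi}"
      using v by (intro integrable_continuous_interval continuous_intros) auto
    have i2': "integral {-pi..pi} (\<lambda>u. (u + 2 * pi - ?v) powr p) \<le> (3 * pi - ?v) powr (p + 1) / (p + 1)"
    proof -
      have h: "((\<lambda>u. (u - (?v - 2 * pi)) powr p) has_integral (pi - (?v - 2 * pi)) powr (p + 1) / (p + 1)) {?v - 2 * pi..pi}"
        by (rule has_integral_powr_shift) (use p v in auto)
      have e: "(\<lambda>u. (u - (?v - 2 * pi)) powr p) = (\<lambda>u. (u + 2 * pi - ?v) powr p)" by (auto simp: algebra_simps)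
      \<comment> \<open>Enlarging the domain down to the zero of the base reuses the antiderivative
        from the singular endpoint and gives a bound uniform in \<open>v\<close>.\<close>
      have "integral {-pi..pi} (\<lambda>u. (u + 2 * pi - ?v) powr p) \<le> integral {?v - 2 * pi..pi} (\<lambda>u. (u + 2 * pi - ?v) powr p)"
        using h i2 v unfolding e by (intro integral_subset_le) auto
      also have "\<dots> = (3 * pi - ?v) powr (p + 1) / (p + 1)" using integral_unique[OF h] unfolding e by simp
      finally show ?thesis .
    qed
    have ih: "h integrable_on {-pi..pi}" unfolding h_def[abs_def] using i1 i2 by (intro integrable_add) auto
    have "integral {-pi..pi} h = integral {-pi..pi} (\<lambda>u. \<bar>u - ?v\<bar> powr p) + integral {-pi..pi} (\<lambda>u. (u + 2 * pi - ?v) powr p)"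
      unfolding h_def[abs_def] using i1 i2 by (intro Henstock_Kurzweil_Integration.integral_add) auto
    also have "\<dots> \<le> ((?v + pi) powr (p + 1) / (p + 1) + (pi - ?v) powr (p + 1) / (p + 1)) + (3 * pi - ?v) powr (p + 1) / (p + 1)"
      using i2' integral_unique[OF i1] by linarith
    also have "\<dots> \<le> 3 * ((4 * pi) powr (p + 1) / (p + 1))"
    proof -
      have "x powr (p + 1) / (p + 1) \<le> (4 * pi) powr (p + 1) / (p + 1)" if "0 \<le> x" "x \<le> 4 * pi" for x
        using that p by (intro divide_right_mono powr_mono2) auto
      from this[of "?v + pi"] this[of "pi - ?v"] this[of "3 * pi - ?v"] show ?thesis using v by auto
    qed
    finally have hI: "integral {-pi..pi} h \<le> 3 * ((4 * pi) powr (p + 1) / (p + 1))" .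
    have if1: "(\<lambda>u. fejer n j u * f u) integrable_on {-pi..pi}" 
      and if2: "(\<lambda>u. fejer n j u * (f u - f ?v)) integrable_on {-pi..pi}"
      by (intro integrable_continuous_interval continuous_intros cf)+
    have "integral {-pi..pi} (\<lambda>u. fejer n j u * (f u - f ?v)) = integral {-pi..pi} (\<lambda>u. fejer n j u * f u) - f ?v * (2 * pi)"
    proof -
      have "((\<lambda>u. fejer n j u * f u - f ?v * fejer n j u) has_integral integral {-pi..pi} (\<lambda>u. fejer n j u * f u) - f ?v * (2 * pi)) {-pi..pi}"
        by (intro has_integral_diff has_integral_mult_right fejer_integral j integrable_integral if1)
      then show ?thesis by (intro integral_unique) (simp add: algebra_simps)
    qed
    then have "\<bar>integral {-pi..pi} (\<lambda>u. fejer n j u * f u) / (2 * pi) - f ?v\<bar>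
       = norm (integral {-pi..pi} (\<lambda>u. fejer n j u * (f u - f ?v))) / (2 * pi)"
      by (simp add: diff_divide_distrib[symmetric] field_simps)
    also have "\<dots> \<le> integral {-pi..pi} (\<lambda>u. ?c * h u) / (2 * pi)"
      using pw integrable_cmul[OF ih, of ?c] by (intro divide_right_mono integral_norm_bound_integral if2) auto
    also have "\<dots> = ?c * integral {-pi..pi} h / (2 * pi)" by simp
    also have "\<dots> \<le> ?c * (3 * ((4 * pi) powr (p + 1) / (p + 1))) / (2 * pi)"
      by (intro divide_right_mono mult_left_mono hI) (auto simp: C'_def)
    also have "\<dots> = K * real n powr - \<gamma>" unfolding K_def by simp
    finally show ?thesis .
  qed
  then show ?thesis using g by blast
qed

subsection \<open>Passage from the truncated to the full filter\<close>

text \<open>Weighted AM-GM for the mixed term. The free parameter \<open>l\<close> lets the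
  coefficient of the fixed quantity \<open>y\<^sup>2\<close> be made small at the expense of the
  vanishing one.\<close>

lemma abs_square_diff_le:
  fixes x y l :: real
  assumes "0 < l"
  shows "\<bar>x\<^sup>2 - y\<^sup>2\<bar> \<le> (1 + 1 / l) * (x - y)\<^sup>2 + l * y\<^sup>2"
proof -
  have "0 \<le> (\<bar>x - y\<bar> / sqrt l - sqrt l * \<bar>y\<bar>)\<^sup>2" by simp
  then have a: "2 * (\<bar>x - y\<bar> * \<bar>y\<bar>) \<le> (x - y)\<^sup>2 / l + l * y\<^sup>2"
    using assms by (simp add: power2_diff power_divide power_mult_distrib)
  have "\<bar>x\<^sup>2 - y\<^sup>2\<bar> = \<bar>(x - y)\<^sup>2 + 2 * ((x - y) * y)\<bar>" by (simp add: power2_eq_square algebra_simps)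
  also have "\<dots> \<le> (x - y)\<^sup>2 + 2 * (\<bar>x - y\<bar> * \<bar>y\<bar>)"
    by (rule order_trans[OF abs_triangle_ineq]) (simp add: abs_mult)
  finally show ?thesis using a by (simp add: algebra_simps)
qed

text \<open>First \<open>l\<close> is fixed so that \<open>l * D\<close> is small, then
  \<open>n\<close> is taken large.\<close>

lemma tendsto_0_of_weighted_bounds:
  fixes d e :: "nat \<Rightarrow> real"
  assumes e: "e \<longlonglongrightarrow> 0" and b: "\<And>l n. 0 < l \<Longrightarrow> \<bar>d n\<bar> \<le> (1 + 1 / l) * e n + l * D"
  shows "d \<longlonglongrightarrow> 0"
proof (rule LIMSEQ_I)
  fix r :: real assume r: "0 < r"
  define l where "l = r / (2 * (\<bar>D\<bar> + 1))"
  have l: "0 < l" using r by (simp add: l_def)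
  have lD: "l * D \<le> r / 2"
  proof -
    have "l * D \<le> l * (\<bar>D\<bar> + 1)" using l by (intro mult_left_mono) auto
    also have "\<dots> = r / 2" unfolding l_def by (simp add: field_simps add_nonneg_eq_0_iff)
    finally show ?thesis .
  qed
  have "(\<lambda>n. (1 + 1 / l) * e n) \<longlonglongrightarrow> (1 + 1 / l) * 0" by (intro tendsto_intros e)
  then have "\<forall>\<^sub>F n in sequentially. (1 + 1 / l) * e n < r / 2" using r by (intro order_tendstoD) auto
  then have "\<forall>\<^sub>F n in sequentially. norm (d n - 0) < r"
  proof eventually_elim
    case (elim n)
    then show ?case using b[OF l, of n] lD unfolding diff_zero real_norm_def by linarith
  qed
  then show "\<exists>no. \<forall>n\<ge>no. norm (d n - 0) < r" unfolding eventually_sequentially .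
qed

context prob_space
begin

lemma square_L1_tendsto:
  fixes Y :: "'a \<Rightarrow> real" and YN :: "nat \<Rightarrow> 'a \<Rightarrow> real"
  assumes [measurable]: "Y \<in> borel_measurable M" "\<And>N. YN N \<in> borel_measurable M"
    and Y2: "integrable M (\<lambda>\<omega>. (Y \<omega>)\<^sup>2)" and D2: "\<And>N. integrable M (\<lambda>\<omega>. (YN N \<omega> - Y \<omega>)\<^sup>2)"
    and lim: "(\<lambda>N. expectation (\<lambda>\<omega>. (YN N \<omega> - Y \<omega>)\<^sup>2)) \<longlonglongrightarrow> 0"
  shows "integrable M (\<lambda>\<omega>. (YN N \<omega>)\<^sup>2)"
    and "(\<lambda>N. expectation (\<lambda>\<omega>. \<bar>(YN N \<omega>)\<^sup>2 - (Y \<omega>)\<^sup>2\<bar>)) \<longlonglongrightarrow> 0"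
proof -
  have b: "integrable M (\<lambda>\<omega>. (1 + 1 / l) * (YN N \<omega> - Y \<omega>)\<^sup>2 + l * (Y \<omega>)\<^sup>2)" for l N
    using Y2 D2[of N] by simp
  have i: "integrable M (\<lambda>\<omega>. (YN N \<omega>)\<^sup>2 - (Y \<omega>)\<^sup>2)" for N
    by (rule Bochner_Integration.integrable_bound[OF b[of 1 N]])
      (use abs_square_diff_le[of 1] in \<open>auto intro!: AE_I2 order_trans[OF _ abs_ge_self]\<close>)
  from Bochner_Integration.integrable_add[OF this[of N] Y2] show "integrable M (\<lambda>\<omega>. (YN N \<omega>)\<^sup>2)" by simp
  show "(\<lambda>N. expectation (\<lambda>\<omega>. \<bar>(YN N \<omega>)\<^sup>2 - (Y \<omega>)\<^sup>2\<bar>)) \<longlonglongrightarrow> 0"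
  proof (rule tendsto_0_of_weighted_bounds[OF lim])
    fix l :: real and N assume l: "0 < l"
    have "expectation (\<lambda>\<omega>. \<bar>(YN N \<omega>)\<^sup>2 - (Y \<omega>)\<^sup>2\<bar>) \<le> expectation (\<lambda>\<omega>. (1 + 1 / l) * (YN N \<omega> - Y \<omega>)\<^sup>2 + l * (Y \<omega>)\<^sup>2)"
      using i b abs_square_diff_le[OF l] by (intro integral_mono) auto
    also have "\<dots> = (1 + 1 / l) * expectation (\<lambda>\<omega>. (YN N \<omega> - Y \<omega>)\<^sup>2) + l * expectation (\<lambda>\<omega>. (Y \<omega>)\<^sup>2)"
      using Y2 D2[of N] by simp
    finally show "\<bar>expectation (\<lambda>\<omega>. \<bar>(YN N \<omega>)\<^sup>2 - (Y \<omega>)\<^sup>2\<bar>)\<bar>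
      \<le> (1 + 1 / l) * expectation (\<lambda>\<omega>. (YN N \<omega> - Y \<omega>)\<^sup>2) + l * expectation (\<lambda>\<omega>. (Y \<omega>)\<^sup>2)"
      by (simp add: integral_nonneg_AE)
  qed
qed

text \<open>A sequence converging in L1 has an almost surely convergent subsequence, and Fatou's
  lemma applies to its squares. Square integrability of the limit is part of the conclusion: in the
  application the limit is quadratic in a process known only to be in L2.\<close>

lemma second_moment_lower_semicontinuous:
  fixes Z :: "'a \<Rightarrow> real" and ZN :: "nat \<Rightarrow> 'a \<Rightarrow> real"
  assumes [measurable]: "Z \<in> borel_measurable M" "\<And>N. ZN N \<in> borel_measurable M"
    and D1: "\<And>N. integrable M (\<lambda>\<omega>. ZN N \<omega> - Z \<omega>)"
    and lim: "(\<lambda>N. expectation (\<lambda>\<omega>. \<bar>ZN N \<omega> - Z \<omega>\<bar>)) \<longlonglongrightarrow> 0"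
    and Z2: "\<And>N. integrable M (\<lambda>\<omega>. (ZN N \<omega>)\<^sup>2)" "\<And>N. expectation (\<lambda>\<omega>. (ZN N \<omega>)\<^sup>2) \<le> B N" and B: "B \<longlonglongrightarrow> b"
  shows "integrable M (\<lambda>\<omega>. (Z \<omega>)\<^sup>2)" and "expectation (\<lambda>\<omega>. (Z \<omega>)\<^sup>2) \<le> b"
proof -
  obtain r where r: "strict_mono r" and ae: "AE \<omega> in M. (\<lambda>n. ZN (r n) \<omega> - Z \<omega>) \<longlonglongrightarrow> 0"
    using tendsto_L1_AE_subseq[of M "\<lambda>N \<omega>. ZN N \<omega> - Z \<omega>"] D1 lim by auto
  have b0: "0 \<le> b"
    by (rule LIMSEQ_le_const[OF B]) (use Z2(2) in \<open>auto intro!: exI[of _ 0] order_trans[OF integral_nonneg_AE]\<close>)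
  have "(\<integral>\<^sup>+\<omega>. ennreal ((Z \<omega>)\<^sup>2) \<partial>M) = (\<integral>\<^sup>+\<omega>. liminf (\<lambda>n. ennreal ((ZN (r n) \<omega>)\<^sup>2)) \<partial>M)"
  proof (rule nn_integral_cong_AE)
    show "AE \<omega> in M. ennreal ((Z \<omega>)\<^sup>2) = liminf (\<lambda>n. ennreal ((ZN (r n) \<omega>)\<^sup>2))"
      using ae
    proof eventually_elim
      case (elim \<omega>)
      then have "(\<lambda>n. ZN (r n) \<omega>) \<longlonglongrightarrow> Z \<omega>" by (simp add: LIM_zero_iff)
      then have "(\<lambda>n. ennreal ((ZN (r n) \<omega>)\<^sup>2)) \<longlonglongrightarrow> ennreal ((Z \<omega>)\<^sup>2)" by (intro tendsto_intros tendsto_ennrealI)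
      from lim_imp_Liminf[OF _ this] show ?case by simp
    qed
  qed
  also have "\<dots> \<le> liminf (\<lambda>n. \<integral>\<^sup>+\<omega>. ennreal ((ZN (r n) \<omega>)\<^sup>2) \<partial>M)" by (rule nn_integral_liminf) measurable
  also have "\<dots> \<le> liminf (\<lambda>n. ennreal (B (r n)))"
    using Z2 by (intro Liminf_mono always_eventually allI) (simp add: nn_integral_eq_integral ennreal_leI)
  also have "\<dots> = ennreal b"
  proof -
    have "(\<lambda>n. ennreal (B (r n))) \<longlonglongrightarrow> ennreal b"
      using LIMSEQ_subseq_LIMSEQ[OF B r] by (intro tendsto_ennrealI) (simp add: o_def)
    from lim_imp_Liminf[OF _ this] show ?thesis by simp
  qed
  finally have le: "(\<integral>\<^sup>+\<omega>. ennreal ((Z \<omega>)\<^sup>2) \<partial>M) \<le> ennreal b" .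
  then show i: "integrable M (\<lambda>\<omega>. (Z \<omega>)\<^sup>2)"
    by (intro integrableI_bounded) (auto simp: le_less_trans[OF le])
  then show "expectation (\<lambda>\<omega>. (Z \<omega>)\<^sup>2) \<le> b" using le b0 by (simp add: nn_integral_eq_integral ennreal_le_iff)
qed

end

lemma transfer_err_tendsto_0:
  assumes A: "transfer_function a A" and cA: "continuous_on {-pi..pi} A"
  shows "transfer_err a A \<longlonglongrightarrow> 0"
proof -
  have e: "(\<Sum>k<N. exp (- \<i> * of_nat k * complex_of_real u) * complex_of_real (a k)) = trunc_transfer a N u" for N u
    unfolding trunc_transfer_def by (intro sum.cong refl) (simp add: cis_conv_exp mult.assoc)
  have "(\<integral>\<^sup>+u\<in>Pi_int. ennreal ((cmod (A u - trunc_transfer a N u))\<^sup>2) \<partial>lborel) = ennreal (transfer_err a A N)" for N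
  proof -
    have "(\<lambda>u. (cmod (A u - trunc_transfer a N u))\<^sup>2) integrable_on {-pi..pi}"
      by (intro integrable_continuous_interval continuous_intros cA)
    then have "((\<lambda>u. (cmod (A u - trunc_transfer a N u))\<^sup>2) has_integral transfer_err a A N) {-pi..pi}"
      unfolding transfer_err_def by (rule integrable_integral)
    from nn_integral_has_integral_lebesgue[OF _ this]
    have "(\<integral>\<^sup>+u. ennreal (indicator {-pi..pi} u * (cmod (A u - trunc_transfer a N u))\<^sup>2) \<partial>lborel) = ennreal (transfer_err a A N)" by simp
    then show ?thesis by (simp add: ennreal_mult' ennreal_indicator mult.commute)
  qed
  then have "(\<lambda>N. ennreal (transfer_err a A N)) \<longlonglongrightarrow> 0"
    using A unfolding transfer_function_def e by simp
  then show ?thesis by (simp add: ennreal_tendsto_0_iff transfer_err_nonneg)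
qed

lemma trunc_transfer_minus: "trunc_transfer a N (- u) = cnj (trunc_transfer a N u)"
  unfolding trunc_transfer_def by (simp add: cis_cnj)

text \<open>Real coefficients give conjugate symmetry of the partial sums, which passes to the L2
  limit. The squared defect of \<open>A\<close> is then continuous with integral zero, so the
  symmetry holds at every point of the interval.\<close>

lemma spec_dens_even:
  assumes A: "transfer_function a A" and cA: "continuous_on {-pi..pi} A" and u: "u \<in> {-pi..pi}"
  shows "spec_dens A (- u) = spec_dens A u"
proof -
  let ?g = "\<lambda>u. (cmod (A u - cnj (A (- u))))\<^sup>2"
  have cA': "continuous_on {-pi..pi} (\<lambda>u. A (- u))"
    by (rule continuous_on_compose2[OF cA]) (auto intro!: continuous_intros)
  have cg: "continuous_on {-pi..pi} ?g" by (intro continuous_intros cA cA')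
  have le: "integral {-pi..pi} ?g \<le> 4 * transfer_err a A N" for N
  proof -
    let ?h = "\<lambda>u. (cmod (A u - trunc_transfer a N u))\<^sup>2"
    have i: "?h integrable_on {-pi..pi}" by (intro integrable_continuous_interval continuous_intros cA)
    have h: "(?h has_integral transfer_err a A N) {-pi..pi}" unfolding transfer_err_def by (rule integrable_integral[OF i])
    have h': "((\<lambda>u. ?h (- u)) has_integral transfer_err a A N) {-pi..pi}"
      using h has_integral_reflect_real[of ?h "transfer_err a A N" pi "-pi"] by (simp only: minus_minus)
    have "integral {-pi..pi} ?g \<le> 2 * transfer_err a A N + 2 * transfer_err a A N"
    proof (rule has_integral_le)
      show "(?g has_integral integral {-pi..pi} ?g) {-pi..pi}" by (intro integrable_integral integrable_continuous_interval cg)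
      show "((\<lambda>u. 2 * ?h u + 2 * ?h (- u)) has_integral 2 * transfer_err a A N + 2 * transfer_err a A N) {-pi..pi}"
        by (intro has_integral_add has_integral_mult_right h h')
      fix u
      have "cmod (A u - cnj (A (- u))) \<le> cmod (A u - trunc_transfer a N u) + cmod (trunc_transfer a N u - cnj (A (- u)))"
        using norm_triangle_ineq[of "A u - trunc_transfer a N u" "trunc_transfer a N u - cnj (A (- u))"] by simp
      also have "cmod (trunc_transfer a N u - cnj (A (- u))) = cmod (A (- u) - trunc_transfer a N (- u))"
      proof -
        have "trunc_transfer a N u - cnj (A (- u)) = - cnj (A (- u) - trunc_transfer a N (- u))" by (simp add: trunc_transfer_minus)
        then show ?thesis by (simp only: norm_minus_cancel complex_mod_cnj)
      qed
      finally have "?g u \<le> (cmod (A u - trunc_transfer a N u) + cmod (A (- u) - trunc_transfer a N (- u)))\<^sup>2"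
        by (intro power_mono) auto
      also have "\<dots> \<le> 2 * ?h u + 2 * ?h (- u)"
        using sum_squares_bound[of "cmod (A u - trunc_transfer a N u)" "cmod (A (- u) - trunc_transfer a N (- u))"]
        by (simp add: power2_sum)
      finally show "?g u \<le> 2 * ?h u + 2 * ?h (- u)" .
    qed
    then show ?thesis by simp
  qed
  have "(\<lambda>N. 4 * transfer_err a A N) \<longlonglongrightarrow> 4 * 0" by (intro tendsto_intros transfer_err_tendsto_0[OF A cA])
  then have "integral {-pi..pi} ?g \<le> 4 * 0" by (rule LIMSEQ_le_const) (use le in auto)
  moreover have "0 \<le> integral {-pi..pi} ?g"
    by (intro Henstock_Kurzweil_Integration.integral_nonneg integrable_continuous_interval cg) auto
  ultimately have "integral {-pi..pi} ?g = 0" by simp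
  moreover have "- pi < pi" using pi_gt_zero by linarith
  ultimately have "\<forall>x\<in>{-pi..pi}. ?g x = 0"
    using integral_eq_0_iff[OF cg] zero_le_power2 by blast
  then have "?g u = 0" using u by (rule bspec)
  then have "A u = cnj (A (- u))" by simp
  then have "cmod (A u) = cmod (A (- u))" by (metis complex_mod_cnj)
  then show ?thesis unfolding spec_dens_def by simp
qed

text \<open>For fixed \<open>n\<close> the kernel is bounded by \<open>n\<close>, so L2 convergence
  of the partial sums suffices.\<close>

lemma fejer_integral_tendsto:
  assumes A: "transfer_function a A" and cA: "continuous_on {-pi..pi} A" and j: "j \<in> {1..nu n}"
  shows "(\<lambda>N. integral {-pi..pi} (\<lambda>u. fejer n j u * (cmod (trunc_transfer a N u))\<^sup>2))
    \<longlonglongrightarrow> integral {-pi..pi} (\<lambda>u. fejer n j u * (cmod (A u))\<^sup>2)"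
proof -
  let ?I = "integral {-pi..pi} (\<lambda>u. fejer n j u * (cmod (A u))\<^sup>2)"
  let ?J = "\<lambda>N. integral {-pi..pi} (\<lambda>u. fejer n j u * (cmod (trunc_transfer a N u))\<^sup>2)"
  have "(\<lambda>N. ?J N - ?I) \<longlonglongrightarrow> 0"
  proof (rule tendsto_0_of_weighted_bounds)
    have "(\<lambda>N. n * transfer_err a A N) \<longlonglongrightarrow> real n * 0" by (intro tendsto_intros transfer_err_tendsto_0[OF A cA])
    then show "(\<lambda>N. n * transfer_err a A N) \<longlonglongrightarrow> 0" by simp
    fix l :: real and N assume l: "0 < l"
    let ?h = "\<lambda>u. (cmod (A u - trunc_transfer a N u))\<^sup>2"
    have i: "(\<lambda>u. fejer n j u * (cmod (A u))\<^sup>2) integrable_on {-pi..pi}"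
      "(\<lambda>u. fejer n j u * (cmod (trunc_transfer a N u))\<^sup>2) integrable_on {-pi..pi}" "?h integrable_on {-pi..pi}"
      by (intro integrable_continuous_interval continuous_intros cA)+
    have 1: "?J N - ?I = integral {-pi..pi} (\<lambda>u. fejer n j u * (cmod (trunc_transfer a N u))\<^sup>2 - fejer n j u * (cmod (A u))\<^sup>2)"
      by (rule Henstock_Kurzweil_Integration.integral_diff[OF i(2,1), symmetric])
    have 2: "norm (integral {-pi..pi} (\<lambda>u. fejer n j u * (cmod (trunc_transfer a N u))\<^sup>2 - fejer n j u * (cmod (A u))\<^sup>2))
      \<le> integral {-pi..pi} (\<lambda>u. (1 + 1 / l) * n * ?h u + l * (fejer n j u * (cmod (A u))\<^sup>2))"
    proof (rule integral_norm_bound_integral)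
      show "(\<lambda>u. fejer n j u * (cmod (trunc_transfer a N u))\<^sup>2 - fejer n j u * (cmod (A u))\<^sup>2) integrable_on {-pi..pi}"
        "(\<lambda>u. (1 + 1 / l) * n * ?h u + l * (fejer n j u * (cmod (A u))\<^sup>2)) integrable_on {-pi..pi}"
        by (intro integrable_continuous_interval continuous_intros cA)+
      fix u
      let ?x = "cmod (trunc_transfer a N u)" and ?y = "cmod (A u)"
      have "\<bar>?x - ?y\<bar> \<le> cmod (A u - trunc_transfer a N u)"
        using norm_triangle_ineq3[of "trunc_transfer a N u" "A u"] by (simp add: norm_minus_commute)
      from power_mono[OF this, of 2] have "(?x - ?y)\<^sup>2 \<le> ?h u" by simp
      then have "(1 + 1 / l) * (?x - ?y)\<^sup>2 \<le> (1 + 1 / l) * ?h u" using l by (intro mult_left_mono) auto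
      then have "\<bar>?x\<^sup>2 - ?y\<^sup>2\<bar> \<le> (1 + 1 / l) * ?h u + l * ?y\<^sup>2"
        using abs_square_diff_le[OF l, of ?x ?y] by linarith
      then have "fejer n j u * \<bar>?x\<^sup>2 - ?y\<^sup>2\<bar> \<le> fejer n j u * ((1 + 1 / l) * ?h u + l * ?y\<^sup>2)"
        by (intro mult_left_mono fejer_nonneg)
      moreover have "fejer n j u * ((1 + 1 / l) * ?h u + l * ?y\<^sup>2) = fejer n j u * ((1 + 1 / l) * ?h u) + l * (fejer n j u * ?y\<^sup>2)"
        by (simp only: distrib_left mult.left_commute)
      moreover have "fejer n j u * ((1 + 1 / l) * ?h u) \<le> n * ((1 + 1 / l) * ?h u)"
        using l by (intro mult_right_mono fejer_le_n j) auto
      moreover have "n * ((1 + 1 / l) * ?h u) = (1 + 1 / l) * n * ?h u" by (simp only: mult_ac)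
      moreover have "norm (fejer n j u * ?x\<^sup>2 - fejer n j u * ?y\<^sup>2) = fejer n j u * \<bar>?x\<^sup>2 - ?y\<^sup>2\<bar>"
        using fejer_nonneg[of n j u] by (simp only: right_diff_distrib[symmetric] real_norm_def abs_mult abs_of_nonneg)
      ultimately show "norm (fejer n j u * ?x\<^sup>2 - fejer n j u * ?y\<^sup>2) \<le> (1 + 1 / l) * n * ?h u + l * (fejer n j u * ?y\<^sup>2)"
        by linarith
    qed
    have "((\<lambda>u. (1 + 1 / l) * n * ?h u + l * (fejer n j u * (cmod (A u))\<^sup>2)) has_integral (1 + 1 / l) * n * transfer_err a A N + l * ?I) {-pi..pi}"
      unfolding transfer_err_def using i by (intro has_integral_add has_integral_mult_right) auto
    from integral_unique[OF this]
    have 3: "integral {-pi..pi} (\<lambda>u. (1 + 1 / l) * n * ?h u + l * (fejer n j u * (cmod (A u))\<^sup>2)) = (1 + 1 / l) * (n * transfer_err a A N) + l * ?I"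
      by (simp only: mult.assoc)
    show "\<bar>?J N - ?I\<bar> \<le> (1 + 1 / l) * (n * transfer_err a A N) + l * ?I"
      using 2 unfolding 1[symmetric] 3 real_norm_def .
  qed
  then show ?thesis by (simp add: LIM_zero_iff)
qed

subsection \<open>Weighted sums of periodogram ordinates\<close>

definition dft :: "(int \<Rightarrow> 'w \<Rightarrow> real) \<Rightarrow> nat \<Rightarrow> nat \<Rightarrow> 'w \<Rightarrow> complex" where
  "dft X n j \<omega> = (\<Sum>t\<in>{1..int n}. dft_vec n j t * complex_of_real (X t \<omega>))"

lemma periodogram_dft: "periodogram X n (freq n j) \<omega> = (cmod (dft X n j \<omega>))\<^sup>2 / (2 * pi)"
proof -
  have "dft X n j \<omega> = (\<Sum>t=1..n. exp (\<i> * of_nat t * complex_of_real (freq n j)) * complex_of_real (X (int t) \<omega>)) / sqrt n"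
    unfolding dft_def sum_int_Icc dft_vec_def sum_divide_distrib
    by (intro sum.cong refl) (simp add: cis_conv_exp mult.assoc)
  then show ?thesis unfolding periodogram_def by (simp add: norm_divide power_divide mult.commute)
qed

lemma Q_stat_dft: "Q_stat b X n \<omega> = (\<Sum>j=1..nu n. b n j / (2 * pi) * (cmod (dft X n j \<omega>))\<^sup>2)"
  unfolding Q_stat_def periodogram_dft by simp

lemma cmod_square_sum_real:
  fixes w :: "'b \<Rightarrow> complex" and x :: "'b \<Rightarrow> real"
  shows "(cmod (\<Sum>s\<in>I. w s * complex_of_real (x s)))\<^sup>2 = (\<Sum>s\<in>I. \<Sum>t\<in>I. Re (w s * cnj (w t)) * x s * x t)"
proof -
  have "complex_of_real ((cmod (\<Sum>s\<in>I. w s * complex_of_real (x s)))\<^sup>2)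
    = (\<Sum>s\<in>I. \<Sum>t\<in>I. (w s * cnj (w t)) * complex_of_real (x s * x t))"
    unfolding cmod_sum_square by (intro sum.cong refl) simp
  then have "Re (complex_of_real ((cmod (\<Sum>s\<in>I. w s * complex_of_real (x s)))\<^sup>2))
    = (\<Sum>s\<in>I. \<Sum>t\<in>I. Re ((w s * cnj (w t)) * complex_of_real (x s * x t)))" by (simp only: Re_sum)
  also have "\<dots> = (\<Sum>s\<in>I. \<Sum>t\<in>I. Re (w s * cnj (w t)) * x s * x t)"
  proof (intro sum.cong refl)
    fix s t
    have r: "Re (p * complex_of_real r) = Re p * r" for p r by simp
    show "Re ((w s * cnj (w t)) * complex_of_real (x s * x t)) = Re (w s * cnj (w t)) * x s * x t"
      by (subst r) (rule mult.assoc[symmetric])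
  qed
  finally show ?thesis by (simp only: Re_complex_of_real)
qed

context iid_innovations
begin

definition trunc_proc :: "(nat \<Rightarrow> real) \<Rightarrow> nat \<Rightarrow> int \<Rightarrow> 'w \<Rightarrow> real" where
  "trunc_proc a N t \<omega> = (\<Sum>k<N. a k * z (t - int k) \<omega>)"

lemma trunc_proc_lin:
  assumes "t \<in> {1..int n}"
  shows "trunc_proc a N t = lin (\<lambda>s. trunc_coeff a N (t - s)) (window n N)"
  using sum_trunc_coeff[OF assms, of a N "\<lambda>s. z s _"] unfolding trunc_proc_def lin_def by (simp add: fun_eq_iff)

lemma trunc_proc_measurable [measurable]: "trunc_proc a N t \<in> borel_measurable M"
  unfolding trunc_proc_def by measurable

lemma dft_trunc_proc:
  "dft (trunc_proc a N) n j \<omega> = (\<Sum>s\<in>window n N. toep a n N (dft_vec n j) s * complex_of_real (z s \<omega>))"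
proof -
  have "dft (trunc_proc a N) n j \<omega> = (\<Sum>t\<in>{1..int n}. \<Sum>s\<in>window n N. dft_vec n j t * complex_of_real (trunc_coeff a N (t - s)) * complex_of_real (z s \<omega>))"
    unfolding dft_def by (intro sum.cong refl) (simp add: trunc_proc_lin[where n=n] lin_def sum_distrib_left mult.assoc)
  also have "\<dots> = (\<Sum>s\<in>window n N. \<Sum>t\<in>{1..int n}. dft_vec n j t * complex_of_real (trunc_coeff a N (t - s)) * complex_of_real (z s \<omega>))"
    by (rule sum.swap)
  finally show ?thesis unfolding toep_def sum_distrib_right .
qed

text \<open>Real and imaginary part are linear forms with coefficients from \<open>toep\<close>, and
  Parseval's identity turns the sum of squares into the integral.\<close>

lemma expectation_dft_trunc_proc:
  shows "integrable M (\<lambda>\<omega>. (cmod (dft (trunc_proc a N) n j \<omega>))\<^sup>2)"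
    and "expectation (\<lambda>\<omega>. (cmod (dft (trunc_proc a N) n j \<omega>))\<^sup>2)
      = integral {-pi..pi} (\<lambda>u. fejer n j u * (cmod (trunc_transfer a N u))\<^sup>2) / (2 * pi)"
proof -
  let ?W = "toep a n N (dft_vec n j)" and ?I = "window n N"
  have e: "(cmod (dft (trunc_proc a N) n j \<omega>))\<^sup>2 = (lin (\<lambda>s. Re (?W s)) ?I \<omega>)\<^sup>2 + (lin (\<lambda>s. Im (?W s)) ?I \<omega>)\<^sup>2" for \<omega>
    unfolding dft_trunc_proc cmod_power2 lin_def by simp
  note l = lin_moments[OF finite_window[of n N]]
  show "integrable M (\<lambda>\<omega>. (cmod (dft (trunc_proc a N) n j \<omega>))\<^sup>2)" unfolding e using l by simp
  have "expectation (\<lambda>\<omega>. (cmod (dft (trunc_proc a N) n j \<omega>))\<^sup>2) = (\<Sum>s\<in>?I. (cmod (?W s))\<^sup>2)"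
    unfolding e using l by (simp add: cmod_power2 sum.distrib)
  also have "\<dots> = integral {-pi..pi} (\<lambda>u. fejer n j u * (cmod (trunc_transfer a N u))\<^sup>2) / (2 * pi)"
    using integral_unique[OF toep_diff_norm[of n "dft_vec n j" a N 0]] by (simp add: fejer_def toep_diff_def)
  finally show "expectation (\<lambda>\<omega>. (cmod (dft (trunc_proc a N) n j \<omega>))\<^sup>2)
      = integral {-pi..pi} (\<lambda>u. fejer n j u * (cmod (trunc_transfer a N u))\<^sup>2) / (2 * pi)" .
qed

text \<open>The Bartlett approximation: up to its mean, \<open>qf (cosker n c)\<close> is the weighted periodogram
  sum of the innovations.\<close>

lemma Q_trunc_minus_qf:
  assumes n: "0 < n" and c: "\<And>j. c j = b n j * spec_dens A (freq n j)"
  shows "\<exists>\<kappa>. \<forall>\<omega>. Q_stat b (trunc_proc a N) n \<omega> - qf (cosker n c) {1..int n} \<omega> = qf (diff_ker a A n (b n) N) (window n N) \<omega> + \<kappa>"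
proof -
  let ?I = "window n N" and ?J = "{1..nu n}" and ?K = "diff_ker a A n (b n) N"
  define W where "W j = toep a n N (dft_vec n j)" for j
  \<comment> \<open>Real Gram entries of the Fourier vectors, extended by zero so that both
    quadratic forms run over the same window.\<close>
  define e where "e j s s' = (if s \<in> {1..int n} \<and> s' \<in> {1..int n} then Re (dft_vec n j s * cnj (dft_vec n j s')) else 0)" for j s s'
  have zz: "(cmod (\<Sum>t\<in>{1..int n}. cis (real_of_int t * freq n j) * z t \<omega>))\<^sup>2 / n = (\<Sum>s\<in>?I. \<Sum>s'\<in>?I. e j s s' * z s \<omega> * z s' \<omega>)" for j \<omega>
  proof -
    have "(\<Sum>t\<in>{1..int n}. cis (real_of_int t * freq n j) * z t \<omega>) / sqrt n = (\<Sum>t\<in>{1..int n}. dft_vec n j t * z t \<omega>)"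
      unfolding dft_vec_def sum_divide_distrib by simp
    then have "(cmod (\<Sum>t\<in>{1..int n}. cis (real_of_int t * freq n j) * z t \<omega>))\<^sup>2 / n = (cmod (\<Sum>t\<in>{1..int n}. dft_vec n j t * z t \<omega>))\<^sup>2"
      using n by (simp add: norm_divide power_divide flip: \<open>_ / _ = _\<close>)
    also have "\<dots> = (\<Sum>s\<in>{1..int n}. \<Sum>s'\<in>{1..int n}. Re (dft_vec n j s * cnj (dft_vec n j s')) * z s \<omega> * z s' \<omega>)"
      by (rule cmod_square_sum_real)
    also have "\<dots> = (\<Sum>s\<in>{1..int n}. \<Sum>s'\<in>?I. e j s s' * z s \<omega> * z s' \<omega>)"
      using window_superset[of n N] unfolding e_def by (intro sum.cong refl sum.mono_neutral_cong_left) auto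
    also have "\<dots> = (\<Sum>s\<in>?I. \<Sum>s'\<in>?I. e j s s' * z s \<omega> * z s' \<omega>)"
      using window_superset[of n N] unfolding e_def by (intro sum.mono_neutral_cong_left) auto
    finally show ?thesis .
  qed
  have Q: "Q_stat b (trunc_proc a N) n \<omega> = (\<Sum>j\<in>?J. b n j / (2 * pi) * (\<Sum>s\<in>?I. \<Sum>s'\<in>?I. Re (W j s * cnj (W j s')) * z s \<omega> * z s' \<omega>))" for \<omega>
    unfolding Q_stat_dft dft_trunc_proc cmod_square_sum_real W_def ..
  have S: "qf (cosker n c) {1..int n} \<omega> = (\<Sum>j\<in>?J. b n j / (2 * pi) * (\<Sum>s\<in>?I. \<Sum>s'\<in>?I. (cmod (A (freq n j)))\<^sup>2 * e j s s' * z s \<omega> * z s' \<omega>)) - (\<Sum>j\<in>?J. c j)" for \<omega>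
  proof -
    have "qf (cosker n c) {1..int n} \<omega> = (\<Sum>j\<in>?J. c j * (\<Sum>s\<in>?I. \<Sum>s'\<in>?I. e j s s' * z s \<omega> * z s' \<omega>)) - (\<Sum>j\<in>?J. c j)"
      unfolding qf_cosker[OF n] zz by (simp add: right_diff_distrib sum_subtractf)
    also have "(\<Sum>j\<in>?J. c j * (\<Sum>s\<in>?I. \<Sum>s'\<in>?I. e j s s' * z s \<omega> * z s' \<omega>)) = (\<Sum>j\<in>?J. b n j / (2 * pi) * (\<Sum>s\<in>?I. \<Sum>s'\<in>?I. (cmod (A (freq n j)))\<^sup>2 * e j s s' * z s \<omega> * z s' \<omega>))"
      unfolding c spec_dens_def mult.assoc sum_distrib_left[symmetric] by (intro sum.cong refl) simp
    finally show ?thesis .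
  qed
  \<comment> \<open>The constant collects the traces of the two centred forms. Its value is dropped
    from the statement and recovered later as an expectation.\<close>
  have "Q_stat b (trunc_proc a N) n \<omega> - qf (cosker n c) {1..int n} \<omega> = qf ?K ?I \<omega> + ((\<Sum>s\<in>?I. ?K s s) + (\<Sum>j\<in>?J. c j))" for \<omega>
  proof -
    have "Q_stat b (trunc_proc a N) n \<omega> - qf (cosker n c) {1..int n} \<omega> - (\<Sum>j\<in>?J. c j)
      = (\<Sum>j\<in>?J. b n j / (2 * pi) * (\<Sum>s\<in>?I. \<Sum>s'\<in>?I. Re (W j s * cnj (W j s')) * z s \<omega> * z s' \<omega>))
       - (\<Sum>j\<in>?J. b n j / (2 * pi) * (\<Sum>s\<in>?I. \<Sum>s'\<in>?I. (cmod (A (freq n j)))\<^sup>2 * e j s s' * z s \<omega> * z s' \<omega>))"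
      unfolding Q S by simp
    also have "\<dots> = (\<Sum>j\<in>?J. \<Sum>s\<in>?I. \<Sum>s'\<in>?I. b n j / (2 * pi) * (Re (W j s * cnj (W j s')) - (cmod (A (freq n j)))\<^sup>2 * e j s s') * z s \<omega> * z s' \<omega>)"
      unfolding sum_distrib_left sum_subtractf[symmetric]
      by (intro sum.cong refl) (simp only: left_diff_distrib right_diff_distrib mult.assoc)
    also have "\<dots> = (\<Sum>s\<in>?I. \<Sum>j\<in>?J. \<Sum>s'\<in>?I. b n j / (2 * pi) * (Re (W j s * cnj (W j s')) - (cmod (A (freq n j)))\<^sup>2 * e j s s') * z s \<omega> * z s' \<omega>)"
      by (rule sum.swap)
    also have "\<dots> = (\<Sum>s\<in>?I. \<Sum>s'\<in>?I. \<Sum>j\<in>?J. b n j / (2 * pi) * (Re (W j s * cnj (W j s')) - (cmod (A (freq n j)))\<^sup>2 * e j s s') * z s \<omega> * z s' \<omega>)"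
      by (intro sum.cong refl sum.swap)
    also have "\<dots> = (\<Sum>s\<in>?I. \<Sum>s'\<in>?I. ?K s s' * z s \<omega> * z s' \<omega>)"
      unfolding diff_ker_def W_def[symmetric] e_def[symmetric] sum_distrib_right ..
    finally show ?thesis unfolding qf_def[of ?K] by simp
  qed
  then show ?thesis by blast
qed

lemma diff_ker_sym: "diff_ker a A n b N s t = diff_ker a A n b N t s"
proof -
  have r: "Re (x * cnj y) = Re (y * cnj x)" for x y :: complex by simp
  show ?thesis unfolding diff_ker_def
    by (intro sum.cong refl arg_cong2[where f="(*)"] arg_cong2[where f="(-)"] r if_cong) auto
qed

section \<open>The full linear process as a limit of truncated ones\<close>

context
  fixes a :: "nat \<Rightarrow> real" and X :: "int \<Rightarrow> 'w \<Rightarrow> real" and A :: "real \<Rightarrow> complex"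
  assumes X: "linear_process M a z X" and A: "transfer_function a A" and cA: "continuous_on {-pi..pi} A"
begin

lemma X_measurable [measurable]: "X t \<in> borel_measurable M"
  using X unfolding linear_process_def by blast

lemma X_trunc_L2:
  assumes t: "t \<in> {1..int n}"
  shows "integrable M (\<lambda>\<omega>. (X t \<omega>)\<^sup>2)" and "integrable M (\<lambda>\<omega>. (trunc_proc a N t \<omega> - X t \<omega>)\<^sup>2)"
    and "(\<lambda>N. expectation (\<lambda>\<omega>. (trunc_proc a N t \<omega> - X t \<omega>)\<^sup>2)) \<longlonglongrightarrow> 0"
proof -
  let ?D = "\<lambda>N \<omega>. (trunc_proc a N t \<omega> - X t \<omega>)\<^sup>2"
  have lim: "(\<lambda>N. \<integral>\<^sup>+\<omega>. ennreal (?D N \<omega>) \<partial>M) \<longlonglongrightarrow> 0"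
    using X unfolding linear_process_def trunc_proc_def by (simp add: power2_commute)
  have T2: "integrable M (\<lambda>\<omega>. (trunc_proc a N t \<omega>)\<^sup>2)" for N
    unfolding trunc_proc_lin[OF t] using lin_moments[OF finite_window[of n N]] by blast
  have le: "(x - y)\<^sup>2 \<le> 2 * x\<^sup>2 + 2 * y\<^sup>2" for x y :: real
    using zero_le_power2[of "x + y"] by (simp add: power2_sum power2_diff)
  \<comment> \<open>A nonnegative integral tending to zero is finite from some index on. One such
    index makes \<open>X t\<close> square integrable, as a finite linear form plus an L2
    error.\<close>
  have "\<forall>\<^sub>F N in sequentially. (\<integral>\<^sup>+\<omega>. ennreal (?D N \<omega>) \<partial>M) < 1" using lim by (intro order_tendstoD) auto
  then obtain N0 where N0: "(\<integral>\<^sup>+\<omega>. ennreal (?D N0 \<omega>) \<partial>M) < 1" unfolding eventually_sequentially by blast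
  have i0: "integrable M (?D N0)"
    by (rule integrableI_bounded) (use N0 in \<open>auto intro: less_trans\<close>)
  have le0: "(X t \<omega>)\<^sup>2 \<le> 2 * (trunc_proc a N0 t \<omega>)\<^sup>2 + 2 * ?D N0 \<omega>" for \<omega>
    using le[of "trunc_proc a N0 t \<omega>" "trunc_proc a N0 t \<omega> - X t \<omega>"] by simp
  have "integrable M (\<lambda>\<omega>. 2 * (trunc_proc a N0 t \<omega>)\<^sup>2 + 2 * ?D N0 \<omega>)" using T2 i0 by simp
  then show X2: "integrable M (\<lambda>\<omega>. (X t \<omega>)\<^sup>2)"
    by (rule Bochner_Integration.integrable_bound)
      (use le0 in \<open>auto intro!: AE_I2\<close>)
  have iN: "integrable M (?D N)" for N
  proof -
    have "integrable M (\<lambda>\<omega>. 2 * (trunc_proc a N t \<omega>)\<^sup>2 + 2 * (X t \<omega>)\<^sup>2)" using T2 X2 by simp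
    then show ?thesis by (rule Bochner_Integration.integrable_bound) (use le in \<open>auto intro!: AE_I2\<close>)
  qed
  then show "integrable M (?D N)" .
  show "(\<lambda>N. expectation (?D N)) \<longlonglongrightarrow> 0"
    using lim iN by (simp add: nn_integral_eq_integral ennreal_tendsto_0_iff integral_nonneg_AE)
qed

text \<open>Real weights are enough, because the squared modulus of a Fourier transform is the sum
  of the squares of two real combinations.\<close>

lemma real_combination_L1:
  fixes w :: "int \<Rightarrow> real" and n :: nat
  defines "Y \<equiv> \<lambda>\<omega>. \<Sum>t\<in>{1..int n}. w t * X t \<omega>" and "YN \<equiv> \<lambda>N \<omega>. \<Sum>t\<in>{1..int n}. w t * trunc_proc a N t \<omega>"
  shows "integrable M (\<lambda>\<omega>. (Y \<omega>)\<^sup>2)" and "integrable M (\<lambda>\<omega>. (YN N \<omega>)\<^sup>2)"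
    and "(\<lambda>N. expectation (\<lambda>\<omega>. \<bar>(YN N \<omega>)\<^sup>2 - (Y \<omega>)\<^sup>2\<bar>)) \<longlonglongrightarrow> 0"
proof -
  let ?T = "{1..int n}" and ?D = "\<lambda>N t \<omega>. trunc_proc a N t \<omega> - X t \<omega>"
  have cs: "(\<Sum>t\<in>?T. w t * x t)\<^sup>2 \<le> (\<Sum>t\<in>?T. (w t)\<^sup>2) * (\<Sum>t\<in>?T. (x t)\<^sup>2)" for x
    by (rule Cauchy_Schwarz_ineq_sum)
  have [measurable]: "Y \<in> borel_measurable M" "YN N \<in> borel_measurable M" for N unfolding Y_def YN_def by measurable
  have bY: "integrable M (\<lambda>\<omega>. (\<Sum>t\<in>?T. (w t)\<^sup>2) * (\<Sum>t\<in>?T. (X t \<omega>)\<^sup>2))"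
    by (intro integrable_mult_right Bochner_Integration.integrable_sum X_trunc_L2(1)[where n=n])
  show Y2: "integrable M (\<lambda>\<omega>. (Y \<omega>)\<^sup>2)"
    by (rule Bochner_Integration.integrable_bound[OF bY]) (use cs in \<open>auto simp: Y_def intro!: AE_I2 order_trans[OF _ abs_ge_self]\<close>)
  have e: "YN N \<omega> - Y \<omega> = (\<Sum>t\<in>?T. w t * ?D N t \<omega>)" for N \<omega>
    unfolding Y_def YN_def sum_subtractf[symmetric] by (simp add: right_diff_distrib)
  have bD: "integrable M (\<lambda>\<omega>. (\<Sum>t\<in>?T. (w t)\<^sup>2) * (\<Sum>t\<in>?T. (?D N t \<omega>)\<^sup>2))" for N
    by (intro integrable_mult_right Bochner_Integration.integrable_sum X_trunc_L2(2)[where n=n])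
  have D2: "integrable M (\<lambda>\<omega>. (YN N \<omega> - Y \<omega>)\<^sup>2)" for N
    by (rule Bochner_Integration.integrable_bound[OF bD]) (use cs in \<open>auto simp: e intro!: AE_I2 order_trans[OF _ abs_ge_self]\<close>)
  have lim: "(\<lambda>N. expectation (\<lambda>\<omega>. (YN N \<omega> - Y \<omega>)\<^sup>2)) \<longlonglongrightarrow> 0"
  proof (rule tendsto_sandwich[OF always_eventually always_eventually tendsto_const])
    show "\<forall>N. 0 \<le> expectation (\<lambda>\<omega>. (YN N \<omega> - Y \<omega>)\<^sup>2)" by simp
    show "\<forall>N. expectation (\<lambda>\<omega>. (YN N \<omega> - Y \<omega>)\<^sup>2) \<le> (\<Sum>t\<in>?T. (w t)\<^sup>2) * (\<Sum>t\<in>?T. expectation (\<lambda>\<omega>. (?D N t \<omega>)\<^sup>2))"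
    proof
      fix N
      have "expectation (\<lambda>\<omega>. (YN N \<omega> - Y \<omega>)\<^sup>2) \<le> expectation (\<lambda>\<omega>. (\<Sum>t\<in>?T. (w t)\<^sup>2) * (\<Sum>t\<in>?T. (?D N t \<omega>)\<^sup>2))"
        using D2 bD cs unfolding e by (intro integral_mono) auto
      also have "\<dots> = (\<Sum>t\<in>?T. (w t)\<^sup>2) * (\<Sum>t\<in>?T. expectation (\<lambda>\<omega>. (?D N t \<omega>)\<^sup>2))"
        using X_trunc_L2(2)[where n=n] by (simp add: Bochner_Integration.integral_sum)
      finally show "expectation (\<lambda>\<omega>. (YN N \<omega> - Y \<omega>)\<^sup>2) \<le> (\<Sum>t\<in>?T. (w t)\<^sup>2) * (\<Sum>t\<in>?T. expectation (\<lambda>\<omega>. (?D N t \<omega>)\<^sup>2))" .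
    qed
    have "(\<lambda>N. (\<Sum>t\<in>?T. (w t)\<^sup>2) * (\<Sum>t\<in>?T. expectation (\<lambda>\<omega>. (?D N t \<omega>)\<^sup>2))) \<longlonglongrightarrow> (\<Sum>t\<in>?T. (w t)\<^sup>2) * (\<Sum>t\<in>?T. 0)"
      by (intro tendsto_intros X_trunc_L2(3)[where n=n])
    then show "(\<lambda>N. (\<Sum>t\<in>?T. (w t)\<^sup>2) * (\<Sum>t\<in>?T. expectation (\<lambda>\<omega>. (?D N t \<omega>)\<^sup>2))) \<longlonglongrightarrow> 0" by simp
  qed
  show "integrable M (\<lambda>\<omega>. (YN N \<omega>)\<^sup>2)" by (rule square_L1_tendsto(1)[OF _ _ Y2 D2 lim]) auto
  show "(\<lambda>N. expectation (\<lambda>\<omega>. \<bar>(YN N \<omega>)\<^sup>2 - (Y \<omega>)\<^sup>2\<bar>)) \<longlonglongrightarrow> 0" by (rule square_L1_tendsto(2)[OF _ _ Y2 D2 lim]) auto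
qed

lemma dft_L1:
  shows "integrable M (\<lambda>\<omega>. (cmod (dft X n j \<omega>))\<^sup>2)"
    and "(\<lambda>N. expectation (\<lambda>\<omega>. \<bar>(cmod (dft (trunc_proc a N) n j \<omega>))\<^sup>2 - (cmod (dft X n j \<omega>))\<^sup>2\<bar>)) \<longlonglongrightarrow> 0"
proof -
  let ?T = "{1..int n}"
  define R where "R Z \<omega> = (\<Sum>t\<in>?T. Re (dft_vec n j t) * Z t \<omega>)" for Z :: "int \<Rightarrow> 'w \<Rightarrow> real" and \<omega>
  define I where "I Z \<omega> = (\<Sum>t\<in>?T. Im (dft_vec n j t) * Z t \<omega>)" for Z :: "int \<Rightarrow> 'w \<Rightarrow> real" and \<omega>
  have e: "(cmod (dft Z n j \<omega>))\<^sup>2 = (R Z \<omega>)\<^sup>2 + (I Z \<omega>)\<^sup>2" for Z \<omega>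
    unfolding cmod_power2 dft_def R_def I_def by simp
  note r = real_combination_L1[where n=n and w="\<lambda>t. Re (dft_vec n j t)", folded R_def]
  note i = real_combination_L1[where n=n and w="\<lambda>t. Im (dft_vec n j t)", folded I_def]
  show "integrable M (\<lambda>\<omega>. (cmod (dft X n j \<omega>))\<^sup>2)" unfolding e using r(1) i(1) by simp
  show "(\<lambda>N. expectation (\<lambda>\<omega>. \<bar>(cmod (dft (trunc_proc a N) n j \<omega>))\<^sup>2 - (cmod (dft X n j \<omega>))\<^sup>2\<bar>)) \<longlonglongrightarrow> 0"
  proof (rule tendsto_sandwich[OF always_eventually always_eventually tendsto_const])
    show "\<forall>N. 0 \<le> expectation (\<lambda>\<omega>. \<bar>(cmod (dft (trunc_proc a N) n j \<omega>))\<^sup>2 - (cmod (dft X n j \<omega>))\<^sup>2\<bar>)" by simp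
    let ?r = "\<lambda>N \<omega>. \<bar>(R (trunc_proc a N) \<omega>)\<^sup>2 - (R X \<omega>)\<^sup>2\<bar>" and ?i = "\<lambda>N \<omega>. \<bar>(I (trunc_proc a N) \<omega>)\<^sup>2 - (I X \<omega>)\<^sup>2\<bar>"
    have int: "integrable M (?r N)" "integrable M (?i N)" for N using r(1,2) i(1,2) by simp_all
    show "\<forall>N. expectation (\<lambda>\<omega>. \<bar>(cmod (dft (trunc_proc a N) n j \<omega>))\<^sup>2 - (cmod (dft X n j \<omega>))\<^sup>2\<bar>) \<le> expectation (?r N) + expectation (?i N)"
    proof
      fix N
      have "expectation (\<lambda>\<omega>. \<bar>(cmod (dft (trunc_proc a N) n j \<omega>))\<^sup>2 - (cmod (dft X n j \<omega>))\<^sup>2\<bar>) \<le> expectation (\<lambda>\<omega>. ?r N \<omega> + ?i N \<omega>)"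
        unfolding e using r(1,2) i(1,2) by (intro integral_mono) auto
      then show "expectation (\<lambda>\<omega>. \<bar>(cmod (dft (trunc_proc a N) n j \<omega>))\<^sup>2 - (cmod (dft X n j \<omega>))\<^sup>2\<bar>) \<le> expectation (?r N) + expectation (?i N)"
        using int by simp
    qed
    have "(\<lambda>N. expectation (?r N) + expectation (?i N)) \<longlonglongrightarrow> 0 + 0" by (intro tendsto_add r(3) i(3))
    then show "(\<lambda>N. expectation (?r N) + expectation (?i N)) \<longlonglongrightarrow> 0" by simp
  qed
qed

lemma Q_stat_L1:
  fixes b :: "nat \<Rightarrow> nat \<Rightarrow> real"
  shows "integrable M (Q_stat b X n)" and "integrable M (Q_stat b (trunc_proc a N) n)"
    and "(\<lambda>N. expectation (\<lambda>\<omega>. \<bar>Q_stat b (trunc_proc a N) n \<omega> - Q_stat b X n \<omega>\<bar>)) \<longlonglongrightarrow> 0"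
proof -
  let ?d = "\<lambda>N j \<omega>. \<bar>(cmod (dft (trunc_proc a N) n j \<omega>))\<^sup>2 - (cmod (dft X n j \<omega>))\<^sup>2\<bar>"
  show iX: "integrable M (Q_stat b X n)" unfolding Q_stat_dft[abs_def] using dft_L1(1) by simp
  show iN: "integrable M (Q_stat b (trunc_proc a N) n)" for N
    unfolding Q_stat_dft[abs_def] using expectation_dft_trunc_proc(1) by simp
  have id: "integrable M (?d N j)" for N j using dft_L1(1) expectation_dft_trunc_proc(1) by simp
  show "(\<lambda>N. expectation (\<lambda>\<omega>. \<bar>Q_stat b (trunc_proc a N) n \<omega> - Q_stat b X n \<omega>\<bar>)) \<longlonglongrightarrow> 0"
  proof (rule tendsto_sandwich[OF always_eventually always_eventually tendsto_const])
    show "\<forall>N. 0 \<le> expectation (\<lambda>\<omega>. \<bar>Q_stat b (trunc_proc a N) n \<omega> - Q_stat b X n \<omega>\<bar>)" by simp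
    show "\<forall>N. expectation (\<lambda>\<omega>. \<bar>Q_stat b (trunc_proc a N) n \<omega> - Q_stat b X n \<omega>\<bar>) \<le> (\<Sum>j=1..nu n. \<bar>b n j / (2 * pi)\<bar> * expectation (?d N j))"
    proof
      fix N
      have "expectation (\<lambda>\<omega>. \<bar>Q_stat b (trunc_proc a N) n \<omega> - Q_stat b X n \<omega>\<bar>) \<le> expectation (\<lambda>\<omega>. \<Sum>j=1..nu n. \<bar>b n j / (2 * pi)\<bar> * ?d N j \<omega>)"
      proof (intro integral_mono)
        fix \<omega>
        show "\<bar>Q_stat b (trunc_proc a N) n \<omega> - Q_stat b X n \<omega>\<bar> \<le> (\<Sum>j=1..nu n. \<bar>b n j / (2 * pi)\<bar> * ?d N j \<omega>)"
          unfolding Q_stat_dft sum_subtractf[symmetric] right_diff_distrib[symmetric]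
          by (rule order_trans[OF sum_abs]) (simp add: abs_mult)
      qed (use iX iN id in auto)
      then show "expectation (\<lambda>\<omega>. \<bar>Q_stat b (trunc_proc a N) n \<omega> - Q_stat b X n \<omega>\<bar>) \<le> (\<Sum>j=1..nu n. \<bar>b n j / (2 * pi)\<bar> * expectation (?d N j))"
        using id by simp
    qed
    have "(\<lambda>N. \<Sum>j=1..nu n. \<bar>b n j / (2 * pi)\<bar> * expectation (?d N j)) \<longlonglongrightarrow> (\<Sum>j=1..nu n. \<bar>b n j / (2 * pi)\<bar> * 0)"
      by (intro tendsto_intros dft_L1(2))
    then show "(\<lambda>N. \<Sum>j=1..nu n. \<bar>b n j / (2 * pi)\<bar> * expectation (?d N j)) \<longlonglongrightarrow> 0" by simp
  qed
qed

lemma Q_stat_measurable [measurable]: "Q_stat b X n \<in> borel_measurable M"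
  using Q_stat_L1(1) by blast

lemma expectation_Q_stat:
  "expectation (Q_stat b X n) = (\<Sum>j=1..nu n. b n j * (integral {-pi..pi} (\<lambda>u. fejer n j u * spec_dens A u) / (2 * pi)))"
proof (rule LIMSEQ_unique)
  have "(\<lambda>N. expectation (Q_stat b (trunc_proc a N) n) - expectation (Q_stat b X n)) \<longlonglongrightarrow> 0"
  proof (rule Lim_null_comparison[OF always_eventually Q_stat_L1(3)[of b n]], rule allI)
    fix N
    have "expectation (Q_stat b (trunc_proc a N) n) - expectation (Q_stat b X n) = expectation (\<lambda>\<omega>. Q_stat b (trunc_proc a N) n \<omega> - Q_stat b X n \<omega>)"
      using Q_stat_L1(1,2) by simp
    then show "norm (expectation (Q_stat b (trunc_proc a N) n) - expectation (Q_stat b X n)) \<le> expectation (\<lambda>\<omega>. \<bar>Q_stat b (trunc_proc a N) n \<omega> - Q_stat b X n \<omega>\<bar>)"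
      using integral_abs_bound[of M "\<lambda>\<omega>. Q_stat b (trunc_proc a N) n \<omega> - Q_stat b X n \<omega>"] by simp
  qed
  then show "(\<lambda>N. expectation (Q_stat b (trunc_proc a N) n)) \<longlonglongrightarrow> expectation (Q_stat b X n)" by (simp add: LIM_zero_iff)
  have "(\<lambda>N. \<Sum>j=1..nu n. b n j / (2 * pi) * (integral {-pi..pi} (\<lambda>u. fejer n j u * (cmod (trunc_transfer a N u))\<^sup>2) / (2 * pi)))
    \<longlonglongrightarrow> (\<Sum>j=1..nu n. b n j / (2 * pi) * (integral {-pi..pi} (\<lambda>u. fejer n j u * (cmod (A u))\<^sup>2) / (2 * pi)))"
    by (intro tendsto_sum tendsto_mult tendsto_const tendsto_divide fejer_integral_tendsto[OF A cA]) auto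
  moreover have "expectation (Q_stat b (trunc_proc a N) n) = (\<Sum>j=1..nu n. b n j / (2 * pi) * (integral {-pi..pi} (\<lambda>u. fejer n j u * (cmod (trunc_transfer a N u))\<^sup>2) / (2 * pi)))" for N
    unfolding Q_stat_dft[abs_def] using expectation_dft_trunc_proc by simp
  moreover have "integral {-pi..pi} (\<lambda>u. fejer n j u * spec_dens A u) = integral {-pi..pi} (\<lambda>u. fejer n j u * (cmod (A u))\<^sup>2) / (2 * pi)" for j
    unfolding spec_dens_def times_divide_eq_right by (rule integral_divide)
  ultimately show "(\<lambda>N. expectation (Q_stat b (trunc_proc a N) n)) \<longlonglongrightarrow> (\<Sum>j=1..nu n. b n j * (integral {-pi..pi} (\<lambda>u. fejer n j u * spec_dens A u) / (2 * pi)))"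
    by simp
qed

text \<open>For fixed \<open>n\<close> the truncated remainders are centred quadratic forms that
  converge to \<open>Z\<close> in L1, with second moments bounded through the Frobenius norm. As
  \<open>N\<close> grows the truncation errors disappear; the constant 6 is the 3 in front of
  \<open>L\<^sup>2\<close> times the 2 in front of \<open>local_err\<close>.\<close>

lemma Q_stat_approximation:
  assumes n: "0 < n" and c: "\<And>j. c j = b n j * spec_dens A (freq n j)"
    and L: "\<And>u. u \<in> {-pi..pi} \<Longrightarrow> cmod (A u) \<le> L"
  defines "Z \<equiv> \<lambda>\<omega>. Q_stat b X n \<omega> - expectation (Q_stat b X n) - qf (cosker n c) {1..int n} \<omega>"
  shows "integrable M (\<lambda>\<omega>. (Z \<omega>)\<^sup>2)"
    and "expectation (\<lambda>\<omega>. (Z \<omega>)\<^sup>2) \<le> 6 * (mu4 + 2) * L\<^sup>2 * (\<Sum>j=1..nu n. (b n j)\<^sup>2 * local_err A n j)"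
proof -
  define QN where "QN N = Q_stat b (trunc_proc a N) n" for N
  define Q where "Q = Q_stat b X n"
  define G where "G = qf (cosker n c) {1..int n}"
  define K where "K N = diff_ker a A n (b n) N" for N
  define B where "B N = (mu4 + 2) * ((3 * L\<^sup>2 + n * transfer_err a A N / pi) * (\<Sum>j=1..nu n. (b n j)\<^sup>2 * (2 * local_err A n j + n * transfer_err a A N / pi)))" for N
  have [measurable]: "Q \<in> borel_measurable M" "G \<in> borel_measurable M" unfolding Q_def G_def by auto
  have Z: "Z = (\<lambda>\<omega>. Q \<omega> - expectation Q - G \<omega>)" unfolding Z_def Q_def G_def ..
  have iQ: "integrable M Q" "integrable M (QN N)" for N unfolding Q_def QN_def by (rule Q_stat_L1)+
  have iG: "integrable M G" "expectation G = 0"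
    unfolding G_def using integrable_qf[of "{1..int n}" "cosker n c"] cosker_sym qf_cosker_moments(2)[OF n] by auto
  have Ksym: "K N s t = K N t s" for N s t unfolding K_def by (rule diff_ker_sym)
  note qm = qf_moments[of "window n _" "K _", OF finite_window Ksym]
  have ZN: "qf (K N) (window n N) \<omega> = QN N \<omega> - expectation (QN N) - G \<omega>" for N \<omega>
  proof -
    obtain \<kappa> where k: "\<And>\<omega>. QN N \<omega> - G \<omega> = qf (K N) (window n N) \<omega> + \<kappa>"
      using Q_trunc_minus_qf[where n=n and c=c and b=b and A=A and a=a and N=N, OF n c] unfolding QN_def G_def K_def by blast
    \<comment> \<open>Both quadratic forms have mean zero, which identifies the constant.\<close>
    have "expectation (\<lambda>\<omega>. QN N \<omega> - G \<omega>) = expectation (\<lambda>\<omega>. qf (K N) (window n N) \<omega> + \<kappa>)" unfolding k ..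
    then have "expectation (QN N) = \<kappa>"
      using iQ iG qm[of N] integrable_qf[of "window n N" "K N", OF finite_window Ksym] by (simp add: prob_space)
    then show ?thesis using k[of \<omega>] by simp
  qed
  have D: "qf (K N) (window n N) \<omega> - Z \<omega> = (QN N \<omega> - Q \<omega>) - (expectation (QN N) - expectation Q)" for N \<omega>
    unfolding ZN Z by simp
  have iD: "integrable M (\<lambda>\<omega>. qf (K N) (window n N) \<omega> - Z \<omega>)" for N unfolding D using iQ by simp
  have limD: "(\<lambda>N. expectation (\<lambda>\<omega>. \<bar>qf (K N) (window n N) \<omega> - Z \<omega>\<bar>)) \<longlonglongrightarrow> 0"
  proof (rule tendsto_sandwich[OF always_eventually always_eventually tendsto_const])
    show "\<forall>N. 0 \<le> expectation (\<lambda>\<omega>. \<bar>qf (K N) (window n N) \<omega> - Z \<omega>\<bar>)" by simp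
    show "\<forall>N. expectation (\<lambda>\<omega>. \<bar>qf (K N) (window n N) \<omega> - Z \<omega>\<bar>) \<le> 2 * expectation (\<lambda>\<omega>. \<bar>QN N \<omega> - Q \<omega>\<bar>)"
    proof
      fix N
      have m: "\<bar>expectation (QN N) - expectation Q\<bar> \<le> expectation (\<lambda>\<omega>. \<bar>QN N \<omega> - Q \<omega>\<bar>)"
        using integral_abs_bound[of M "\<lambda>\<omega>. QN N \<omega> - Q \<omega>"] iQ by simp
      have "expectation (\<lambda>\<omega>. \<bar>qf (K N) (window n N) \<omega> - Z \<omega>\<bar>) \<le> expectation (\<lambda>\<omega>. \<bar>QN N \<omega> - Q \<omega>\<bar> + \<bar>expectation (QN N) - expectation Q\<bar>)"
        unfolding D using iQ by (intro integral_mono) (auto intro: abs_triangle_ineq4)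
      also have "\<dots> = expectation (\<lambda>\<omega>. \<bar>QN N \<omega> - Q \<omega>\<bar>) + \<bar>expectation (QN N) - expectation Q\<bar>" using iQ by (simp add: prob_space)
      finally show "expectation (\<lambda>\<omega>. \<bar>qf (K N) (window n N) \<omega> - Z \<omega>\<bar>) \<le> 2 * expectation (\<lambda>\<omega>. \<bar>QN N \<omega> - Q \<omega>\<bar>)" using m by linarith
    qed
    have "(\<lambda>N. 2 * expectation (\<lambda>\<omega>. \<bar>QN N \<omega> - Q \<omega>\<bar>)) \<longlonglongrightarrow> 2 * 0"
      unfolding QN_def Q_def by (intro tendsto_intros Q_stat_L1(3))
    then show "(\<lambda>N. 2 * expectation (\<lambda>\<omega>. \<bar>QN N \<omega> - Q \<omega>\<bar>)) \<longlonglongrightarrow> 0" by simp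
  qed
  have qB: "expectation (\<lambda>\<omega>. (qf (K N) (window n N) \<omega>)\<^sup>2) \<le> B N" for N
  proof -
    have "expectation (\<lambda>\<omega>. (qf (K N) (window n N) \<omega>)\<^sup>2) \<le> (mu4 + 2) * (\<Sum>s\<in>window n N. \<Sum>t\<in>window n N. (K N s t)\<^sup>2)"
      by (rule qf_second_moment_le[of "window n N" "K N", OF finite_window Ksym])
    also have "\<dots> \<le> B N" unfolding B_def K_def using mu4_ge_1 by (intro mult_left_mono diff_ker_frobenius[OF cA L]) auto
    finally show ?thesis .
  qed
  have "B \<longlonglongrightarrow> (mu4 + 2) * ((3 * L\<^sup>2 + real n * 0 / pi) * (\<Sum>j=1..nu n. (b n j)\<^sup>2 * (2 * local_err A n j + real n * 0 / pi)))"
    unfolding B_def[abs_def] by (intro tendsto_intros transfer_err_tendsto_0[OF A cA]) auto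
  also have "(mu4 + 2) * ((3 * L\<^sup>2 + real n * 0 / pi) * (\<Sum>j=1..nu n. (b n j)\<^sup>2 * (2 * local_err A n j + real n * 0 / pi)))
     = 6 * (mu4 + 2) * L\<^sup>2 * (\<Sum>j=1..nu n. (b n j)\<^sup>2 * local_err A n j)"
    by (simp add: sum_distrib_left sum.distrib algebra_simps)
  finally have Blim: "B \<longlonglongrightarrow> 6 * (mu4 + 2) * L\<^sup>2 * (\<Sum>j=1..nu n. (b n j)\<^sup>2 * local_err A n j)" .
  have [measurable]: "Z \<in> borel_measurable M" unfolding Z by measurable
  have q2: "integrable M (\<lambda>\<omega>. (qf (K N) (window n N) \<omega>)\<^sup>2)" for N using qm by blast
  show "integrable M (\<lambda>\<omega>. (Z \<omega>)\<^sup>2)"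
    by (rule second_moment_lower_semicontinuous(1)[OF _ _ iD limD q2 qB Blim]) auto
  show "expectation (\<lambda>\<omega>. (Z \<omega>)\<^sup>2) \<le> 6 * (mu4 + 2) * L\<^sup>2 * (\<Sum>j=1..nu n. (b n j)\<^sup>2 * local_err A n j)"
    by (rule second_moment_lower_semicontinuous(2)[OF _ _ iD limD q2 qB Blim]) auto
qed

end

end

section \<open>Normalization, variance, limit law and mean\<close>

locale weighted_periodogram = iid_innovations M z for M :: "'w measure" and z +
  fixes a :: "nat \<Rightarrow> real" and X :: "int \<Rightarrow> 'w \<Rightarrow> real" and b :: "nat \<Rightarrow> nat \<Rightarrow> real"
    and A :: "real \<Rightarrow> complex" and C1 C2 :: real
  assumes X: "linear_process M a z X"
    and weights_nonzero: "\<forall>\<^sub>F n in sequentially. (\<Sum>j=1..nu n. (b n j)\<^sup>2) \<noteq> 0"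
    and weights: "(\<lambda>n. Max ((\<lambda>j. \<bar>b n j\<bar>) ` {1..nu n}) / sqrt (\<Sum>j=1..nu n. (b n j)\<^sup>2)) \<longlonglongrightarrow> 0"
    and A: "transfer_function a A" and cA: "continuous_on {-pi..pi} A"
    and C1: "0 < C1" and f_bounds: "\<And>u. u \<in> {-pi..pi} \<Longrightarrow> C1 \<le> spec_dens A u \<and> spec_dens A u \<le> C2"
    and nondegenerate: "expectation (\<lambda>\<omega>. z 0 \<omega> ^ 4) = 1 \<Longrightarrow>
         \<exists>c>0. \<forall>\<^sub>F n in sequentially. c * (\<Sum>j=1..nu n. (b n j)\<^sup>2) \<le> (v_norm M (z 0) b A n)\<^sup>2"
begin

definition v :: "nat \<Rightarrow> real" where "v n = v_norm M (z 0) b A n"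
definition c :: "nat \<Rightarrow> nat \<Rightarrow> real" where "c n j = b n j * spec_dens A (freq n j)"
definition B :: "nat \<Rightarrow> real" where "B n = (\<Sum>j=1..nu n. (b n j)\<^sup>2)"
definition G :: "nat \<Rightarrow> 'w \<Rightarrow> real" where "G n = qf (cosker n (c n)) {1..int n}"
definition Z :: "nat \<Rightarrow> 'w \<Rightarrow> real" where
  "Z n \<omega> = Q_stat b X n \<omega> - expectation (Q_stat b X n) - G n \<omega>"

lemma cum4_z: "cum4 M (z 0) = mu4 - 3"
  unfolding cum4_def mean_z mu4_def using second_z by simp

lemma bf_sum_c: "bf_sum b A n = (\<Sum>j=1..nu n. c n j)"
  unfolding bf_sum_def c_def ..

lemma B_nonneg: "0 \<le> B n" unfolding B_def by (intro sum_nonneg) auto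

lemma v_nonneg: "0 \<le> v n"
proof (cases "n = 0")
  case True then show ?thesis by (simp add: v_def v_norm_def nu_def)
next
  case False
  then have "0 \<le> (\<Sum>j=1..nu n. (c n j)\<^sup>2) + (mu4 - 3) * (1 / n) * (\<Sum>j=1..nu n. c n j)\<^sup>2"
    using qf_cosker_moments(3)[of n "c n"] integral_nonneg_AE[of "\<lambda>\<omega>. (qf (cosker n (c n)) {1..int n} \<omega>)\<^sup>2" M] by simp
  then show ?thesis unfolding v_def v_norm_def cum4_z bf_sum_c c_def by simp
qed

text \<open>The square root in \<open>v_norm\<close> can be undone because its radicand is a second
  moment, hence nonnegative.\<close>

lemma v_square:
  assumes n: "0 < n"
  shows "(v n)\<^sup>2 = (\<Sum>j=1..nu n. (c n j)\<^sup>2) + (mu4 - 3) * (1 / n) * (\<Sum>j=1..nu n. c n j)\<^sup>2"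
    and "(v n)\<^sup>2 = expectation (\<lambda>\<omega>. (G n \<omega>)\<^sup>2)"
proof -
  note q = qf_cosker_moments(3)[OF n, of "c n", folded G_def]
  have "0 \<le> expectation (\<lambda>\<omega>. (G n \<omega>)\<^sup>2)" by simp
  then have "0 \<le> (\<Sum>j=1..nu n. (c n j)\<^sup>2) + (mu4 - 3) * (1 / n) * (\<Sum>j=1..nu n. c n j)\<^sup>2" unfolding q .
  then show s: "(v n)\<^sup>2 = (\<Sum>j=1..nu n. (c n j)\<^sup>2) + (mu4 - 3) * (1 / n) * (\<Sum>j=1..nu n. c n j)\<^sup>2"
    unfolding v_def v_norm_def cum4_z bf_sum_c c_def by simp
  show "(v n)\<^sup>2 = expectation (\<lambda>\<omega>. (G n \<omega>)\<^sup>2)" unfolding s q ..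
qed

lemma f_freq_bounds: "j \<in> {1..nu n} \<Longrightarrow> C1 \<le> spec_dens A (freq n j) \<and> spec_dens A (freq n j) \<le> C2"
  using freq_in[of j n] by (intro f_bounds) auto

lemma C2_pos: "0 < C2" using C1 f_bounds[of 0] by auto

lemma sum_c_square_bounds: "C1\<^sup>2 * B n \<le> (\<Sum>j=1..nu n. (c n j)\<^sup>2)" "(\<Sum>j=1..nu n. (c n j)\<^sup>2) \<le> C2\<^sup>2 * B n"
proof -
  show "C1\<^sup>2 * B n \<le> (\<Sum>j=1..nu n. (c n j)\<^sup>2)"
    unfolding B_def sum_distrib_left c_def power_mult_distrib
  proof (rule sum_mono)
    fix j assume "j \<in> {1..nu n}"
    then have "C1\<^sup>2 \<le> (spec_dens A (freq n j))\<^sup>2" using f_freq_bounds[of j n] C1 by (intro power_mono) auto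
    then show "C1\<^sup>2 * (b n j)\<^sup>2 \<le> (b n j)\<^sup>2 * (spec_dens A (freq n j))\<^sup>2"
      unfolding mult.commute[of "(b n j)\<^sup>2"] by (rule mult_right_mono) simp
  qed
  show "(\<Sum>j=1..nu n. (c n j)\<^sup>2) \<le> C2\<^sup>2 * B n"
    unfolding B_def sum_distrib_left c_def power_mult_distrib
  proof (rule sum_mono)
    fix j assume "j \<in> {1..nu n}"
    then have "(spec_dens A (freq n j))\<^sup>2 \<le> C2\<^sup>2" using f_freq_bounds[of j n] C1 by (intro power_mono) auto
    then show "(b n j)\<^sup>2 * (spec_dens A (freq n j))\<^sup>2 \<le> C2\<^sup>2 * (b n j)\<^sup>2"
      unfolding mult.commute[of "(b n j)\<^sup>2"] by (rule mult_right_mono) simp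
  qed
qed

text \<open>The factor one half comes from \<open>2 * nu n \<le> n\<close>. With \<open>S\<close>
  the sum of the squared \<open>c n j\<close>, it turns the worst case for a negative cumulant into
  \<open>S + (mu4 - 3) * S / 2 = (mu4 - 1) / 2 * S\<close>, which for \<open>mu4 > 1\<close> is a
  positive multiple of \<open>S\<close>.\<close>

lemma sum_square_le_half: "(\<Sum>j=1..nu n. x j)\<^sup>2 \<le> n / 2 * (\<Sum>j=1..nu n. (x j)\<^sup>2)" for x :: "nat \<Rightarrow> real"
proof -
  have "(\<Sum>j=1..nu n. x j)\<^sup>2 \<le> (\<Sum>j=1..nu n. (x j)\<^sup>2) * card {1..nu n}" by (rule sum_squared_le_sum_of_squares)
  also have "\<dots> \<le> (\<Sum>j=1..nu n. (x j)\<^sup>2) * (n / 2)"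
    using nu_le[of n] by (intro mult_left_mono sum_nonneg) auto
  finally show ?thesis by (simp add: mult.commute)
qed

text \<open>All error terms are compared with \<open>B\<close>, so \<open>v\<^sup>2\<close> must not
  be of smaller order. For \<open>mu4 = 1\<close> this is the hypothesis
  \<open>nondegenerate\<close>; for \<open>mu4 > 1\<close> the cumulant term is nonnegative or
  controlled by Cauchy-Schwarz.\<close>

lemma v_lower: "\<exists>\<kappa>>0. \<forall>\<^sub>F n in sequentially. \<kappa> * B n \<le> (v n)\<^sup>2"
proof (cases "mu4 = 1")
  case True
  then show ?thesis using nondegenerate unfolding B_def v_def mu4_def by auto
next
  case False
  then have m: "1 < mu4" using mu4_ge_1 by simp
  define \<kappa> where "\<kappa> = min 1 ((mu4 - 1) / 2) * C1\<^sup>2"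
  have "0 < \<kappa>" using m C1 by (simp add: \<kappa>_def)
  moreover have "\<forall>\<^sub>F n in sequentially. \<kappa> * B n \<le> (v n)\<^sup>2"
    using eventually_gt_at_top[of 0]
  proof eventually_elim
    case (elim n)
    let ?S = "\<Sum>j=1..nu n. (c n j)\<^sup>2"
    have S0: "0 \<le> ?S" by (intro sum_nonneg) auto
    have q: "1 / n * (\<Sum>j=1..nu n. c n j)\<^sup>2 \<le> ?S / 2"
      using sum_square_le_half[where n=n and x="c n"] elim by (simp add: field_simps)
    have "min 1 ((mu4 - 1) / 2) * ?S \<le> (v n)\<^sup>2"
    proof (cases "3 \<le> mu4")
      case True
      then have "?S \<le> (v n)\<^sup>2" unfolding v_square(1)[OF elim] by simp
      moreover have "min 1 ((mu4 - 1) / 2) * ?S \<le> 1 * ?S" by (rule mult_right_mono[OF min.cobounded1 S0])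
      ultimately show ?thesis by simp
    next
      case False
      then have "(mu4 - 3) * (?S / 2) \<le> (mu4 - 3) * (1 / n * (\<Sum>j=1..nu n. c n j)\<^sup>2)"
        by (intro mult_left_mono_neg q) auto
      then have "(mu4 - 1) / 2 * ?S \<le> (v n)\<^sup>2" unfolding v_square(1)[OF elim] by (simp add: field_simps)
      moreover have "min 1 ((mu4 - 1) / 2) * ?S \<le> (mu4 - 1) / 2 * ?S" by (rule mult_right_mono[OF min.cobounded2 S0])
      ultimately show ?thesis by simp
    qed
    moreover have "\<kappa> * B n \<le> min 1 ((mu4 - 1) / 2) * ?S"
      unfolding \<kappa>_def mult.assoc using m by (intro mult_left_mono sum_c_square_bounds) auto
    ultimately show ?case by linarith
  qed
  ultimately show ?thesis by blast
qed

lemma eventually_B_pos: "\<forall>\<^sub>F n in sequentially. 0 < B n"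
  using weights_nonzero by eventually_elim (use B_nonneg in \<open>auto simp: B_def order_less_le\<close>)

lemma eventually_v_pos: "\<forall>\<^sub>F n in sequentially. 0 < v n"
proof -
  obtain \<kappa> where k: "0 < \<kappa>" "\<forall>\<^sub>F n in sequentially. \<kappa> * B n \<le> (v n)\<^sup>2" using v_lower by blast
  from k(2) eventually_B_pos show ?thesis
  proof eventually_elim
    case (elim n)
    then have "0 < (v n)\<^sup>2" using k(1) by (meson less_le_trans mult_pos_pos)
    then show ?case using v_nonneg[of n] by (auto simp: order_less_le)
  qed
qed

lemma G_moments: "0 < n \<Longrightarrow> integrable M (\<lambda>\<omega>. (G n \<omega>)\<^sup>2)"
  unfolding G_def by (rule qf_cosker_moments(1))

lemma G_measurable [measurable]: "G n \<in> borel_measurable M" unfolding G_def by simp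

lemma Z_measurable [measurable]: "Z n \<in> borel_measurable M"
  using Q_stat_measurable[OF X A cA, of b n] unfolding Z_def[abs_def] by measurable

lemma Z_square:
  assumes n: "0 < n"
  shows "integrable M (\<lambda>\<omega>. (Z n \<omega>)\<^sup>2)"
    and "(\<And>u. u \<in> {-pi..pi} \<Longrightarrow> cmod (A u) \<le> L) \<Longrightarrow> expectation (\<lambda>\<omega>. (Z n \<omega>)\<^sup>2)
      \<le> 6 * (mu4 + 2) * L\<^sup>2 * (\<Sum>j=1..nu n. (b n j)\<^sup>2 * local_err A n j)"
proof -
  obtain L where L: "\<And>u. u \<in> {-pi..pi} \<Longrightarrow> cmod (A u) \<le> L"
    using compact_imp_bounded[OF compact_continuous_image[OF cA compact_Icc]] unfolding bounded_iff by (metis imageI)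
  show "integrable M (\<lambda>\<omega>. (Z n \<omega>)\<^sup>2)"
    unfolding Z_def G_def by (rule Q_stat_approximation(1)[where c="c n" and L=L and A=A and b=b and n=n, OF X A cA n c_def L])
  show "expectation (\<lambda>\<omega>. (Z n \<omega>)\<^sup>2) \<le> 6 * (mu4 + 2) * L\<^sup>2 * (\<Sum>j=1..nu n. (b n j)\<^sup>2 * local_err A n j)"
    if "\<And>u. u \<in> {-pi..pi} \<Longrightarrow> cmod (A u) \<le> L" for L
    unfolding Z_def G_def by (rule Q_stat_approximation(2)[where c="c n" and L=L and A=A and b=b and n=n, OF X A cA n c_def that])
qed

lemma Z_negligible: "(\<lambda>n. expectation (\<lambda>\<omega>. (Z n \<omega>)\<^sup>2) / (v n)\<^sup>2) \<longlonglongrightarrow> 0"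
proof -
  obtain L where L: "\<And>u. u \<in> {-pi..pi} \<Longrightarrow> cmod (A u) \<le> L"
    using compact_imp_bounded[OF compact_continuous_image[OF cA compact_Icc]] unfolding bounded_iff by (metis imageI)
  obtain \<kappa> where k: "0 < \<kappa>" "\<forall>\<^sub>F n in sequentially. \<kappa> * B n \<le> (v n)\<^sup>2" using v_lower by blast
  let ?s = "\<lambda>n. \<Sum>j=1..nu n. (b n j)\<^sup>2 * local_err A n j"
  have "(\<lambda>n. 6 * (mu4 + 2) * L\<^sup>2 / \<kappa> * (?s n / B n)) \<longlonglongrightarrow> 6 * (mu4 + 2) * L\<^sup>2 / \<kappa> * 0"
    unfolding B_def by (intro tendsto_intros weighted_local_err_tendsto_0 cA weights weights_nonzero)
  then have lim: "(\<lambda>n. 6 * (mu4 + 2) * L\<^sup>2 / \<kappa> * (?s n / B n)) \<longlonglongrightarrow> 0" by simp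
  show ?thesis
  proof (rule tendsto_sandwich[OF _ _ tendsto_const lim])
    show "\<forall>\<^sub>F n in sequentially. 0 \<le> expectation (\<lambda>\<omega>. (Z n \<omega>)\<^sup>2) / (v n)\<^sup>2" by (intro always_eventually allI) simp
    show "\<forall>\<^sub>F n in sequentially. expectation (\<lambda>\<omega>. (Z n \<omega>)\<^sup>2) / (v n)\<^sup>2 \<le> 6 * (mu4 + 2) * L\<^sup>2 / \<kappa> * (?s n / B n)"
      using k(2) eventually_B_pos eventually_gt_at_top[of 0]
    proof eventually_elim
      case (elim n)
      have e0: "0 \<le> expectation (\<lambda>\<omega>. (Z n \<omega>)\<^sup>2)" by simp
      have "expectation (\<lambda>\<omega>. (Z n \<omega>)\<^sup>2) / (v n)\<^sup>2 \<le> expectation (\<lambda>\<omega>. (Z n \<omega>)\<^sup>2) / (\<kappa> * B n)"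
      proof (intro divide_left_mono e0 elim(1) mult_pos_pos)
        show "0 < \<kappa>" "0 < B n" using k(1) elim by auto
        then have "0 < \<kappa> * B n" by simp
        then show "0 < (v n)\<^sup>2" using elim(1) by linarith
      qed
      also have "\<dots> \<le> 6 * (mu4 + 2) * L\<^sup>2 * ?s n / (\<kappa> * B n)"
        using elim k(1) by (intro divide_right_mono Z_square(2) L) auto
      finally show ?case by simp
    qed
  qed
qed

text \<open>The centred statistic is \<open>G + Z\<close> with \<open>G\<close> of variance
  \<open>v\<^sup>2\<close>. The mixed term is treated by weighted AM-GM, half of the tolerance going
  to \<open>G\<close> and half to \<open>Z\<close>.\<close>

lemma variance_asymptotics: "(\<lambda>n. variance (Q_stat b X n) - (v n)\<^sup>2) \<in> o(\<lambda>n. (v n)\<^sup>2)"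
proof (rule landau_o.smallI)
  fix e :: real assume e: "0 < e"
  define l where "l = e / 2"
  have l: "0 < l" using e by (simp add: l_def)
  have "(\<lambda>n. (1 + 1 / l) * (expectation (\<lambda>\<omega>. (Z n \<omega>)\<^sup>2) / (v n)\<^sup>2)) \<longlonglongrightarrow> (1 + 1 / l) * 0"
    by (intro tendsto_intros Z_negligible)
  then have "\<forall>\<^sub>F n in sequentially. (1 + 1 / l) * (expectation (\<lambda>\<omega>. (Z n \<omega>)\<^sup>2) / (v n)\<^sup>2) < e / 2"
    using e by (intro order_tendstoD) auto
  with eventually_v_pos eventually_gt_at_top[of 0]
  show "\<forall>\<^sub>F n in sequentially. norm (variance (Q_stat b X n) - (v n)\<^sup>2) \<le> e * norm ((v n)\<^sup>2)"
  proof eventually_elim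
    case (elim n)
    have gz: "integrable M (\<lambda>\<omega>. (G n \<omega>)\<^sup>2)" "integrable M (\<lambda>\<omega>. (Z n \<omega>)\<^sup>2)" using G_moments Z_square(1) elim by auto
    have sq: "(Q_stat b X n \<omega> - expectation (Q_stat b X n))\<^sup>2 = (G n \<omega> + Z n \<omega>)\<^sup>2" for \<omega> by (simp add: Z_def)
    have bd: "\<bar>(G n \<omega> + Z n \<omega>)\<^sup>2 - (G n \<omega>)\<^sup>2\<bar> \<le> (1 + 1 / l) * (Z n \<omega>)\<^sup>2 + l * (G n \<omega>)\<^sup>2" for \<omega>
      using abs_square_diff_le[OF l, of "G n \<omega> + Z n \<omega>" "G n \<omega>"] by simp
    have ib: "integrable M (\<lambda>\<omega>. (1 + 1 / l) * (Z n \<omega>)\<^sup>2 + l * (G n \<omega>)\<^sup>2)" using gz by simp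
    have id: "integrable M (\<lambda>\<omega>. (G n \<omega> + Z n \<omega>)\<^sup>2 - (G n \<omega>)\<^sup>2)"
      by (rule Bochner_Integration.integrable_bound[OF ib]) (use bd in \<open>auto intro!: AE_I2 order_trans[OF _ abs_ge_self]\<close>)
    have isq: "integrable M (\<lambda>\<omega>. (G n \<omega> + Z n \<omega>)\<^sup>2)" using Bochner_Integration.integrable_add[OF id gz(1)] by simp
    have vs: "(v n)\<^sup>2 = expectation (\<lambda>\<omega>. (G n \<omega>)\<^sup>2)" by (rule v_square(2)[OF elim(2)])
    have vq: "variance (Q_stat b X n) = expectation (\<lambda>\<omega>. (G n \<omega> + Z n \<omega>)\<^sup>2)"
      by (rule Bochner_Integration.integral_cong[OF refl sq])
    have 1: "variance (Q_stat b X n) - (v n)\<^sup>2 = expectation (\<lambda>\<omega>. (G n \<omega> + Z n \<omega>)\<^sup>2 - (G n \<omega>)\<^sup>2)"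
      unfolding vq vs by (rule Bochner_Integration.integral_diff[OF isq gz(1), symmetric])
    have 2: "norm (expectation (\<lambda>\<omega>. (G n \<omega> + Z n \<omega>)\<^sup>2 - (G n \<omega>)\<^sup>2)) \<le> expectation (\<lambda>\<omega>. (1 + 1 / l) * (Z n \<omega>)\<^sup>2 + l * (G n \<omega>)\<^sup>2)"
      by (rule norm_integral_le[OF borel_measurable_integrable[OF id] ib]) (rule bd[folded real_norm_def])
    have 3: "expectation (\<lambda>\<omega>. (1 + 1 / l) * (Z n \<omega>)\<^sup>2 + l * (G n \<omega>)\<^sup>2) = (1 + 1 / l) * expectation (\<lambda>\<omega>. (Z n \<omega>)\<^sup>2) + l * (v n)\<^sup>2"
      unfolding vs using gz by simp
    have "(1 + 1 / l) * expectation (\<lambda>\<omega>. (Z n \<omega>)\<^sup>2) = (1 + 1 / l) * (expectation (\<lambda>\<omega>. (Z n \<omega>)\<^sup>2) / (v n)\<^sup>2) * (v n)\<^sup>2"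
      using elim(1) by simp
    moreover have "(1 + 1 / l) * (expectation (\<lambda>\<omega>. (Z n \<omega>)\<^sup>2) / (v n)\<^sup>2) * (v n)\<^sup>2 \<le> e / 2 * (v n)\<^sup>2"
      using elim(3) by (intro mult_right_mono) auto
    moreover have "l * (v n)\<^sup>2 = e / 2 * (v n)\<^sup>2" by (simp add: l_def)
    moreover have "e * (v n)\<^sup>2 = e / 2 * (v n)\<^sup>2 + e / 2 * (v n)\<^sup>2" by simp
    ultimately have 4: "(1 + 1 / l) * expectation (\<lambda>\<omega>. (Z n \<omega>)\<^sup>2) + l * (v n)\<^sup>2 \<le> e * (v n)\<^sup>2"
      by (simp only:)
    have "norm (variance (Q_stat b X n) - (v n)\<^sup>2) \<le> e * (v n)\<^sup>2"
      unfolding 1 by (rule order_trans[OF 2]) (use 3 4 in linarith)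
    then show ?case by (simp only: real_norm_def abs_power2)
  qed
qed

text \<open>Dividing the weights by \<open>v n\<close> gives unit variance, a sum of squares of at
  most \<open>C2\<^sup>2 / \<kappa>\<close> and a maximal weight of the order of the ratio in the
  weight condition.\<close>

lemma G_char_tendsto:
  "(\<lambda>n. expectation (\<lambda>\<omega>. iexp (t * (G n \<omega> / v n)))) \<longlonglongrightarrow> complex_of_real (exp (- (t\<^sup>2) / 2))"
proof -
  obtain \<kappa> where k: "0 < \<kappa>" "\<forall>\<^sub>F n in sequentially. \<kappa> * B n \<le> (v n)\<^sup>2" using v_lower by blast
  define m where "m n = Max ((\<lambda>j. \<bar>b n j\<bar>) ` {1..nu n})" for n
  \<comment> \<open>The absolute value keeps \<open>\<epsilon>\<close> nonnegative also where the
    index range is empty and \<open>Max\<close> is unspecified.\<close>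
  define \<epsilon> where "\<epsilon> n = \<bar>C2 / sqrt \<kappa> * (m n / sqrt (B n))\<bar>" for n
  have "\<epsilon> \<longlonglongrightarrow> \<bar>C2 / sqrt \<kappa> * 0\<bar>"
    unfolding \<epsilon>_def[abs_def] m_def B_def by (intro tendsto_intros weights)
  then have e0: "\<epsilon> \<longlonglongrightarrow> 0" by simp
  have "(\<lambda>n. expectation (\<lambda>\<omega>. iexp (t * qf (cosker n (\<lambda>j. c n j / v n)) {1..int n} \<omega>))) \<longlonglongrightarrow> complex_of_real (exp (- (t\<^sup>2) / 2))"
  proof (rule qf_cosker_char_tendsto[of "C2\<^sup>2 / \<kappa>" \<epsilon>])
    show "0 < C2\<^sup>2 / \<kappa>" using k C2_pos by simp
    show "\<forall>\<^sub>F n in sequentially. (\<Sum>j=1..nu n. (c n j / v n)\<^sup>2) \<le> C2\<^sup>2 / \<kappa> \<and> (\<forall>j\<in>{1..nu n}. \<bar>c n j / v n\<bar> \<le> \<epsilon> n)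
      \<and> (\<Sum>j=1..nu n. (c n j / v n)\<^sup>2) + (mu4 - 3) * (1 / n) * (\<Sum>j=1..nu n. c n j / v n)\<^sup>2 = 1"
      using k(2) eventually_v_pos eventually_B_pos eventually_gt_at_top[of 0]
    proof eventually_elim
      case (elim n)
      have "(\<Sum>j=1..nu n. (c n j / v n)\<^sup>2) = (\<Sum>j=1..nu n. (c n j)\<^sup>2) / (v n)\<^sup>2"
        by (simp add: power_divide sum_divide_distrib)
      moreover have "(\<Sum>j=1..nu n. c n j / v n)\<^sup>2 = (\<Sum>j=1..nu n. c n j)\<^sup>2 / (v n)\<^sup>2"
        by (simp add: power_divide flip: sum_divide_distrib)
      moreover have "(\<Sum>j=1..nu n. (c n j)\<^sup>2) / (v n)\<^sup>2 \<le> C2\<^sup>2 / \<kappa>"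
      proof -
        have "(\<Sum>j=1..nu n. (c n j)\<^sup>2) / (v n)\<^sup>2 \<le> C2\<^sup>2 * B n / (\<kappa> * B n)"
          using elim k(1) by (intro frac_le sum_c_square_bounds) auto
        then show ?thesis using elim by simp
      qed
      moreover have "(\<Sum>j=1..nu n. (c n j)\<^sup>2) / (v n)\<^sup>2 + (mu4 - 3) * (1 / n) * ((\<Sum>j=1..nu n. c n j)\<^sup>2 / (v n)\<^sup>2) = 1"
      proof -
        have "(\<Sum>j=1..nu n. (c n j)\<^sup>2) / (v n)\<^sup>2 + (mu4 - 3) * (1 / n) * ((\<Sum>j=1..nu n. c n j)\<^sup>2 / (v n)\<^sup>2) = (v n)\<^sup>2 / (v n)\<^sup>2"
          unfolding v_square(1)[OF elim(4)] by (simp only: add_divide_distrib times_divide_eq_right)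
        then show ?thesis using elim by simp
      qed
      moreover have "\<bar>c n j / v n\<bar> \<le> \<epsilon> n" if j: "j \<in> {1..nu n}" for j
      proof -
        have mj: "\<bar>b n j\<bar> \<le> m n" unfolding m_def using j by (intro Max_ge) auto
        have f: "0 \<le> spec_dens A (freq n j)" "spec_dens A (freq n j) \<le> C2" using f_freq_bounds[OF j] C1 by auto
        have "sqrt (\<kappa> * B n) \<le> v n" using elim by (intro real_le_lsqrt) auto
        moreover have "0 < sqrt (\<kappa> * B n)" using k(1) elim by simp
        moreover have "\<bar>c n j\<bar> \<le> m n * C2" unfolding c_def abs_mult using mj f by (intro mult_mono) auto
        ultimately have "\<bar>c n j\<bar> / v n \<le> m n * C2 / sqrt (\<kappa> * B n)"
          using mj C2_pos by (intro frac_le) auto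
        also have "\<dots> \<le> \<epsilon> n" unfolding \<epsilon>_def by (rule order_trans[OF _ abs_ge_self]) (simp add: real_sqrt_mult mult.commute)
        finally show ?thesis using elim by (simp add: abs_divide)
      qed
      ultimately show ?case by (simp only:) blast
    qed
  qed (use e0 in \<open>auto simp: \<epsilon>_def\<close>)
  then show ?thesis
  proof (rule Lim_transform_eventually)
    show "\<forall>\<^sub>F n in sequentially. expectation (\<lambda>\<omega>. iexp (t * qf (cosker n (\<lambda>j. c n j / v n)) {1..int n} \<omega>)) = expectation (\<lambda>\<omega>. iexp (t * (G n \<omega> / v n)))"
      using eventually_gt_at_top[of 0]
    proof eventually_elim
      case (elim n)
      have "qf (cosker n (\<lambda>j. c n j / v n)) {1..int n} \<omega> = G n \<omega> / v n" for \<omega>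
        unfolding G_def qf_cosker[OF elim] by (simp add: sum_divide_distrib)
      then show ?case by simp
    qed
  qed
qed

text \<open>The centring \<open>m\<close> is left free, so that the mean and the weighted sum of
  spectral densities are two instances. Replacing \<open>G n / v n\<close> by the standardized
  statistic moves the characteristic function at \<open>t\<close> by at most \<open>|t|\<close>
  times an L1 distance.\<close>

lemma clt_centred:
  assumes m: "(\<lambda>n. (expectation (Q_stat b X n) - m n) / v n) \<longlonglongrightarrow> 0"
  shows "tends_to_std_normal M (\<lambda>n \<omega>. inverse (v n) * (Q_stat b X n \<omega> - m n))"
proof -
  define Y where "Y n \<omega> = inverse (v n) * (Q_stat b X n \<omega> - m n)" for n \<omega>
  have [measurable]: "Q_stat b X n \<in> borel_measurable M" for n by (rule Q_stat_measurable[OF X A cA])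
  have [measurable]: "Y n \<in> borel_measurable M" for n unfolding Y_def by measurable
  have ie: "integrable M (\<lambda>\<omega>. iexp (t * F \<omega>))" if [measurable]: "F \<in> borel_measurable M" for F :: "'w \<Rightarrow> real" and t
    by (rule integrable_const_bound[where B=1]) auto
  have conv: "(\<lambda>n. expectation (\<lambda>\<omega>. iexp (t * Y n \<omega>))) \<longlonglongrightarrow> complex_of_real (exp (- (t\<^sup>2) / 2))" for t
  proof -
    let ?d = "\<lambda>n. (expectation (Q_stat b X n) - m n) / v n"
    define g where "g n = \<bar>t\<bar> * (sqrt (expectation (\<lambda>\<omega>. (Z n \<omega>)\<^sup>2) / (v n)\<^sup>2) + \<bar>?d n\<bar>)" for n
    have "g \<longlonglongrightarrow> \<bar>t\<bar> * (sqrt 0 + \<bar>0\<bar>)" unfolding g_def[abs_def] by (intro tendsto_intros Z_negligible m)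
    then have g0: "g \<longlonglongrightarrow> 0" by simp
    have "(\<lambda>n. expectation (\<lambda>\<omega>. iexp (t * Y n \<omega>)) - expectation (\<lambda>\<omega>. iexp (t * (G n \<omega> / v n)))) \<longlonglongrightarrow> 0"
    proof (rule Lim_null_comparison[OF _ g0])
      show "\<forall>\<^sub>F n in sequentially. norm (expectation (\<lambda>\<omega>. iexp (t * Y n \<omega>)) - expectation (\<lambda>\<omega>. iexp (t * (G n \<omega> / v n)))) \<le> g n"
        using eventually_v_pos eventually_gt_at_top[of 0]
      proof eventually_elim
        case (elim n)
        have Z2: "integrable M (\<lambda>\<omega>. (Z n \<omega>)\<^sup>2)" using Z_square(1) elim by simp
        have iZ: "integrable M (Z n)" and eZ: "expectation (\<lambda>\<omega>. \<bar>Z n \<omega>\<bar>) \<le> sqrt (expectation (\<lambda>\<omega>. (Z n \<omega>)\<^sup>2))"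
          using expectation_abs_le_sqrt[OF Z_measurable Z2] by auto
        have 1: "expectation (\<lambda>\<omega>. iexp (t * Y n \<omega>)) - expectation (\<lambda>\<omega>. iexp (t * (G n \<omega> / v n)))
          = expectation (\<lambda>\<omega>. iexp (t * Y n \<omega>) - iexp (t * (G n \<omega> / v n)))"
          by (rule Bochner_Integration.integral_diff[symmetric]) (rule ie; measurable)+
        have 2: "norm (expectation (\<lambda>\<omega>. iexp (t * Y n \<omega>) - iexp (t * (G n \<omega> / v n)))) \<le> expectation (\<lambda>\<omega>. \<bar>t\<bar> * (\<bar>Z n \<omega>\<bar> / v n + \<bar>?d n\<bar>))"
        proof (rule norm_integral_le)
          show "integrable M (\<lambda>\<omega>. \<bar>t\<bar> * (\<bar>Z n \<omega>\<bar> / v n + \<bar>?d n\<bar>))" using iZ by simp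
          fix \<omega>
          define y where "y = Z n \<omega> / v n + ?d n"
          have Y: "Y n \<omega> = G n \<omega> / v n + y"
            unfolding Y_def Z_def y_def using elim by (simp add: field_simps)
          have "iexp (t * Y n \<omega>) = iexp (t * (G n \<omega> / v n)) * iexp (t * y)"
            unfolding Y distrib_left of_real_add exp_add ..
          then have "iexp (t * Y n \<omega>) - iexp (t * (G n \<omega> / v n)) = iexp (t * (G n \<omega> / v n)) * (iexp (t * y) - 1)"
            by (simp only: right_diff_distrib mult_1_right)
          then have "norm (iexp (t * Y n \<omega>) - iexp (t * (G n \<omega> / v n))) = norm (iexp (t * y) - 1)"
            by (simp only: norm_mult norm_exp_i_times mult_1_left)
          moreover have "norm (iexp (t * y) - 1) \<le> \<bar>t * y\<bar>" by (rule norm_iexp_minus_1_le)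
          moreover have "\<bar>t * y\<bar> \<le> \<bar>t\<bar> * (\<bar>Z n \<omega>\<bar> / v n + \<bar>?d n\<bar>)"
            unfolding abs_mult y_def using abs_triangle_ineq[of "Z n \<omega> / v n" "?d n"] elim by (intro mult_left_mono) auto
          ultimately show "norm (iexp (t * Y n \<omega>) - iexp (t * (G n \<omega> / v n))) \<le> \<bar>t\<bar> * (\<bar>Z n \<omega>\<bar> / v n + \<bar>?d n\<bar>)"
            by linarith
        qed measurable
        have 3: "expectation (\<lambda>\<omega>. \<bar>t\<bar> * (\<bar>Z n \<omega>\<bar> / v n + \<bar>?d n\<bar>)) = \<bar>t\<bar> * (expectation (\<lambda>\<omega>. \<bar>Z n \<omega>\<bar>) / v n + \<bar>?d n\<bar>)"
          using iZ by (simp add: prob_space)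
        have 4: "expectation (\<lambda>\<omega>. \<bar>Z n \<omega>\<bar>) / v n \<le> sqrt (expectation (\<lambda>\<omega>. (Z n \<omega>)\<^sup>2) / (v n)\<^sup>2)"
          using divide_right_mono[OF eZ, of "v n"] elim by (simp add: real_sqrt_divide)
        have 5: "\<bar>t\<bar> * (expectation (\<lambda>\<omega>. \<bar>Z n \<omega>\<bar>) / v n + \<bar>?d n\<bar>) \<le> g n"
          unfolding g_def using 4 by (intro mult_left_mono add_right_mono) auto
        show ?case unfolding 1 by (rule order_trans[OF 2]) (unfold 3, rule 5)
      qed
    qed
    from tendsto_add[OF this G_char_tendsto[of t]] show ?thesis by simp
  qed
  show ?thesis
    unfolding tends_to_std_normal_def Y_def[symmetric]
  proof (rule levy_continuity)
    show "real_distribution (distr M borel (Y n))" for n by simp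
    show "real_distribution std_normal_distribution" by (rule real_dist_normal_dist)
    show "(\<lambda>n. char (distr M borel (Y n)) t) \<longlonglongrightarrow> char std_normal_distribution t" for t
      unfolding char_std_normal_distribution using conv[of t] by (simp add: char_def integral_distr)
  qed
qed

text \<open>The Fejer means err by \<open>n powr (-\<gamma>)\<close> uniformly, and Cauchy-Schwarz
  bounds the sum of the absolute weights by \<open>sqrt n * sqrt (B n)\<close>. The product is of
  order \<open>n powr (1/2 - \<gamma>) * v n\<close>, which is where \<open>\<beta> > 1/2\<close>
  enters.\<close>

lemma mean_asymptotics:
  assumes \<beta>: "1 / 2 < \<beta>" "\<beta> \<le> 1" and lip: "(\<lambda>u. complex_of_real (spec_dens A u)) \<in> Lipschitz_class \<beta>"
  shows "(\<lambda>n. (expectation (Q_stat b X n) - bf_sum b A n) / v n) \<longlonglongrightarrow> 0"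
proof -
  obtain C where C': "\<forall>u\<in>{-pi..pi}. \<forall>w\<in>{-pi..pi}.
      cmod (complex_of_real (spec_dens A u) - complex_of_real (spec_dens A w)) \<le> C * \<bar>u - w\<bar> powr \<beta>"
    using lip unfolding Lipschitz_class_def by blast
  have C: "\<bar>spec_dens A u - spec_dens A w\<bar> \<le> C * \<bar>u - w\<bar> powr \<beta>" if "u \<in> {-pi..pi}" "w \<in> {-pi..pi}" for u w
    using C' that by (metis norm_of_real of_real_diff)
  have cf: "continuous_on {-pi..pi} (spec_dens A)" unfolding spec_dens_def by (intro continuous_intros cA) auto
  obtain K \<gamma> where \<gamma>: "1 / 2 < \<gamma>" and K: "\<And>n j. j \<in> {1..nu n} \<Longrightarrow>
    \<bar>integral {-pi..pi} (\<lambda>u. fejer n j u * spec_dens A u) / (2 * pi) - spec_dens A (freq n j)\<bar> \<le> K * real n powr - \<gamma>"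
    using fejer_mean_error[OF cf spec_dens_even[OF A cA] \<beta> C] by blast
  obtain \<kappa> where k: "0 < \<kappa>" "\<forall>\<^sub>F n in sequentially. \<kappa> * B n \<le> (v n)\<^sup>2" using v_lower by blast
  have "(\<lambda>n. \<bar>K\<bar> / sqrt \<kappa> * real n powr (1 / 2 - \<gamma>)) \<longlonglongrightarrow> \<bar>K\<bar> / sqrt \<kappa> * 0"
    using \<gamma> by (intro tendsto_intros tendsto_neg_powr filterlim_real_sequentially) auto
  then have lim: "(\<lambda>n. \<bar>K\<bar> / sqrt \<kappa> * real n powr (1 / 2 - \<gamma>)) \<longlonglongrightarrow> 0" by simp
  show ?thesis
  proof (rule Lim_null_comparison[OF _ lim])
    show "\<forall>\<^sub>F n in sequentially. norm ((expectation (Q_stat b X n) - bf_sum b A n) / v n) \<le> \<bar>K\<bar> / sqrt \<kappa> * real n powr (1 / 2 - \<gamma>)"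
      using k(2) eventually_v_pos eventually_B_pos eventually_gt_at_top[of 0]
    proof eventually_elim
      case (elim n)
      define I where "I j = integral {-pi..pi} (\<lambda>u. fejer n j u * spec_dens A u) / (2 * pi)" for j
      define d where "d = expectation (Q_stat b X n) - bf_sum b A n"
      have d: "d = (\<Sum>j=1..nu n. b n j * (I j - spec_dens A (freq n j)))"
        unfolding d_def I_def expectation_Q_stat[OF X A cA] bf_sum_def sum_subtractf[symmetric] right_diff_distrib ..
      have 1: "\<bar>d\<bar> \<le> (\<Sum>j=1..nu n. \<bar>b n j\<bar> * (\<bar>K\<bar> * real n powr - \<gamma>))"
        unfolding d
      proof (rule order_trans[OF sum_abs sum_mono])
        fix j assume j: "j \<in> {1..nu n}"
        have "K * real n powr - \<gamma> \<le> \<bar>K\<bar> * real n powr - \<gamma>" by (rule mult_right_mono) auto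
        then have "\<bar>I j - spec_dens A (freq n j)\<bar> \<le> \<bar>K\<bar> * real n powr - \<gamma>" using K[OF j] unfolding I_def by linarith
        then show "\<bar>b n j * (I j - spec_dens A (freq n j))\<bar> \<le> \<bar>b n j\<bar> * (\<bar>K\<bar> * real n powr - \<gamma>)"
          unfolding abs_mult by (rule mult_left_mono) simp
      qed
      have 2: "(\<Sum>j=1..nu n. \<bar>b n j\<bar>) \<le> sqrt n * sqrt (B n)"
      proof -
        have "(\<Sum>j=1..nu n. \<bar>b n j\<bar>)\<^sup>2 \<le> n / 2 * B n"
          using sum_square_le_half[where n=n and x="\<lambda>j. \<bar>b n j\<bar>"] by (simp add: B_def)
        also have "\<dots> \<le> n * B n" using B_nonneg[of n] by (intro mult_right_mono) auto
        finally show ?thesis unfolding real_sqrt_mult[symmetric] by (rule real_le_rsqrt)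
      qed
      have 3: "sqrt (B n) \<le> v n / sqrt \<kappa>"
      proof -
        have "sqrt \<kappa> * sqrt (B n) \<le> v n" unfolding real_sqrt_mult[symmetric] using elim by (intro real_le_lsqrt) auto
        then show ?thesis using k(1) by (simp add: pos_le_divide_eq mult.commute)
      qed
      have 4: "sqrt n * real n powr - \<gamma> = real n powr (1 / 2 - \<gamma>)"
        using elim by (simp add: powr_half_sqrt[symmetric] powr_add[symmetric])
      have "\<bar>d\<bar> \<le> (\<Sum>j=1..nu n. \<bar>b n j\<bar>) * (\<bar>K\<bar> * real n powr - \<gamma>)"
        using 1 unfolding sum_distrib_right .
      also have "\<dots> \<le> (sqrt n * sqrt (B n)) * (\<bar>K\<bar> * real n powr - \<gamma>)" by (rule mult_right_mono[OF 2]) simp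
      also have "\<dots> = \<bar>K\<bar> * (sqrt n * real n powr - \<gamma>) * sqrt (B n)" by (simp only: mult_ac)
      also have "\<dots> \<le> \<bar>K\<bar> * (sqrt n * real n powr - \<gamma>) * (v n / sqrt \<kappa>)" by (rule mult_left_mono[OF 3]) simp
      also have "\<dots> = \<bar>K\<bar> / sqrt \<kappa> * real n powr (1 / 2 - \<gamma>) * v n" unfolding 4 by simp
      finally have "\<bar>d\<bar> / v n \<le> \<bar>K\<bar> / sqrt \<kappa> * real n powr (1 / 2 - \<gamma>)" using elim(2) by (simp add: pos_divide_le_eq)
      then show ?case unfolding d_def[symmetric] using elim(2) by (simp add: abs_divide)
    qed
  qed
qed

lemma mean_smallo:
  assumes "(\<lambda>n. (expectation (Q_stat b X n) - bf_sum b A n) / v n) \<longlonglongrightarrow> 0"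
  shows "(\<lambda>n. expectation (Q_stat b X n) - bf_sum b A n) \<in> o(v)"
  by (rule smalloI_tendsto[OF assms]) (use eventually_v_pos in \<open>auto elim: eventually_mono\<close>)

end

theorem theorem3p1:
  fixes M :: "'w measure"
    and \<zeta> X :: "int \<Rightarrow> 'w \<Rightarrow> real"
    and a :: "nat \<Rightarrow> real"
    and b :: "nat \<Rightarrow> nat \<Rightarrow> real"
    and A :: "real \<Rightarrow> complex"
    and C1 C2 :: real
  assumes prob: "prob_space M"
    and indep: "prob_space.indep_vars M (\<lambda>_. borel) \<zeta> UNIV"
    and ident: "\<And>j. distr M borel (\<zeta> j) = distr M borel (\<zeta> 0)"
    and fourth: "integrable M (\<lambda>\<omega>. \<zeta> 0 \<omega> ^ 4)"
    and mean: "prob_space.expectation M (\<zeta> 0) = 0"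
    and second: "prob_space.expectation M (\<lambda>\<omega>. (\<zeta> 0 \<omega>)\<^sup>2) = 1"
    and coeffs: "summable (\<lambda>k. (a k)\<^sup>2)"
    and X: "linear_process M a \<zeta> X"
    and weights_nonzero: "\<forall>\<^sub>F n in sequentially. (\<Sum>j=1..nu n. (b n j)\<^sup>2) \<noteq> 0"
    and weights: "(\<lambda>n. Max ((\<lambda>j. \<bar>b n j\<bar>) ` {1..nu n}) / sqrt (\<Sum>j=1..nu n. (b n j)\<^sup>2))
                    \<longlonglongrightarrow> 0"
    and A: "transfer_function a A"
    and A_cont: "continuous_on {-pi..pi} A"
    and C1: "0 < C1"
    and f_bounds: "\<And>u. u \<in> {-pi..pi} \<Longrightarrow> C1 \<le> spec_dens A u \<and> spec_dens A u \<le> C2"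
    and nondegenerate:
      "prob_space.expectation M (\<lambda>\<omega>. \<zeta> 0 \<omega> ^ 4) = 1 \<Longrightarrow>
         \<exists>c>0. \<forall>\<^sub>F n in sequentially. c * (\<Sum>j=1..nu n. (b n j)\<^sup>2) \<le> (v_norm M (\<zeta> 0) b A n)\<^sup>2"
  shows "(\<lambda>n. prob_space.variance M (Q_stat b X n) - (v_norm M (\<zeta> 0) b A n)\<^sup>2)
           \<in> o(\<lambda>n. (v_norm M (\<zeta> 0) b A n)\<^sup>2)
    \<and> tends_to_std_normal M
         (\<lambda>n \<omega>. inverse (v_norm M (\<zeta> 0) b A n)
            * (Q_stat b X n \<omega> - prob_space.expectation M (Q_stat b X n)))
    \<and> (\<forall>\<beta>. 1/2 < \<beta> \<and> \<beta> \<le> 1 \<and> (\<lambda>u. complex_of_real (spec_dens A u)) \<in> Lipschitz_class \<beta> \<longrightarrow>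
         (\<lambda>n. prob_space.expectation M (Q_stat b X n) - bf_sum b A n)
            \<in> o(\<lambda>n. v_norm M (\<zeta> 0) b A n)
         \<and> tends_to_std_normal M
              (\<lambda>n \<omega>. inverse (v_norm M (\<zeta> 0) b A n) * (Q_stat b X n \<omega> - bf_sum b A n)))"
proof -
  interpret weighted_periodogram M \<zeta> a X b A C1 C2
    by (intro weighted_periodogram.intro iid_innovations.intro prob
        iid_innovations_axioms.intro weighted_periodogram_axioms.intro) (fact assms)+
  have v: "v_norm M (\<zeta> 0) b A = v" unfolding v_def[abs_def] ..
  show ?thesis unfolding v
  proof (intro conjI allI impI)
    show "(\<lambda>n. variance (Q_stat b X n) - (v n)\<^sup>2) \<in> o(\<lambda>n. (v n)\<^sup>2)" by (rule variance_asymptotics)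
    show "tends_to_std_normal M (\<lambda>n \<omega>. inverse (v n) * (Q_stat b X n \<omega> - expectation (Q_stat b X n)))"
      by (rule clt_centred) simp
    fix \<beta> assume \<beta>: "1/2 < \<beta> \<and> \<beta> \<le> 1 \<and> (\<lambda>u. complex_of_real (spec_dens A u)) \<in> Lipschitz_class \<beta>"
    then have m: "(\<lambda>n. (expectation (Q_stat b X n) - bf_sum b A n) / v n) \<longlonglongrightarrow> 0" by (intro mean_asymptotics) auto
    show "(\<lambda>n. expectation (Q_stat b X n) - bf_sum b A n) \<in> o(v)" by (rule mean_smallo[OF m])
    show "tends_to_std_normal M (\<lambda>n \<omega>. inverse (v n) * (Q_stat b X n \<omega> - bf_sum b A n))" by (rule clt_centred[OF m])
  qed
qed

end
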